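(* Let $d\ge 2$, let the collision kernel $B$ be of hard-potential type with angular cutoff, as specified in the context, let $T>0$, and let $f\in C([0,T];L^1(\mathbb{T}^d\times\mathbb{R}^d))$, $f\ge 0$, be a dissipative renormalized solution (in the sense defined in the context) of the Boltzmann equation $(\partial_t+v\cdot\nabla_x)f=Q(f)$ with initial condition $$f(x,v,0)=f_0(x,v)\le M_0(v)\quad\text{for a.a. }(x,v)\in\mathbb{T}^d\times\mathbb{R}^d,$$ where $M_0(v)=e^{-a_0|v|^2+c_0}$, $a_0>0$, $c_0\in\mathbb{R}$. Assume that $f$ satisfies the estimates $$\int_{\mathbb{R}^d}f(x,v,t)\,dv\ge\rho_0,\qquad (x,t)\in\mathbb{T}^d\times[0,T],$$ and $$\sup_{(x,t)\in\mathbb{T}^d\times[0,T]}\|f(x,v,t)\|_{L^\infty_v}\le C_0,\qquad \sup_{(x,t)\in\mathbb{T}^d\times[0,T]}\int_{\mathbb{R}^d}\frac{f(x,v,t)}{M_1(v)}\,dv\le C_1,$$ where $M_1(v)=e^{-a_1|v|^2+c_1}$ and $0<a_1<a_0$, $c_1\in\mathbb{R}$, $\rho_0>0$, $C_0$, $C_1$ are constants. Then for any $0<a<a_1$ there is a constant $c$, depending (for the given dimension and kernel $B$) only on $a,a_0,c_0,a_1,c_1,\rho_0,C_0$ and $C_1$, such that for any $t\in[0,T]$ $$f(x,v,t)\le M(v)\quad\text{for a.a. }(x,v)\in\mathbb{T}^d\times\mathbb{R}^d,$$ where $M(v)=e^{-a|v|^2+c}$.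
   Context: $\mathbb{T}^d$ is the $d$-dimensional torus (unit hypercube with periodic boundary conditions). The collision operator is $$Q(f)(x,v,t)=\int_{\mathbb{R}^d}\int_{S^{d-1}}(f'_*f'-f_*f)\,B(v-v_*,\sigma)\,d\sigma\,dv_*,$$ where $f=f(x,v,t)$, $f_*=f(x,v_*,t)$, $f'=f(x,v',t)$, $f'_*=f(x,v'_*,t)$, $v'=\frac{v+v_*}{2}+\frac{|v-v_*|}{2}\sigma$, $v'_*=\frac{v+v_*}{2}-\frac{|v-v_*|}{2}\sigma$. Assumptions on $B$: $B(v-v_*,\sigma)=|v-v_*|^\beta h(\cos\vartheta)$, $\cos\vartheta=\frac{(v-v_* )\cdot\sigma}{|v-v_*|}$, where $0<\beta\le 1$ is a constant and $h$ is a nonnegative (measurable) function on $(-1,1)$ such that $h(z)+h(-z)$ is nondecreasing on $(0,1)$; $0\le h(\cos\vartheta)\sin^\alpha\vartheta\le C$ for $\vartheta\in(0,\pi)$, where $\alpha<d-1$ and $C$ are constants; and $\int_{S^{d-1}}h(\cos\vartheta)\,d\sigma=1$. Set $\overline{B}(v-v_*,\sigma)=(B(v-v_*,\sigma)+B(v-v_*,-\sigma))1_{\{\cos\vartheta>0\}}$ and define the bilinear forms $$Q^+(f,g)=\int_{\mathbb{R}^d}\int_{S^{d-1}}f'_*\,g'\,\overline{B}(v-v_*,\sigma)\,d\sigma\,dv_*,\qquad Q^-(f,g)=(f*|v|^\beta)\,g,\qquad Q(f,g)=Q^+(f,g)-Q^-(f,g),$$ with $*$ the convolution in $v$; then $Q^\pm(f):=Q^\pm(f,f)$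 are the gain and loss terms and $Q(f)=Q^+(f)-Q^-(f)$. Renormalized solution: $f\ge 0$, $f\in C([0,T];L^1(\mathbb{T}^d\times\mathbb{R}^d))$, $Q^\pm(f)/(1+f)\in L^1_{\rm loc}$, and $(\partial_t+v\cdot\nabla_x)\log(1+f)=Q(f)/(1+f)$ in the sense of distributions. Dissipative: a renormalized solution $f$ is dissipative if $f|v|^2\in L^\infty([0,T];L^1(\mathbb{T}^d\times\mathbb{R}^d))$ and for every sufficiently regular $g:\mathbb{T}^d\times\mathbb{R}^d\times[0,T]\to\mathbb{R}$, $$\partial_t\int_{\mathbb{R}^d}|f-g|\,dv+\mathrm{div}_x\int_{\mathbb{R}^d}|f-g|\,v\,dv\le\int_{\mathbb{R}^d}\big(Q(f,g)-D(g)\big)\,\mathrm{sign}(f-g)\,dv$$ in the sense of distributions, where $D(g)=(\partial_t+v\cdot\nabla_x)g$, $\mathrm{sign}(z)=1$ for $z>0$, $-1$ for $z<0$, and $\mathrm{sign}(0)$ may be assigned an arbitrary value in $[-1,1]$. Here $g$ is "sufficiently regular" if $g\in C([0,T];L^1_{xv})$, $g|v|^2\in L^\infty_t(L^1_{xv})$, $D(g)\in L^1_{xvt}$, and for every $\tilde f\in C([0,T];L^1_{xv})$ with $\tilde f|v|^2\in L^\infty_t(L^1_{xv})$ one has $Q^+(\tilde f,|g|),\,Q^-(\tilde f,|g|)\in L^1_{xvt}$. *)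

theory Defs
  imports "HOL-Analysis.Analysis"
begin

section \<open>Measures: torus, phase space, sphere\<close>

text \<open>
  The torus is represented by the fundamental domain $[0,1)^d$ of $\mathbb{Z}^d$ with Lebesgue
  measure. Its topology enters only through test functions, which are smooth functions on the
  whole space that are $\mathbb{Z}^d$-periodic in $x$ (see below). Functions on the torus are
  determined up to null sets, so nothing is said about their values outside the fundamental domain.
\<close>

definition torus :: "(real^'n) measure" where
  "torus = restrict_space lborel {x. \<forall>i. 0 \<le> x $ i \<and> x $ i < 1}"

definition phase :: "((real^'n) \<times> (real^'n)) measure" where
  "phase = torus \<Otimes>\<^sub>M lborel"

definition time :: "real \<Rightarrow> real measure" where
  "time T = restrict_space lborel {0..T}"

definition phase_time :: "real \<Rightarrow> ((real^'n) \<times> (real^'n) \<times> real) measure" where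
  "phase_time T = torus \<Otimes>\<^sub>M lborel \<Otimes>\<^sub>M time T"

text \<open>
  Surface measure on the unit sphere in polar coordinates: $\sigma(A)$ is $d$ times the Lebesgue
  measure of the cone $\{r\omega : \omega \in A,\ 0 < r < 1\}$.
\<close>

definition sphere_measure :: "('a::euclidean_space) measure" where
  "sphere_measure = scale_measure (of_nat DIM('a))
     (distr (restrict_space lborel (ball 0 1 - {0})) (restrict_space borel (sphere 0 1)) sgn)"


section \<open>Collision kernel and collision operator\<close>

definition cos_angle :: "'a::euclidean_space \<Rightarrow> 'a \<Rightarrow> real" where
  "cos_angle z \<sigma> = (z \<bullet> \<sigma>) / norm z"

definition hard_potential_cutoff ::
    "(real^'n \<Rightarrow> real^'n \<Rightarrow> real) \<Rightarrow> real \<Rightarrow> (real \<Rightarrow> real) \<Rightarrow> bool" where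
  "hard_potential_cutoff B \<beta> h \<longleftrightarrow>
     0 < \<beta> \<and> \<beta> \<le> 1 \<and>
     h \<in> borel_measurable (restrict_space borel {-1<..<1}) \<and>
     (\<forall>z\<in>{-1<..<1}. 0 \<le> h z) \<and>
     mono_on {0<..<1} (\<lambda>z. h z + h (- z)) \<and>
     (\<exists>\<alpha> C. \<alpha> < real CARD('n) - 1 \<and>
        (\<forall>\<theta>\<in>{0<..<pi}. 0 \<le> h (cos \<theta>) * sin \<theta> powr \<alpha> \<and> h (cos \<theta>) * sin \<theta> powr \<alpha> \<le> C)) \<and>
     (\<forall>z::real^'n. z \<noteq> 0 \<longrightarrow> (\<integral>\<sigma>. h (cos_angle z \<sigma>) \<partial>sphere_measure) = 1) \<and>
     (\<forall>z \<sigma>. B z \<sigma> = norm z powr \<beta> * h (cos_angle z \<sigma>))"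

definition B_bar :: "(real^'n \<Rightarrow> real^'n \<Rightarrow> real) \<Rightarrow> real^'n \<Rightarrow> real^'n \<Rightarrow> real" where
  "B_bar B z \<sigma> = (if 0 < cos_angle z \<sigma> then B z \<sigma> + B z (- \<sigma>) else 0)"

definition post :: "real^'n \<Rightarrow> real^'n \<Rightarrow> real^'n \<Rightarrow> real^'n" where
  "post v w \<sigma> = (1/2) *\<^sub>R (v + w) + (norm (v - w) / 2) *\<^sub>R \<sigma>"

definition post_star :: "real^'n \<Rightarrow> real^'n \<Rightarrow> real^'n \<Rightarrow> real^'n" where
  "post_star v w \<sigma> = (1/2) *\<^sub>R (v + w) - (norm (v - w) / 2) *\<^sub>R \<sigma>"

definition gain_integrand ::
    "(real^'n \<Rightarrow> real^'n \<Rightarrow> real) \<Rightarrow> (real^'n \<Rightarrow> real) \<Rightarrow> (real^'n \<Rightarrow> real) \<Rightarrow> real^'n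
      \<Rightarrow> (real^'n) \<times> (real^'n) \<Rightarrow> real" where
  "gain_integrand B f g v = (\<lambda>(w, \<sigma>). f (post_star v w \<sigma>) * g (post v w \<sigma>) * B_bar B (v - w) \<sigma>)"

definition Q_plus ::
    "(real^'n \<Rightarrow> real^'n \<Rightarrow> real) \<Rightarrow> (real^'n \<Rightarrow> real) \<Rightarrow> (real^'n \<Rightarrow> real) \<Rightarrow> real^'n \<Rightarrow> real" where
  "Q_plus B f g v = (\<integral>p. gain_integrand B f g v p \<partial>(lborel \<Otimes>\<^sub>M sphere_measure))"

definition Q_minus ::
    "real \<Rightarrow> (real^'n \<Rightarrow> real) \<Rightarrow> (real^'n \<Rightarrow> real) \<Rightarrow> real^'n \<Rightarrow> real" where
  "Q_minus \<beta> f g v = (\<integral>w. f w * norm (v - w) powr \<beta> \<partial>lborel) * g v"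

definition Q_bilin ::
    "(real^'n \<Rightarrow> real^'n \<Rightarrow> real) \<Rightarrow> real \<Rightarrow> (real^'n \<Rightarrow> real) \<Rightarrow> (real^'n \<Rightarrow> real) \<Rightarrow> real^'n \<Rightarrow> real" where
  "Q_bilin B \<beta> f g v = Q_plus B f g v - Q_minus \<beta> f g v"

text \<open>
  The Bochner integral of a non-integrable function is 0, so absolute convergence of the integrals
  in \<open>Q_plus\<close> and \<open>Q_minus\<close> has to be required separately whenever $Q^\pm$ is said to belong to
  some Lebesgue space.
\<close>

definition Q_converges ::
    "(real^'n \<Rightarrow> real^'n \<Rightarrow> real) \<Rightarrow> real \<Rightarrow> (real^'n \<Rightarrow> real) \<Rightarrow> (real^'n \<Rightarrow> real) \<Rightarrow> real^'n \<Rightarrow> bool" where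
  "Q_converges B \<beta> f g v \<longleftrightarrow>
     integrable (lborel \<Otimes>\<^sub>M sphere_measure) (gain_integrand B f g v) \<and>
     integrable lborel (\<lambda>w. f w * norm (v - w) powr \<beta>)"


section \<open>Function spaces and distributions\<close>

text \<open>
  $C([0,T]; L^1)$. Every such curve has a jointly Borel measurable representative whose time
  slices are correct for every $t$; \<open>f\<close> is such a representative.
\<close>

definition cont_L1 :: "real \<Rightarrow> (real^'n \<Rightarrow> real^'n \<Rightarrow> real \<Rightarrow> real) \<Rightarrow> bool" where
  "cont_L1 T f \<longleftrightarrow>
     (\<lambda>(x, v, t). f x v t) \<in> borel_measurable (phase_time T) \<and>
     (\<forall>t\<in>{0..T}. integrable phase (\<lambda>(x, v). f x v t)) \<and>
     (\<forall>t\<in>{0..T}. ((\<lambda>s. \<integral>(x, v). \<bar>f x v s - f x v t\<bar> \<partial>phase) \<longlongrightarrow> 0) (at t within {0..T}))"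

definition second_moment_bounded :: "real \<Rightarrow> (real^'n \<Rightarrow> real^'n \<Rightarrow> real \<Rightarrow> real) \<Rightarrow> bool" where
  "second_moment_bounded T f \<longleftrightarrow>
     (\<exists>K::real. AE t in time T.
        (\<integral>\<^sup>+(x, v). ennreal (\<bar>f x v t\<bar> * (norm v)\<^sup>2) \<partial>phase) \<le> ennreal K)"

primrec C_k :: "nat \<Rightarrow> ('a::euclidean_space \<Rightarrow> real) \<Rightarrow> bool" where
  "C_k 0 \<phi> \<longleftrightarrow> continuous_on UNIV \<phi>"
| "C_k (Suc k) \<phi> \<longleftrightarrow> (\<forall>y. \<phi> differentiable (at y)) \<and>
     (\<forall>b\<in>Basis. C_k k (\<lambda>y. frechet_derivative \<phi> (at y) b))"

definition C_infinity :: "('a::euclidean_space \<Rightarrow> real) \<Rightarrow> bool" where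
  "C_infinity \<phi> \<longleftrightarrow> (\<forall>k. C_k k \<phi>)"

text \<open>
  Test functions: $C_c^\infty(\mathbb{T}^d \times \mathbb{R}^d \times (0,T))$ and
  $C_c^\infty(\mathbb{T}^d \times (0,T))$.
\<close>

definition test_xvt :: "real \<Rightarrow> ((real^'n) \<times> (real^'n) \<times> real \<Rightarrow> real) \<Rightarrow> bool" where
  "test_xvt T \<phi> \<longleftrightarrow> C_infinity \<phi> \<and>
     (\<forall>i x v t. \<phi> (x + axis i 1, v, t) = \<phi> (x, v, t)) \<and>
     (\<exists>R \<delta>. 0 < \<delta> \<and> (\<forall>x v t. \<phi> (x, v, t) \<noteq> 0 \<longrightarrow> norm v \<le> R \<and> t \<in> {\<delta>..T - \<delta>}))"

definition test_xt :: "real \<Rightarrow> ((real^'n) \<times> real \<Rightarrow> real) \<Rightarrow> bool" where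
  "test_xt T \<psi> \<longleftrightarrow> C_infinity \<psi> \<and>
     (\<forall>i x t. \<psi> (x + axis i 1, t) = \<psi> (x, t)) \<and>
     (\<exists>\<delta>. 0 < \<delta> \<and> (\<forall>x t. \<psi> (x, t) \<noteq> 0 \<longrightarrow> t \<in> {\<delta>..T - \<delta>}))"

text \<open>
  $(\partial_t + v \cdot \nabla_x) u = w$ in the sense of distributions. The derivative
  $(\partial_t + v \cdot \nabla_x)\varphi$ at $(x,v,t)$ is the derivative in direction $(v,0,1)$.
\<close>

definition transport_eq ::
    "real \<Rightarrow> (real^'n \<Rightarrow> real^'n \<Rightarrow> real \<Rightarrow> real) \<Rightarrow> (real^'n \<Rightarrow> real^'n \<Rightarrow> real \<Rightarrow> real) \<Rightarrow> bool" where
  "transport_eq T u w \<longleftrightarrow> (\<forall>\<phi>. test_xvt T \<phi> \<longrightarrow>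
     - (\<integral>(x, v, t). u x v t * frechet_derivative \<phi> (at (x, v, t)) (v, 0, 1) \<partial>phase_time T)
     = (\<integral>(x, v, t). w x v t * \<phi> (x, v, t) \<partial>phase_time T))"


section \<open>Renormalized and dissipative solutions\<close>

text \<open>
  Every compact subset of $\mathbb{T}^d \times \mathbb{R}^d \times [0,T]$ is contained in
  some $\{|v| \le R\}$, which gives the local integrability condition below.
\<close>

definition renormalized_solution ::
    "(real^'n \<Rightarrow> real^'n \<Rightarrow> real) \<Rightarrow> real \<Rightarrow> real \<Rightarrow> (real^'n \<Rightarrow> real^'n \<Rightarrow> real \<Rightarrow> real) \<Rightarrow> bool" where
  "renormalized_solution B \<beta> T f \<longleftrightarrow>
     cont_L1 T f \<and>
     (\<forall>t\<in>{0..T}. AE (x, v) in phase. 0 \<le> f x v t) \<and>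
     (AE (x, v, t) in phase_time T. Q_converges B \<beta> (\<lambda>u. f x u t) (\<lambda>u. f x u t) v) \<and>
     (\<forall>R. set_integrable (phase_time T) {(x, v, t). norm v \<le> R}
            (\<lambda>(x, v, t). Q_plus B (\<lambda>u. f x u t) (\<lambda>u. f x u t) v / (1 + f x v t))) \<and>
     (\<forall>R. set_integrable (phase_time T) {(x, v, t). norm v \<le> R}
            (\<lambda>(x, v, t). Q_minus \<beta> (\<lambda>u. f x u t) (\<lambda>u. f x u t) v / (1 + f x v t))) \<and>
     transport_eq T (\<lambda>x v t. ln (1 + f x v t))
       (\<lambda>x v t. Q_bilin B \<beta> (\<lambda>u. f x u t) (\<lambda>u. f x u t) v / (1 + f x v t))"

text \<open>
  \<open>sufficiently_regular B \<beta> T g G\<close>: \<open>g\<close> is an admissible comparison function and the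
  distribution $D(g) = (\partial_t + v \cdot \nabla_x) g$ is the integrable function \<open>G\<close>.
\<close>

definition sufficiently_regular ::
    "(real^'n \<Rightarrow> real^'n \<Rightarrow> real) \<Rightarrow> real \<Rightarrow> real
      \<Rightarrow> (real^'n \<Rightarrow> real^'n \<Rightarrow> real \<Rightarrow> real) \<Rightarrow> (real^'n \<Rightarrow> real^'n \<Rightarrow> real \<Rightarrow> real) \<Rightarrow> bool" where
  "sufficiently_regular B \<beta> T g G \<longleftrightarrow>
     cont_L1 T g \<and> second_moment_bounded T g \<and>
     integrable (phase_time T) (\<lambda>(x, v, t). G x v t) \<and> transport_eq T g G \<and>
     (\<forall>f. cont_L1 T f \<and> second_moment_bounded T f \<longrightarrow>
        (AE (x, v, t) in phase_time T. Q_converges B \<beta> (\<lambda>u. f x u t) (\<lambda>u. \<bar>g x u t\<bar>) v) \<and>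
        integrable (phase_time T) (\<lambda>(x, v, t). Q_plus B (\<lambda>u. f x u t) (\<lambda>u. \<bar>g x u t\<bar>) v) \<and>
        integrable (phase_time T) (\<lambda>(x, v, t). Q_minus \<beta> (\<lambda>u. f x u t) (\<lambda>u. \<bar>g x u t\<bar>) v))"

definition sign_at_0 :: "real \<Rightarrow> real \<Rightarrow> real" where
  "sign_at_0 s z = (if z = 0 then s else sgn z)"

text \<open>
  The parameter \<open>s\<close> is the value assigned to $\mathrm{sign}(0)$. The differential inequality is
  tested against nonnegative \<open>\<psi>\<close>, with $\partial_t$ and $\mathrm{div}_x$ moved onto \<open>\<psi>\<close>.
\<close>

definition dissipative_solution ::
    "real \<Rightarrow> (real^'n \<Rightarrow> real^'n \<Rightarrow> real) \<Rightarrow> real \<Rightarrow> real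
      \<Rightarrow> (real^'n \<Rightarrow> real^'n \<Rightarrow> real \<Rightarrow> real) \<Rightarrow> bool" where
  "dissipative_solution s B \<beta> T f \<longleftrightarrow>
     renormalized_solution B \<beta> T f \<and> second_moment_bounded T f \<and>
     (\<forall>g G \<psi>. sufficiently_regular B \<beta> T g G \<and> test_xt T \<psi> \<and> (\<forall>y. 0 \<le> \<psi> y) \<longrightarrow>
        - (\<integral>(x, t). (\<integral>v. \<bar>f x v t - g x v t\<bar> \<partial>lborel) * frechet_derivative \<psi> (at (x, t)) (0, 1)
             + frechet_derivative \<psi> (at (x, t)) (\<integral>v. \<bar>f x v t - g x v t\<bar> *\<^sub>R v \<partial>lborel, 0)
           \<partial>(torus \<Otimes>\<^sub>M time T))
        \<le> (\<integral>(x, t). (\<integral>v. (Q_bilin B \<beta> (\<lambda>u. f x u t) (\<lambda>u. g x u t) v - G x v t)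
                          * sign_at_0 s (f x v t - g x v t) \<partial>lborel) * \<psi> (x, t)
           \<partial>(torus \<Otimes>\<^sub>M time T)))"

definition maxwellian :: "real \<Rightarrow> real \<Rightarrow> real^'n \<Rightarrow> real" where
  "maxwellian a c v = exp (- a * (norm v)\<^sup>2 + c)"

end

theory Submission
  imports Defs
begin

text \<open>
  The Maxwellian \<open>M\<close> is a stationary solution of the transport equation, so it is an admissible
  comparison function. Adding the dissipativity inequalities with \<open>g = M\<close> and with \<open>g = 0\<close>, tested
  against functions of time only, gives
  \[ \frac{d}{dt} \int\!\!\int (|f-M| + f - M) \,dv\,dx \;\le\;
     \int\!\!\int Q(f,M)\, \mathrm{sign}(f-M) \,dv\,dx . \]
  Since $\int Q(f,M)\,dv = 0$, the sign may be replaced by $1 + \mathrm{sign}(f-M) \ge 0$, which vanishes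
  where \<open>f < M\<close>. Now $Q(f,M)(v) \le 0$ for $|v| \ge R$, where \<open>R\<close> does not depend on the constant \<open>c\<close> in
  \<open>M\<close> because $Q(f,M)$ is linear in \<open>M\<close>; and \<open>c\<close> is chosen so large that $f \le C_0 < M$ for $|v| < R$.
  Hence the integral on the left is nonincreasing, and it vanishes initially.

  The sign of $Q(f,M)$ for large velocities: with $F = f e^{a|\cdot|^2}$ energy conservation gives
  $Q^+(f,M)(v) = M(v) \int\!\!\int F(v'_*) e^{-a|v_*|^2} \overline{B}\,d\sigma\,dv_*$. Passing from $v_*$ to
  $v'_*$, only small deviation angles contribute when $v - v'_*$ is large, so this is
  $o(|v|^\beta) M(v)$, whereas $Q^-(f,M)(v) \ge \mathrm{const}\cdot\rho_0 |v|^\beta M(v)$.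
\<close>

section \<open>Integration along lines and in polar coordinates\<close>

text \<open>With g = 0 the dissipativity inequality reads d/dt \<integral>\<integral> |f| \<le> 0,
  because Q(f,0) = 0; this supplies the control of the total mass, which is not part of the
  definition of a solution. The finite second moment of f makes Q(f,M) integrable. The obstacle is
  the gain term: large |v| alone does not make v - v'_* large, since v'_* may lie near v. Velocities
  |v'_*| > r are therefore treated by the weighted bound: F is f/M_1 times a factor that decays like
  e^{-(a_1 - a)|v'_*|^2}, and this is where a < a_1 enters. For |v'_*| \<le> r the contributing
  angles form a small cap, and the mass of the angular kernel in a shrinking cap tends to 0 by
  dominated convergence. In the variable v - v'_* the natural angle is half the deviation angle; the
  monotonicity of h(z) + h(-z) allows the kernel to be evaluated at the half angle, where the
  normalization of h applies again.\<close>

lemma nn_integral_lborel_translate: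
  fixes G :: "'a::euclidean_space \<Rightarrow> ennreal"
  assumes [measurable]: "G \<in> borel_measurable borel"
  shows "(\<integral>\<^sup>+x. G (a + x) \<partial>lborel) = (\<integral>\<^sup>+x. G x \<partial>lborel)"
proof -
  have "(\<integral>\<^sup>+x. G x \<partial>lborel) = (\<integral>\<^sup>+x. G x \<partial>(distr lborel borel ((+) a)))"
    by (simp add: lborel_distr_plus)
  also have "\<dots> = (\<integral>\<^sup>+x. G (a + x) \<partial>lborel)"
    by (rule nn_integral_distr) auto
  finally show ?thesis ..
qed

lemma nn_integral_lborel_affine:
  fixes G :: "'a::euclidean_space \<Rightarrow> ennreal"
  assumes [measurable]: "G \<in> borel_measurable borel" and "c \<noteq> 0"
  shows "(\<integral>\<^sup>+x. G x \<partial>lborel) = ennreal (\<bar>c\<bar> ^ DIM('a)) * (\<integral>\<^sup>+x. G (a + c *\<^sub>R x) \<partial>lborel)"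
proof -
  have "(\<integral>\<^sup>+x. G x \<partial>lborel) = (\<integral>\<^sup>+x. G x
      \<partial>(density (distr lborel borel (\<lambda>x. a + c *\<^sub>R x)) (\<lambda>_. ennreal (\<bar>c\<bar> ^ DIM('a)))))"
    by (subst lborel_affine[of c a]) (use assms in auto)
  also have "\<dots> = (\<integral>\<^sup>+x. ennreal (\<bar>c\<bar> ^ DIM('a)) * G x \<partial>(distr lborel borel (\<lambda>x. a + c *\<^sub>R x)))"
    by (rule nn_integral_density) auto
  also have "\<dots> = (\<integral>\<^sup>+x. ennreal (\<bar>c\<bar> ^ DIM('a)) * G (a + c *\<^sub>R x) \<partial>lborel)"
    by (rule nn_integral_distr) auto
  also have "\<dots> = ennreal (\<bar>c\<bar> ^ DIM('a)) * (\<integral>\<^sup>+x. G (a + c *\<^sub>R x) \<partial>lborel)"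
    by (rule nn_integral_cmult) auto
  finally show ?thesis .
qed

lemma nn_integral_lborel_reflect:
  fixes G :: "'a::euclidean_space \<Rightarrow> ennreal"
  assumes "G \<in> borel_measurable borel"
  shows "(\<integral>\<^sup>+x. G (a - x) \<partial>lborel) = (\<integral>\<^sup>+x. G x \<partial>lborel)"
  using nn_integral_lborel_affine[OF assms, of "-1" a] by simp

text \<open>Fubini in an arbitrary direction without an adapted basis: each point of a line parallel
  to \<open>u\<close> is reached from the slab 0 \<le> z \<bullet> u \<le> 1 for a set of shifts
  \<tau> of length exactly 1. Statements about maps that move points along such lines thereby become
  one-dimensional.\<close>

lemma nn_integral_lborel_lines:
  fixes H :: "'a::euclidean_space \<Rightarrow> ennreal"
  assumes [measurable]: "H \<in> borel_measurable borel" and u: "norm u = 1"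
  shows "(\<integral>\<^sup>+z. H z \<partial>lborel)
    = (\<integral>\<^sup>+z. indicator {0..1} (z \<bullet> u) * (\<integral>\<^sup>+\<tau>. H (z + \<tau> *\<^sub>R u) \<partial>lborel) \<partial>lborel)"
proof -
  have uu: "u \<bullet> u = 1" using u by (simp add: norm_eq_1)
  have one: "(\<integral>\<^sup>+\<tau>. indicator {0..1} (s - \<tau>) \<partial>lborel) = (1::ennreal)" for s :: real
    using nn_integral_lborel_reflect[of "indicator {0..1::real}" s] by simp
  have "(\<integral>\<^sup>+z. indicator {0..1} (z \<bullet> u) * (\<integral>\<^sup>+\<tau>. H (z + \<tau> *\<^sub>R u) \<partial>lborel) \<partial>lborel)
      = (\<integral>\<^sup>+z. (\<integral>\<^sup>+\<tau>. indicator {0..1} (z \<bullet> u) * H (z + \<tau> *\<^sub>R u) \<partial>lborel) \<partial>lborel)"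
    by (simp add: nn_integral_cmult)
  also have "\<dots> = (\<integral>\<^sup>+\<tau>. (\<integral>\<^sup>+z. indicator {0..1} (z \<bullet> u) * H (z + \<tau> *\<^sub>R u) \<partial>lborel) \<partial>lborel)"
    by (rule lborel_pair.Fubini'[symmetric]) measurable
  also have "\<dots> = (\<integral>\<^sup>+\<tau>. (\<integral>\<^sup>+z. indicator {0..1} (z \<bullet> u - \<tau>) * H z \<partial>lborel) \<partial>lborel)"
  proof (rule nn_integral_cong)
    fix \<tau> :: real
    have "(\<integral>\<^sup>+z. indicator {0..1} (z \<bullet> u - \<tau>) * H z \<partial>lborel)
      = (\<integral>\<^sup>+z. indicator {0..1} ((\<tau> *\<^sub>R u + z) \<bullet> u - \<tau>) * H (\<tau> *\<^sub>R u + z) \<partial>lborel)"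
      by (rule nn_integral_lborel_translate[symmetric]) measurable
    also have "\<dots> = (\<integral>\<^sup>+z. indicator {0..1} (z \<bullet> u) * H (z + \<tau> *\<^sub>R u) \<partial>lborel)"
      by (simp add: inner_add_left uu add.commute)
    finally show "(\<integral>\<^sup>+z. indicator {0..1} (z \<bullet> u) * H (z + \<tau> *\<^sub>R u) \<partial>lborel)
      = (\<integral>\<^sup>+z. indicator {0..1} (z \<bullet> u - \<tau>) * H z \<partial>lborel)" ..
  qed
  also have "\<dots> = (\<integral>\<^sup>+z. (\<integral>\<^sup>+\<tau>. indicator {0..1} (z \<bullet> u - \<tau>) * H z \<partial>lborel) \<partial>lborel)"
    by (rule lborel_pair.Fubini') measurable
  also have "\<dots> = (\<integral>\<^sup>+z. H z \<partial>lborel)"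
    by (simp add: nn_integral_multc one)
  finally show ?thesis ..
qed

text \<open>The mirror image in the hyperplane orthogonal to \<open>u\<close> acts on each line
  parallel to \<open>u\<close> as a reflection of the real parameter, which preserves
  one-dimensional Lebesgue measure.\<close>

lemma nn_integral_lborel_mirror:
  fixes H :: "'a::euclidean_space \<Rightarrow> ennreal"
  assumes [measurable]: "H \<in> borel_measurable borel" and u: "norm u = 1"
  shows "(\<integral>\<^sup>+z. H (z - (2 * (z \<bullet> u)) *\<^sub>R u) \<partial>lborel) = (\<integral>\<^sup>+z. H z \<partial>lborel)"
proof -
  have uu: "u \<bullet> u = 1" using u by (simp add: norm_eq_1)
  have line: "(\<integral>\<^sup>+\<tau>. H (z + \<tau> *\<^sub>R u - (2 * ((z + \<tau> *\<^sub>R u) \<bullet> u)) *\<^sub>R u) \<partial>lborel)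
      = (\<integral>\<^sup>+\<tau>. H (z + \<tau> *\<^sub>R u) \<partial>lborel)" for z
  proof -
    have "H (z + \<tau> *\<^sub>R u - (2 * ((z + \<tau> *\<^sub>R u) \<bullet> u)) *\<^sub>R u)
        = H (z + (- 2 * (z \<bullet> u) - \<tau>) *\<^sub>R u)" for \<tau>
      by (rule arg_cong[of _ _ H]) (simp add: inner_add_left uu algebra_simps flip: scaleR_add_left)
    then show ?thesis
      using nn_integral_lborel_reflect[of "\<lambda>\<tau>. H (z + \<tau> *\<^sub>R u)" "- 2 * (z \<bullet> u)"] by simp
  qed
  show ?thesis
    by (subst (1 2) nn_integral_lborel_lines[OF _ u]) (simp_all only: line, measurable)
qed

text \<open>Since \<phi>' \<ge> 1, the factor \<phi>' may be inserted under the integral, and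
  substitution turns the result into the integral of \<open>g\<close> over the range of \<phi>.
  Substitution is available on compact intervals, so the half-line is exhausted by them.\<close>

lemma nn_integral_compose_expanding_le:
  fixes g :: "real \<Rightarrow> ennreal"
  assumes [measurable]: "g \<in> borel_measurable borel" "\<phi> \<in> borel_measurable borel"
    and deriv: "\<And>\<tau>. a < \<tau> \<Longrightarrow> (\<phi> has_real_derivative \<phi>' \<tau>) (at \<tau>)"
    and cont: "continuous_on {a<..} \<phi>'"
    and ge: "\<And>\<tau>. a < \<tau> \<Longrightarrow> 1 \<le> \<phi>' \<tau>"
  shows "(\<integral>\<^sup>+\<tau>. indicator {a<..} \<tau> * g (\<phi> \<tau>) \<partial>lborel) \<le> (\<integral>\<^sup>+\<tau>. g \<tau> \<partial>lborel)"
proof -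
  \<comment> \<open>The left end stays away from \<open>a\<close>, where no derivative is assumed;
    the \<open>+ 2\<close> keeps the interval nondegenerate already for n = 0.\<close>
  define I where "I n = {a + 1 / (real n + 1) .. a + real n + 2}" for n :: nat
  have bound: "(\<integral>\<^sup>+\<tau>. indicator (I n) \<tau> * g (\<phi> \<tau>) \<partial>lborel) \<le> (\<integral>\<^sup>+\<tau>. g \<tau> \<partial>lborel)" for n
  proof -
    have sub: "I n \<subseteq> {a<..}"
      by (auto simp: I_def) (smt (verit) of_nat_0_le_iff zero_less_divide_1_iff)
    have lt: "a + 1 / (real n + 1) < a + real n + 2"
    proof -
      have "1 / (real n + 1) \<le> 1" by (simp add: field_simps)
      then show ?thesis by linarith
    qed
    have "(\<integral>\<^sup>+\<tau>. indicator (I n) \<tau> * g (\<phi> \<tau>) \<partial>lborel)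
      \<le> (\<integral>\<^sup>+\<tau>. g (\<phi> \<tau>) * ennreal (\<phi>' \<tau>) * indicator (I n) \<tau> \<partial>lborel)"
    proof (rule nn_integral_mono)
      fix \<tau>
      show "indicator (I n) \<tau> * g (\<phi> \<tau>) \<le> g (\<phi> \<tau>) * ennreal (\<phi>' \<tau>) * indicator (I n) \<tau>"
      proof (cases "\<tau> \<in> I n")
        case True
        then have "1 \<le> ennreal (\<phi>' \<tau>)" using sub ge by auto
        then have "g (\<phi> \<tau>) * 1 \<le> g (\<phi> \<tau>) * ennreal (\<phi>' \<tau>)" by (rule mult_left_mono) simp
        then show ?thesis using True by simp
      qed simp
    qed
    also have "\<dots> = (\<integral>\<^sup>+x. g x * indicator {\<phi> (a + 1 / (real n + 1)) .. \<phi> (a + real n + 2)} x \<partial>lborel)"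
      unfolding I_def
    proof (rule nn_integral_substitution_aux[symmetric])
      show "continuous_on {a + 1 / (real n + 1)..a + real n + 2} \<phi>'"
        using cont sub unfolding I_def by (rule continuous_on_subset)
    next
      fix x assume "x \<in> {a + 1 / (real n + 1)..a + real n + 2}"
      then have "a < x" using sub unfolding I_def by auto
      then show "(\<phi> has_real_derivative \<phi>' x) (at x)" "0 \<le> \<phi>' x"
        using deriv ge[of x] by auto
    qed (use lt in auto)
    also have "\<dots> \<le> (\<integral>\<^sup>+\<tau>. g \<tau> \<partial>lborel)"
      by (rule nn_integral_mono) (auto split: split_indicator)
    finally show ?thesis .
  qed
  have inc: "incseq I"
  proof (rule incseq_SucI)
    fix n
    have "1 / (real (Suc n) + 1) \<le> 1 / (real n + 1)" by (simp add: field_simps)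
    then show "I n \<subseteq> I (Suc n)" by (auto simp: I_def)
  qed
  have Un: "(\<Union>n. I n) = {a<..}"
  proof (intro equalityI subsetI)
    fix x assume "x \<in> {a<..}"
    then have "0 < x - a" by simp
    obtain n1 where n1: "1 / (real n1 + 1) < x - a"
      using \<open>0 < x - a\<close> reals_Archimedean[of "x - a"] by (auto simp: inverse_eq_divide add.commute)
    obtain n2 where n2: "x - a < real n2" using reals_Archimedean2 by blast
    have "1 / (real (max n1 n2) + 1) \<le> 1 / (real n1 + 1)" by (simp add: frac_le)
    then have "x \<in> I (max n1 n2)" using n1 n2 by (auto simp: I_def)
    then show "x \<in> (\<Union>n. I n)" by blast
  next
    fix x assume "x \<in> (\<Union>n. I n)"
    then show "x \<in> {a<..}"
      by (auto simp: I_def) (smt (verit) of_nat_0_le_iff zero_less_divide_1_iff)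
  qed
  have "(\<integral>\<^sup>+\<tau>. indicator {a<..} \<tau> * g (\<phi> \<tau>) \<partial>lborel)
      = (\<integral>\<^sup>+\<tau>. (SUP n. indicator (I n) \<tau> * g (\<phi> \<tau>)) \<partial>lborel)"
  proof (rule nn_integral_cong)
    fix \<tau>
    show "indicator {a<..} \<tau> * g (\<phi> \<tau>) = (SUP n. indicator (I n) \<tau> * g (\<phi> \<tau>))"
    proof (rule antisym)
      show "indicator {a<..} \<tau> * g (\<phi> \<tau>) \<le> (SUP n. indicator (I n) \<tau> * g (\<phi> \<tau>))"
      proof (cases "\<tau> \<in> {a<..}")
        case True
        then obtain n where "\<tau> \<in> I n" using Un by blast
        then show ?thesis using True by (intro SUP_upper2[of n]) auto
      qed simp
      show "(SUP n. indicator (I n) \<tau> * g (\<phi> \<tau>)) \<le> indicator {a<..} \<tau> * g (\<phi> \<tau>)"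
        using Un by (intro SUP_least) (auto split: split_indicator)
    qed
  qed
  also have "\<dots> = (SUP n. (\<integral>\<^sup>+\<tau>. indicator (I n) \<tau> * g (\<phi> \<tau>) \<partial>lborel))"
  proof (rule nn_integral_monotone_convergence_SUP)
    show "incseq (\<lambda>n \<tau>. indicator (I n) \<tau> * g (\<phi> \<tau>))"
      using inc by (auto simp: incseq_def le_fun_def split: split_indicator)
    show "(\<lambda>\<tau>. indicator (I n) \<tau> * g (\<phi> \<tau>)) \<in> borel_measurable lborel" for n
      unfolding I_def by measurable
  qed
  also have "\<dots> \<le> (\<integral>\<^sup>+\<tau>. g \<tau> \<partial>lborel)"
    by (rule SUP_least) (rule bound)
  finally show ?thesis .
qed

text \<open>
  The map \<open>z \<mapsto> z + |z| \<sigma>\<close> moves points along lines parallel to \<open>\<sigma>\<close>, and it is expanding there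
  as long as \<open>z \<bullet> \<sigma> > 0\<close>.
\<close>

lemma nn_integral_shear_le:
  fixes G :: "'a::euclidean_space \<Rightarrow> ennreal"
  assumes [measurable]: "G \<in> borel_measurable borel" and \<sigma>: "norm \<sigma> = 1"
  shows "(\<integral>\<^sup>+z. indicator {0<..} (z \<bullet> \<sigma>) * G (z + norm z *\<^sub>R \<sigma>) \<partial>lborel) \<le> (\<integral>\<^sup>+z. G z \<partial>lborel)"
proof -
  have ss: "\<sigma> \<bullet> \<sigma> = 1" using \<sigma> by (simp add: norm_eq_1)
  have line: "(\<integral>\<^sup>+\<tau>. indicator {0<..} ((z + \<tau> *\<^sub>R \<sigma>) \<bullet> \<sigma>)
        * G (z + \<tau> *\<^sub>R \<sigma> + norm (z + \<tau> *\<^sub>R \<sigma>) *\<^sub>R \<sigma>) \<partial>lborel)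
      \<le> (\<integral>\<^sup>+\<tau>. G (z + \<tau> *\<^sub>R \<sigma>) \<partial>lborel)" for z
  proof -
    define s where "s = z \<bullet> \<sigma>"
    \<comment> \<open>\<open>q\<close> is the squared distance from the origin to the line through z
      parallel to \<sigma>. It is constant along the line, so |z + \<tau> \<sigma>| = sqrt((s +
      \<tau>)^2 + q).\<close>
    define q where "q = (norm z)\<^sup>2 - s\<^sup>2"
    have "s\<^sup>2 \<le> (norm z)\<^sup>2"
      using Cauchy_Schwarz_ineq2[of z \<sigma>] \<sigma> by (simp add: s_def abs_le_square_iff[symmetric])
    then have q: "0 \<le> q" by (simp add: q_def)
    have nrm: "norm (z + \<tau> *\<^sub>R \<sigma>) = sqrt ((s + \<tau>)\<^sup>2 + q)" for \<tau>
      by (simp add: norm_eq_sqrt_inner q_def s_def power2_norm_eq_inner inner_add_left inner_add_right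
          ss inner_commute power2_eq_square algebra_simps)
    define \<phi> where "\<phi> \<tau> = \<tau> + sqrt ((s + \<tau>)\<^sup>2 + q)" for \<tau>
    define \<phi>' where "\<phi>' \<tau> = 1 + (s + \<tau>) / sqrt ((s + \<tau>)\<^sup>2 + q)" for \<tau>
    have pos: "0 < (s + \<tau>)\<^sup>2 + q" if "- s < \<tau>" for \<tau>
      using that q by (simp add: add_pos_nonneg)
    have "(\<integral>\<^sup>+\<tau>. indicator {0<..} ((z + \<tau> *\<^sub>R \<sigma>) \<bullet> \<sigma>)
        * G (z + \<tau> *\<^sub>R \<sigma> + norm (z + \<tau> *\<^sub>R \<sigma>) *\<^sub>R \<sigma>) \<partial>lborel)
      = (\<integral>\<^sup>+\<tau>. indicator {-s<..} \<tau> * G (z + \<phi> \<tau> *\<^sub>R \<sigma>) \<partial>lborel)"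
    proof (rule nn_integral_cong)
      fix \<tau> :: real
      have "indicator {0<..} ((z + \<tau> *\<^sub>R \<sigma>) \<bullet> \<sigma>) = (indicator {-s<..} \<tau> :: ennreal)"
        by (auto simp: inner_add_left ss s_def split: split_indicator)
      moreover have "z + \<tau> *\<^sub>R \<sigma> + norm (z + \<tau> *\<^sub>R \<sigma>) *\<^sub>R \<sigma> = z + \<phi> \<tau> *\<^sub>R \<sigma>"
        by (simp add: nrm \<phi>_def algebra_simps)
      ultimately show "indicator {0<..} ((z + \<tau> *\<^sub>R \<sigma>) \<bullet> \<sigma>)
        * G (z + \<tau> *\<^sub>R \<sigma> + norm (z + \<tau> *\<^sub>R \<sigma>) *\<^sub>R \<sigma>) = indicator {-s<..} \<tau> * G (z + \<phi> \<tau> *\<^sub>R \<sigma>)"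
        by metis
    qed
    also have "\<dots> \<le> (\<integral>\<^sup>+\<tau>. G (z + \<tau> *\<^sub>R \<sigma>) \<partial>lborel)"
    proof (rule nn_integral_compose_expanding_le[where \<phi>' = \<phi>'])
      show "\<phi> \<in> borel_measurable borel" unfolding \<phi>_def by measurable
      fix \<tau> assume \<tau>: "- s < \<tau>"
      show "(\<phi> has_real_derivative \<phi>' \<tau>) (at \<tau>)"
        unfolding \<phi>_def \<phi>'_def using pos[OF \<tau>]
        by (auto intro!: derivative_eq_intros simp: divide_simps)
      show "1 \<le> \<phi>' \<tau>" unfolding \<phi>'_def using \<tau> q by simp
    next
      show "continuous_on {-s<..} \<phi>'"
        unfolding \<phi>'_def by (intro continuous_intros) (use pos in force)
    qed measurable
    finally show ?thesis .
  qed
  show ?thesis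
    by (subst (1 2) nn_integral_lborel_lines[OF _ \<sigma>])
      (auto intro!: nn_integral_mono mult_left_mono line)
qed

text \<open>Serves twice: with a = |y| it integrates out the auxiliary radius in the polar
  coordinate formula, and with d = 1 it bounds the radial integral of Gaussian moments.\<close>

lemma nn_integral_powr_tail:
  fixes a :: real
  assumes "0 < a" and "0 < d"
  shows "(\<integral>\<^sup>+s. ennreal (real d * inverse (s ^ (d + 1))) * indicator {a..} s \<partial>lborel)
    = ennreal (inverse (a ^ d))"
proof -
  have "(\<integral>\<^sup>+s. ennreal (real d * inverse (s ^ (d + 1))) * indicator {a..} s \<partial>lborel)
      = ennreal (0 - (- inverse (a ^ d)))"
  proof (rule nn_integral_FTC_atLeast)
    fix x assume "a \<le> x"
    then have x: "0 < x" using assms by simp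
    show "((\<lambda>x. - inverse (x ^ d)) has_real_derivative real d * inverse (x ^ (d + 1))) (at x)"
    proof -
      obtain e where e: "d = Suc e" using assms(2) by (cases d) auto
      have "((\<lambda>x. x ^ d) has_real_derivative real d * x ^ e) (at x)"
        using DERIV_pow[of d x] by (simp add: e)
      from DERIV_minus[OF DERIV_inverse'[OF this]] x show ?thesis
        by (simp add: e divide_simps mult_ac)
    qed
    show "0 \<le> real d * inverse (x ^ (d + 1))" using x by simp
  next
    have "filterlim (\<lambda>x::real. x ^ d) at_top at_top"
      using assms(2) by (intro filterlim_pow_at_top filterlim_ident) auto
    then have "((\<lambda>x::real. inverse (x ^ d)) \<longlongrightarrow> 0) at_top"
      by (rule tendsto_inverse_0_at_top)
    then show "((\<lambda>x::real. - inverse (x ^ d)) \<longlongrightarrow> 0) at_top"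
      using tendsto_minus by fastforce
  qed simp
  then show ?thesis by simp
qed

section \<open>The surface measure on the sphere and polar coordinates\<close>

text \<open>
  Unlike \<open>sphere_measure\<close> this is a measure on the Borel sets of the whole space, which spares
  conversions in measurability arguments.
\<close>

definition sphere_borel :: "('a::euclidean_space) measure" where
  "sphere_borel = distr sphere_measure borel (\<lambda>\<sigma>. \<sigma>)"

lemma sets_sphere_borel [simp, measurable_cong]: "sets sphere_borel = sets borel"
  by (simp add: sphere_borel_def)

lemma space_sphere_borel [simp]: "space sphere_borel = UNIV"
  by (simp add: sphere_borel_def)

lemma sets_sphere_measure [measurable_cong]:
  "sets (sphere_measure :: 'a::euclidean_space measure) = sets (restrict_space borel (sphere 0 1))"
  by (simp add: sphere_measure_def)

lemma space_sphere_measure [simp]: "space (sphere_measure :: 'a::euclidean_space measure) = sphere 0 1"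
  by (simp add: sphere_measure_def space_scale_measure space_restrict_space)

lemma measurable_ident_sphere_measure: "(\<lambda>\<sigma>. \<sigma>) \<in> sphere_measure \<rightarrow>\<^sub>M borel"
  by (simp add: measurable_cong_sets[OF sets_sphere_measure refl] measurable_restrict_space1)

lemma measurable_sgn_restrict:
  "sgn \<in> restrict_space lborel (ball 0 1 - {0::'a::euclidean_space})
     \<rightarrow>\<^sub>M restrict_space borel (sphere 0 1)"
  by (intro measurable_restrict_space2 measurable_restrict_space1)
    (auto simp: space_restrict_space norm_sgn)

lemma measurable_ball [measurable]: "ball (a::'a::euclidean_space) r \<in> sets borel"
  by simp

lemma nn_integral_sphere_measure:
  fixes g :: "'a::euclidean_space \<Rightarrow> ennreal"
  assumes [measurable]: "g \<in> borel_measurable borel"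
  shows "(\<integral>\<^sup>+\<sigma>. g \<sigma> \<partial>sphere_measure)
    = (\<integral>\<^sup>+x. ennreal (real DIM('a)) * indicator (ball 0 1) x * g (sgn x) \<partial>lborel)"
proof -
  have g: "g \<in> borel_measurable (restrict_space borel (sphere 0 1))"
    by (rule measurable_restrict_space1) simp
  have "(\<integral>\<^sup>+\<sigma>. g \<sigma> \<partial>sphere_measure) = of_nat DIM('a) *
     (\<integral>\<^sup>+\<sigma>. g \<sigma> \<partial>(distr (restrict_space lborel (ball 0 1
         - {0})) (restrict_space borel (sphere 0 1)) sgn))"
    unfolding sphere_measure_def by (rule nn_integral_scale_measure) (simp add: g)
  also have "\<dots> = of_nat DIM('a) * (\<integral>\<^sup>+x. g (sgn x) \<partial>(restrict_space lborel (ball 0 1 - {0})))"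
    by (subst nn_integral_distr[OF measurable_sgn_restrict]) (simp_all add: g)
  also have "\<dots> = of_nat DIM('a) * (\<integral>\<^sup>+x. g (sgn x) * indicator (ball 0 1 - {0}) x \<partial>lborel)"
    by (subst nn_integral_restrict_space) auto
  also have "\<dots> = of_nat DIM('a) * (\<integral>\<^sup>+x. indicator (ball 0 1) x * g (sgn x) \<partial>lborel)"
    using AE_lborel_singleton[of "0::'a"]
    by (intro arg_cong2[of _ _ _ _ "(*)"] refl nn_integral_cong_AE)
      (auto split: split_indicator)
  also have "\<dots> = (\<integral>\<^sup>+x. ennreal (real DIM('a)) * indicator (ball 0 1) x * g (sgn x) \<partial>lborel)"
    by (simp add: nn_integral_cmult mult.assoc ennreal_of_nat_eq_real_of_nat)
  finally show ?thesis .
qed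

lemma nn_integral_sphere_borel:
  fixes g :: "'a::euclidean_space \<Rightarrow> ennreal"
  assumes [measurable]: "g \<in> borel_measurable borel"
  shows "(\<integral>\<^sup>+\<sigma>. g \<sigma> \<partial>sphere_borel)
    = (\<integral>\<^sup>+x. ennreal (real DIM('a)) * indicator (ball 0 1) x * g (sgn x) \<partial>lborel)"
  unfolding sphere_borel_def
  by (subst nn_integral_distr)
    (auto simp: nn_integral_sphere_measure measurable_ident_sphere_measure)

lemma finite_sphere_borel: "finite_measure (sphere_borel :: 'a::euclidean_space measure)"
proof
  have "emeasure (sphere_borel :: 'a measure) (space sphere_borel)
      = (\<integral>\<^sup>+\<sigma>. 1 \<partial>(sphere_borel :: 'a measure))"
    by simp
  also have "\<dots> = ennreal (real DIM('a)) * emeasure lborel (ball (0::'a) 1)"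
    by (subst nn_integral_sphere_borel) (simp_all add: nn_integral_cmult_indicator)
  also have "\<dots> < \<infinity>"
    using emeasure_lborel_ball_finite[of "0::'a" 1] by (simp add: ennreal_mult_less_top)
  finally show "emeasure (sphere_borel :: 'a measure) (space sphere_borel) \<noteq> \<infinity>" by simp
qed

interpretation sphere_borel: finite_measure sphere_borel
  by (rule finite_sphere_borel)

lemma finite_sphere_measure: "finite_measure (sphere_measure :: 'a::euclidean_space measure)"
proof -
  have "emeasure (sphere_measure :: 'a measure) (space sphere_measure)
      = emeasure (sphere_borel :: 'a measure) UNIV"
    unfolding sphere_borel_def
    by (subst emeasure_distr) (auto simp: measurable_ident_sphere_measure)
  then show ?thesis
    using sphere_borel.emeasure_finite[of "UNIV::'a set"] by (intro finite_measureI) simp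
qed

interpretation sphere_measure: finite_measure sphere_measure
  by (rule finite_sphere_measure)

lemma AE_sphere_borel_norm: "AE \<sigma> in (sphere_borel :: 'a::euclidean_space measure). norm \<sigma> = 1"
  unfolding sphere_borel_def
  by (subst AE_distr_iff) (auto simp: measurable_ident_sphere_measure)

text \<open>The cone definition of the surface measure makes the right-hand side a double integral
  of F(r x/|x|) over r > 0 and x in the unit ball. Two scalings, r = |x| s for fixed x and y = s x
  for fixed s, bring out F(y); the remaining integral of d |y|^d s^(-d-1) over s > |y| equals
  1.\<close>

lemma nn_integral_polar:
  fixes F :: "'a::euclidean_space \<Rightarrow> ennreal"
  assumes [measurable]: "F \<in> borel_measurable borel"
  shows "(\<integral>\<^sup>+z. F z \<partial>lborel) = (\<integral>\<^sup>+r. indicator {0<..} r * ennreal (r ^ (DIM('a) - 1))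
    * (\<integral>\<^sup>+\<sigma>. F (r *\<^sub>R \<sigma>) \<partial>sphere_borel) \<partial>lborel)"
proof -
  define d where "d = DIM('a)"
  have d: "0 < d" by (simp add: d_def)
  then obtain e where e: "d = Suc e" by (cases d) auto
  define b :: "'a \<Rightarrow> ennreal" where "b x = indicator (ball 0 1) x" for x
  define p :: "real \<Rightarrow> ennreal" where "p r = indicator {0<..} r" for r
  have [measurable]: "b \<in> borel_measurable borel" "p \<in> borel_measurable borel"
    unfolding b_def[abs_def] p_def[abs_def] by (auto intro!: borel_measurable_indicator)
  \<comment> \<open>The integrand in the variables (x, r), (x, s) and (y, s) in turn; the condition
    |x| < 1 has become |y| < s in \<open>?W\<close>.\<close>
  let ?U = "\<lambda>x r. p r * ennreal (r ^ (d - 1)) * (ennreal d * b x * F (r *\<^sub>R sgn x))"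
  let ?V = "\<lambda>x s. p s * ennreal (s ^ (d - 1)) * (ennreal d * b x * ennreal (norm x ^ d) * F (s *\<^sub>R x))"
  let ?W = "\<lambda>y s. F y * ennreal (norm y ^ d)
    * (ennreal (d * inverse (s ^ (d + 1))) * (p s * indicator {0<..} (s - norm y)))"
  have "(\<integral>\<^sup>+r. p r * ennreal (r ^ (d - 1)) * (\<integral>\<^sup>+\<sigma>. F (r *\<^sub>R \<sigma>) \<partial>sphere_borel) \<partial>lborel)
      = (\<integral>\<^sup>+r. (\<integral>\<^sup>+x. ?U x r \<partial>lborel) \<partial>lborel)"
    by (subst nn_integral_sphere_borel) (auto simp: nn_integral_cmult d_def b_def)
  also have "\<dots> = (\<integral>\<^sup>+x. (\<integral>\<^sup>+r. ?U x r \<partial>lborel) \<partial>lborel)"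
    by (rule lborel_pair.Fubini') measurable
  also have "\<dots> = (\<integral>\<^sup>+x. (\<integral>\<^sup>+s. ?V x s \<partial>lborel) \<partial>lborel)"
  proof (rule nn_integral_cong_AE)
    have "(\<integral>\<^sup>+r. ?U x r \<partial>lborel)
      = (\<integral>\<^sup>+s. ?V x s \<partial>lborel)"
      if x: "x \<noteq> 0" for x
    proof -
      have "(\<integral>\<^sup>+r. ?U x r \<partial>lborel)
        = ennreal \<bar>norm x\<bar> * (\<integral>\<^sup>+s. ?U x (0 + norm x * s) \<partial>lborel)"
        by (rule nn_integral_real_affine) (use x in auto)
      also have "\<dots> = (\<integral>\<^sup>+s. ennreal \<bar>norm x\<bar> * (?U x (0 + norm x * s)) \<partial>lborel)"
        by (rule nn_integral_cmult[symmetric]) measurable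
      also have "\<dots> = (\<integral>\<^sup>+s. ?V x s \<partial>lborel)"
      proof (rule nn_integral_cong)
        fix s :: real
        have 1: "(norm x * s) *\<^sub>R sgn x = s *\<^sub>R x"
          using x by (simp add: sgn_div_norm)
        have 2: "ennreal (norm x) * ennreal ((norm x * s) ^ (d - 1)) = ennreal (s ^ (d - 1))
            * ennreal (norm x ^ d)" if "0 < s"
          using that d by (simp add: ennreal_mult[symmetric] power_mult_distrib e mult_ac)
        have 3: "p (norm x * s) = p s" using x
          by (auto simp: p_def zero_less_mult_iff split: split_indicator)
        show "ennreal \<bar>norm x\<bar> * (?U x (0 + norm x * s))
          = ?V x s"
        proof (cases "0 < s")
          case True
          have "ennreal \<bar>norm x\<bar> * (?U x (0 + norm x * s))
            = (ennreal (norm x) * ennreal ((norm x * s) ^ (d - 1)))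
                * (p s * (ennreal d * b x * F (s *\<^sub>R x)))"
            unfolding add_0 1 3 by (simp add: mult_ac)
          then show ?thesis unfolding 2[OF True] by (simp add: mult_ac)
        qed (simp add: 3, simp add: p_def)
      qed
      finally show ?thesis .
    qed
    then show "AE x in lborel. (\<integral>\<^sup>+r. ?U x r \<partial>lborel)
      = (\<integral>\<^sup>+s. ?V x s \<partial>lborel)"
      using AE_lborel_singleton[of "0::'a"] by auto
  qed
  also have "\<dots> = (\<integral>\<^sup>+s. (\<integral>\<^sup>+x. ?V x s \<partial>lborel) \<partial>lborel)"
    by (rule lborel_pair.Fubini'[symmetric]) measurable
  also have "\<dots> = (\<integral>\<^sup>+s. (\<integral>\<^sup>+y. ?W y s \<partial>lborel) \<partial>lborel)"
  proof (rule nn_integral_cong)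
    fix s :: real
    show "(\<integral>\<^sup>+x. ?V x s \<partial>lborel)
      = (\<integral>\<^sup>+y. ?W y s \<partial>lborel)"
    proof (cases "0 < s")
      case True
      have "(\<integral>\<^sup>+y. ?W y s \<partial>lborel)
        = ennreal (\<bar>s\<bar> ^ DIM('a)) * (\<integral>\<^sup>+x. ?W (0 + s *\<^sub>R x) s \<partial>lborel)"
        by (rule nn_integral_lborel_affine) (use True in auto)
      also have "\<dots> = (\<integral>\<^sup>+x. ennreal (\<bar>s\<bar> ^ DIM('a)) * (?W (0 + s *\<^sub>R x) s) \<partial>lborel)"
        by (rule nn_integral_cmult[symmetric]) measurable
      also have "\<dots> = (\<integral>\<^sup>+x. ?V x s \<partial>lborel)"
      proof (rule nn_integral_cong)
        fix x :: 'a
        have 1: "indicator {0<..} (s - norm (s *\<^sub>R x)) = b x"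
          using True by (auto simp: b_def split: split_indicator)
        have "(s ^ d) * (norm (s *\<^sub>R x) ^ d * (d * inverse (s ^ (d + 1)))) = s ^ (d - 1)
            * (d * norm x ^ d)"
          using True d by (simp add: power_mult_distrib e field_simps)
        then have 2: "ennreal (s ^ d) * (ennreal (norm (s *\<^sub>R x) ^ d)
            * ennreal (d * inverse (s ^ (d + 1)))) = ennreal (s ^ (d - 1))
            * (ennreal d * ennreal (norm x ^ d))"
          using True by (simp add: ennreal_mult[symmetric] del: norm_scaleR)
        have "ennreal (\<bar>s\<bar> ^ DIM('a)) * (?W (0 + s *\<^sub>R x) s)
          = (ennreal (s ^ d) * (ennreal (norm (s *\<^sub>R x) ^ d) * ennreal (d * inverse (s ^ (d + 1)))))
              * (F (s *\<^sub>R x) * (p s * b x))"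
          unfolding add_0 1 using True by (simp only: d_def[symmetric] abs_of_pos mult_ac)
        then show "ennreal (\<bar>s\<bar> ^ DIM('a)) * (?W (0 + s *\<^sub>R x) s)
          = ?V x s"
          unfolding 2 by (simp only: mult_ac)
      qed
      finally show ?thesis ..
    qed (simp add: p_def)
  qed
  also have "\<dots> = (\<integral>\<^sup>+y. (\<integral>\<^sup>+s. ?W y s \<partial>lborel) \<partial>lborel)"
    by (rule lborel_pair.Fubini') measurable
  also have "\<dots> = (\<integral>\<^sup>+y. F y \<partial>lborel)"
  proof (rule nn_integral_cong_AE)
    have "(\<integral>\<^sup>+s. ?W y s \<partial>lborel) = F y"
      if y: "y \<noteq> 0" for y
    proof -
      have "(\<integral>\<^sup>+s. ?W y s \<partial>lborel)
        = (\<integral>\<^sup>+s. F y * ennreal (norm y ^ d)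
            * (ennreal (d * inverse (s ^ (d + 1))) * indicator {norm y..} s) \<partial>lborel)"
        using AE_lborel_singleton[of "norm y"]
        by (intro nn_integral_cong_AE) (auto simp: p_def split: split_indicator intro:
          order.strict_trans1[OF norm_ge_zero])
      also have "\<dots> = F y * ennreal (norm y ^ d)
          * (\<integral>\<^sup>+s. ennreal (d * inverse (s ^ (d + 1))) * indicator {norm y..} s \<partial>lborel)"
        by (rule nn_integral_cmult) measurable
      also have "\<dots> = F y * ennreal (norm y ^ d) * ennreal (inverse (norm y ^ d))"
        using y d by (subst nn_integral_powr_tail) auto
      also have "\<dots> = F y"
        using y by (simp add: mult.assoc ennreal_mult[symmetric])
      finally show ?thesis .
    qed
    then show "AE y in lborel. (\<integral>\<^sup>+s. ?W y s \<partial>lborel) = F y"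
      using AE_lborel_singleton[of "0::'a"] by auto
  qed
  finally show ?thesis by (simp add: d_def p_def)
qed

section \<open>The collision kernel\<close>

interpretation sphere_pair: pair_sigma_finite sphere_borel sphere_borel ..
interpretation lborel_sphere: pair_sigma_finite lborel sphere_borel ..

text \<open>Any isometry taking \<eta> to \<eta>' would do; the mirror in the hyperplane orthogonal
  to \<eta> - \<eta>' has an explicit formula and preserves Lebesgue measure on the ball.\<close>

lemma nn_integral_sphere_zonal:
  fixes \<eta> \<eta>' :: "'a::euclidean_space" and k :: "real \<Rightarrow> ennreal"
  assumes [measurable]: "k \<in> borel_measurable borel" and "norm \<eta> = 1" "norm \<eta>' = 1"
  shows "(\<integral>\<^sup>+\<sigma>. k (\<eta> \<bullet> \<sigma>) \<partial>sphere_borel) = (\<integral>\<^sup>+\<sigma>. k (\<eta>' \<bullet> \<sigma>) \<partial>sphere_borel)"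
proof (cases "\<eta> = \<eta>'")
  case False
  define u where "u = sgn (\<eta> - \<eta>')"
  define N where "N = norm (\<eta> - \<eta>')"
  have N: "0 < N" using False by (simp add: N_def)
  have u: "norm u = 1" using False by (simp add: u_def norm_sgn)
  then have uu: "u \<bullet> u = 1" by (simp add: norm_eq_1)
  have Nu: "N *\<^sub>R u = \<eta> - \<eta>'" using N by (simp add: u_def N_def sgn_div_norm)
  have e1: "\<eta> \<bullet> \<eta> = 1" "\<eta>' \<bullet> \<eta>' = 1" using assms by (simp_all add: norm_eq_1)
  have "N\<^sup>2 = 2 * (\<eta> \<bullet> (\<eta> - \<eta>'))"
    by (simp add: N_def power2_norm_eq_inner inner_diff_left inner_diff_right e1 inner_commute)
  also have "\<dots> = 2 * N * (\<eta> \<bullet> u)" by (simp flip: Nu)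
  finally have "N = 2 * (\<eta> \<bullet> u)" using N by (simp add: power2_eq_square)
  then have \<eta>': "\<eta>' = \<eta> - (2 * (\<eta> \<bullet> u)) *\<^sub>R u" using Nu by simp
  define R where "R z = z - (2 * (z \<bullet> u)) *\<^sub>R u" for z
  have nR: "norm (R z) = norm z" for z
    by (simp add: norm_eq_sqrt_inner R_def inner_diff_left inner_diff_right uu inner_commute
      algebra_simps)
  have R\<eta>: "\<eta> \<bullet> R z = \<eta>' \<bullet> z" for z
    by (simp add: R_def \<eta>' inner_diff_left inner_diff_right inner_commute)
  have [measurable]: "R \<in> borel_measurable borel" unfolding R_def[abs_def] by measurable
  have "(\<integral>\<^sup>+\<sigma>. k (\<eta> \<bullet> \<sigma>) \<partial>sphere_borel)
      = (\<integral>\<^sup>+x. ennreal (real DIM('a)) * indicator (ball 0 1) x * k (\<eta> \<bullet> sgn x) \<partial>lborel)"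
    by (rule nn_integral_sphere_borel) measurable
  also have "\<dots> = (\<integral>\<^sup>+x. ennreal (real DIM('a)) * indicator (ball 0 1) (R x) * k (\<eta> \<bullet> sgn (R x))
      \<partial>lborel)"
    unfolding R_def by (rule nn_integral_lborel_mirror[OF _ u, symmetric]) measurable
  also have "\<dots> = (\<integral>\<^sup>+x. ennreal (real DIM('a)) * indicator (ball 0 1) x * k (\<eta>' \<bullet> sgn x) \<partial>lborel)"
    by (intro nn_integral_cong) (auto simp: sgn_div_norm nR R\<eta> split: split_indicator)
  also have "\<dots> = (\<integral>\<^sup>+\<sigma>. k (\<eta>' \<bullet> \<sigma>) \<partial>sphere_borel)"
    by (rule nn_integral_sphere_borel[symmetric]) measurable
  finally show ?thesis .
qed simp

text \<open>A set of directions is null as soon as the cone over it is. Linear algebra provides such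
  cones as negligible sets, that is, null in the completed measure; measurability of P brings the
  statement back to Borel sets.\<close>

lemma AE_sphere_borel_cone:
  fixes P :: "'a::euclidean_space \<Rightarrow> bool"
  assumes P[measurable]: "Measurable.pred borel P"
    and "negligible S" "\<And>x. x \<notin> S \<Longrightarrow> P (sgn x)"
  shows "AE \<sigma> in sphere_borel. P \<sigma>"
proof -
  have "AE x in lebesgue. x \<notin> S"
    using assms(2) by (intro AE_not_in) (simp add: negligible_iff_null_sets)
  then have "AE x in lebesgue. P (sgn x)" by eventually_elim (rule assms(3))
  moreover have "{x \<in> space lborel. P (sgn x)} \<in> sets lborel" by measurable
  ultimately have ae: "AE x in lborel. P (sgn x)"
    by (simp add: AE_completion_iff)
  have "(\<integral>\<^sup>+\<sigma>. indicator {\<sigma>. \<not> P \<sigma>} \<sigma> \<partial>sphere_borel)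
    = (\<integral>\<^sup>+x. ennreal (real DIM('a)) * indicator (ball 0 1) x * indicator {\<sigma>. \<not> P \<sigma>} (sgn x) \<partial>lborel)"
    by (rule nn_integral_sphere_borel) measurable
  also have "\<dots> = (\<integral>\<^sup>+x. 0 \<partial>(lborel :: 'a measure))"
    using ae by (intro nn_integral_cong_AE) auto
  finally have "emeasure sphere_borel {\<sigma>. \<not> P \<sigma>} = 0" by simp
  then show ?thesis by (intro AE_I[of _ _ "{\<sigma>. \<not> P \<sigma>}"]) auto
qed

lemma AE_sphere_borel_not_orthogonal:
  fixes \<eta> :: "'a::euclidean_space"
  assumes "\<eta> \<noteq> 0"
  shows "AE \<sigma> in sphere_borel. \<eta> \<bullet> \<sigma> \<noteq> 0"
proof (rule AE_sphere_borel_cone)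
  show "negligible {x. \<eta> \<bullet> x = 0}" using assms by (intro negligible_hyperplane) auto
qed (auto simp: sgn_div_norm)

text \<open>In dimension at least 2 the line spanned by \<eta> is negligible. This discards the
  directions with cosine 1 or -1, where h is unconstrained.\<close>

lemma AE_sphere_borel_not_parallel:
  fixes \<eta> :: "'a::euclidean_space"
  assumes "2 \<le> DIM('a)" and "norm \<eta> = 1"
  shows "AE \<sigma> in sphere_borel. \<bar>\<eta> \<bullet> \<sigma>\<bar> \<noteq> 1"
proof (rule AE_sphere_borel_cone)
  have "dim (span {\<eta>}) \<le> card {\<eta>}" by (intro dim_le_card) auto
  then show "negligible (span {\<eta>})" using assms(1) by (intro negligible_lowdim) simp
  fix x assume x: "x \<notin> span {\<eta>}"
  show "\<bar>\<eta> \<bullet> sgn x\<bar> \<noteq> 1"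
  proof
    assume "\<bar>\<eta> \<bullet> sgn x\<bar> = 1"
    moreover have "x \<noteq> 0" using x span_zero by blast
    ultimately have "\<bar>\<eta> \<bullet> x\<bar> = norm \<eta> * norm x"
      using assms(2) by (simp add: sgn_div_norm abs_mult divide_simps)
    then have "norm \<eta> *\<^sub>R x = norm x *\<^sub>R \<eta> \<or> norm \<eta> *\<^sub>R x = - norm x *\<^sub>R \<eta>"
      by (simp only: norm_cauchy_schwarz_abs_eq)
    then have "x = norm x *\<^sub>R \<eta> \<or> x = (- norm x) *\<^sub>R \<eta>" using assms(2) by simp
    then show False using x by (metis insertI1 span_base span_mul)
  qed
qed measurable

text \<open>u is the centre of mass and z the relative velocity. The change of variables is a
  reflection in w followed by a translation of v by z/2, so no Jacobian appears.\<close>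

lemma nn_integral_center_of_mass:
  fixes W :: "'a::euclidean_space \<Rightarrow> 'a \<Rightarrow> ennreal"
  assumes [measurable]: "case_prod W \<in> borel_measurable (borel \<Otimes>\<^sub>M borel)"
  shows "(\<integral>\<^sup>+v. \<integral>\<^sup>+w. W v w \<partial>lborel \<partial>lborel)
    = (\<integral>\<^sup>+u. \<integral>\<^sup>+z. W (u + (1/2) *\<^sub>R z) (u - (1/2) *\<^sub>R z) \<partial>lborel \<partial>lborel)"
proof -
  have "(\<integral>\<^sup>+v. \<integral>\<^sup>+w. W v w \<partial>lborel \<partial>lborel) = (\<integral>\<^sup>+v. \<integral>\<^sup>+z. W v (v - z) \<partial>lborel \<partial>lborel)"
    by (intro nn_integral_cong nn_integral_lborel_reflect[symmetric]) measurable
  also have "\<dots> = (\<integral>\<^sup>+z. \<integral>\<^sup>+v. W v (v - z) \<partial>lborel \<partial>lborel)"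
    by (rule lborel_pair.Fubini'[symmetric]) measurable
  also have "\<dots> = (\<integral>\<^sup>+z. \<integral>\<^sup>+u. W ((1/2) *\<^sub>R z + u) ((1/2) *\<^sub>R z + u - z) \<partial>lborel \<partial>lborel)"
    by (intro nn_integral_cong nn_integral_lborel_translate[symmetric]) measurable
  also have "\<dots> = (\<integral>\<^sup>+z. \<integral>\<^sup>+u. W (u + (1/2) *\<^sub>R z) (u - (1/2) *\<^sub>R z) \<partial>lborel \<partial>lborel)"
  proof (intro nn_integral_cong arg_cong2[of _ _ _ _ W])
    fix z u :: 'a
    have "z = (1/2) *\<^sub>R z + (1/2) *\<^sub>R z" by (simp flip: scaleR_add_left)
    then show "(1/2) *\<^sub>R z + u - z = u - (1/2) *\<^sub>R z"
      by (metis add_diff_cancel_left add_diff_eq diff_diff_eq2 diff_add_eq_diff_diff_swap add.commute)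
  qed simp
  also have "\<dots> = (\<integral>\<^sup>+u. \<integral>\<^sup>+z. W (u + (1/2) *\<^sub>R z) (u - (1/2) *\<^sub>R z) \<partial>lborel \<partial>lborel)"
    by (rule lborel_pair.Fubini') measurable
  finally show ?thesis .
qed

section \<open>The symmetrized angular kernel and the collisional change of variables\<close>

lemma cos_angle_measurable [measurable (raw)]:
  fixes f g :: "'z \<Rightarrow> real^'n"
  assumes [measurable]: "f \<in> borel_measurable M" "g \<in> borel_measurable M"
  shows "(\<lambda>x. cos_angle (f x) (g x)) \<in> borel_measurable M"
  unfolding cos_angle_def by measurable

lemma post_measurable [measurable (raw)]:
  fixes f g k :: "'z \<Rightarrow> real^'n"
  assumes [measurable]: "f \<in> borel_measurable M" "g \<in> borel_measurable M" "k \<in> borel_measurable M"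
  shows "(\<lambda>x. post (f x) (g x) (k x)) \<in> borel_measurable M"
    and "(\<lambda>x. post_star (f x) (g x) (k x)) \<in> borel_measurable M"
  unfolding post_def post_star_def by measurable

locale hard_potential =
  fixes B :: "real^'n \<Rightarrow> real^'n \<Rightarrow> real" and \<beta> :: real and h :: "real \<Rightarrow> real"
  assumes kernel: "hard_potential_cutoff B \<beta> h" and dim_ge_2: "2 \<le> CARD('n)"
begin

lemma beta_pos: "0 < \<beta>" and beta_le_1: "\<beta> \<le> 1"
  using kernel by (auto simp: hard_potential_cutoff_def)

text \<open>
  The values of \<open>h\<close> at \<open>\<plusminus>1\<close> are unconstrained (they may even be negative), but only a null set of
  directions is concerned. So \<open>B_bar\<close> agrees almost everywhere with the kernel \<open>Bsym\<close> below, which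
  discards them.
\<close>

definition hsym :: "real \<Rightarrow> real" where
  "hsym c = (if 0 < c \<and> c < 1 then h c + h (- c) else 0)"

definition Bsym :: "real^'n \<Rightarrow> real^'n \<Rightarrow> real" where
  "Bsym z \<sigma> = norm z powr \<beta> * hsym (cos_angle z \<sigma>)"

lemma h_cut_measurable [measurable]: "(\<lambda>c. if c \<in> {-1<..<1} then h c else 0) \<in> borel_measurable borel"
proof -
  have "h \<in> borel_measurable (restrict_space borel {-1<..<1})"
    using kernel by (auto simp: hard_potential_cutoff_def)
  then show ?thesis
    by (subst (asm) measurable_restrict_space_iff[where c = 0]) auto
qed

lemma hsym_measurable [measurable]: "hsym \<in> borel_measurable borel"
proof -
  define h0 where "h0 c = (if c \<in> {-1<..<1} then h c else 0)" for c
  have [measurable]: "h0 \<in> borel_measurable borel"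
    using h_cut_measurable unfolding h0_def[abs_def] .
  have "hsym = (\<lambda>c. if 0 < c \<and> c < 1 then h0 c + h0 (- c) else 0)"
    by (auto simp: hsym_def h0_def)
  then show ?thesis by simp
qed

lemma hsym_nonneg [simp]: "0 \<le> hsym c"
  using kernel by (auto simp: hsym_def hard_potential_cutoff_def)

lemma hsym_mono: "0 < c \<Longrightarrow> c \<le> c' \<Longrightarrow> c' < 1 \<Longrightarrow> hsym c \<le> hsym c'"
  using kernel by (auto simp: hsym_def hard_potential_cutoff_def mono_on_def)

lemma Bsym_measurable [measurable (raw)]:
  assumes [measurable]: "f \<in> borel_measurable M" "g \<in> borel_measurable M"
  shows "(\<lambda>x. Bsym (f x) (g x)) \<in> borel_measurable M"
  unfolding Bsym_def by measurable

lemma Bsym_nonneg [simp]: "0 \<le> Bsym z \<sigma>"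
  by (simp add: Bsym_def)

lemma AE_B_bar_eq: "AE \<sigma> in sphere_borel. B_bar B z \<sigma> = Bsym z \<sigma>"
proof (cases "z = 0")
  case True
  then show ?thesis by (simp add: B_bar_def Bsym_def cos_angle_def)
next
  case False
  have "AE \<sigma> in sphere_borel. \<bar>sgn z \<bullet> \<sigma>\<bar> \<noteq> 1"
    using False dim_ge_2 by (intro AE_sphere_borel_not_parallel) (auto simp: norm_sgn)
  with AE_sphere_borel_norm show ?thesis
  proof eventually_elim
    case (elim \<sigma>)
    have cos: "cos_angle z \<sigma> = sgn z \<bullet> \<sigma>" for \<sigma>
      by (simp add: cos_angle_def sgn_div_norm divide_inverse mult.commute)
    have "\<bar>sgn z \<bullet> \<sigma>\<bar> \<le> 1"
      using Cauchy_Schwarz_ineq2[of "sgn z" \<sigma>] elim(1) False by (simp add: norm_sgn)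
    with elim have "cos_angle z \<sigma> < 1" by (simp add: cos)
    moreover have "B z \<sigma> = norm z powr \<beta> * h (cos_angle z \<sigma>)" for z \<sigma>
      using kernel by (auto simp: hard_potential_cutoff_def)
    moreover have "cos_angle z (- \<sigma>) = - cos_angle z \<sigma>" by (simp add: cos)
    ultimately show ?case by (simp add: B_bar_def Bsym_def hsym_def algebra_simps)
  qed
qed

text \<open>Symmetrization folds the sphere onto the half sphere \<eta> \<bullet> \<sigma> > 0: the
  summand h(-c) there is the part of h on the opposite half sphere, moved by replacing \<eta> with
  -\<eta>. The equator is null, so the normalization of h carries over to
  \<open>hsym\<close>.\<close>

lemma nn_integral_hsym:
  fixes \<eta> :: "real^'n"
  assumes "norm \<eta> = 1"
  shows "(\<integral>\<^sup>+\<sigma>. ennreal (hsym (\<eta> \<bullet> \<sigma>)) \<partial>sphere_borel) = 1"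
proof -
  define h0 where "h0 c = (if c \<in> {-1<..<1} then h c else 0)" for c
  have [measurable]: "h0 \<in> borel_measurable borel"
    using h_cut_measurable unfolding h0_def[abs_def] .
  have h0_nonneg: "0 \<le> h0 c" for c
    using kernel by (auto simp: h0_def hard_potential_cutoff_def)
  have ca: "cos_angle \<eta> \<sigma> = \<eta> \<bullet> \<sigma>" for \<sigma> using assms by (simp add: cos_angle_def)
  have "\<eta> \<noteq> 0" using assms by auto
  then have 1: "(\<integral>\<sigma>. h (\<eta> \<bullet> \<sigma>) \<partial>sphere_measure) = 1"
    using kernel by (auto simp: hard_potential_cutoff_def simp flip: ca)
  \<comment> \<open>A non-integrable function would have Bochner integral 0 instead of 1.\<close>
  then have int: "integrable sphere_measure (\<lambda>\<sigma>. h (\<eta> \<bullet> \<sigma>))"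
    using not_integrable_integral_eq by fastforce
  have "AE \<sigma> in sphere_borel. \<bar>\<eta> \<bullet> \<sigma>\<bar> \<noteq> 1"
    using assms dim_ge_2 by (intro AE_sphere_borel_not_parallel) auto
  then have "AE \<sigma> in sphere_measure. \<bar>\<eta> \<bullet> \<sigma>\<bar> \<noteq> 1"
    unfolding sphere_borel_def by (subst (asm) AE_distr_iff) (auto simp:
      measurable_ident_sphere_measure)
  then have ae: "AE \<sigma> in sphere_measure. h (\<eta> \<bullet> \<sigma>) = h0 (\<eta> \<bullet> \<sigma>)"
  proof (rule AE_mp, intro AE_I2 impI)
    fix \<sigma> :: "real^'n" assume "\<sigma> \<in> space sphere_measure" and ne: "\<bar>\<eta> \<bullet> \<sigma>\<bar> \<noteq> 1"
    then have "\<bar>\<eta> \<bullet> \<sigma>\<bar> \<le> 1" using Cauchy_Schwarz_ineq2[of \<eta> \<sigma>] assms by simp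
    with ne show "h (\<eta> \<bullet> \<sigma>) = h0 (\<eta> \<bullet> \<sigma>)" by (auto simp: h0_def)
  qed
  have "(\<integral>\<^sup>+\<sigma>. ennreal (h (\<eta> \<bullet> \<sigma>)) \<partial>sphere_measure) = ennreal 1"
    using ae h0_nonneg by (subst nn_integral_eq_integral[OF int]) (auto simp: 1)
  moreover have "(\<integral>\<^sup>+\<sigma>. ennreal (h (\<eta> \<bullet> \<sigma>)) \<partial>sphere_measure)
      = (\<integral>\<^sup>+\<sigma>. ennreal (h0 (\<eta> \<bullet> \<sigma>)) \<partial>sphere_measure)"
    using ae by (intro nn_integral_cong_AE) auto
  ultimately have tot: "(\<integral>\<^sup>+\<sigma>. ennreal (h0 (\<eta> \<bullet> \<sigma>)) \<partial>sphere_borel) = 1"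
    unfolding sphere_borel_def by (subst nn_integral_distr) (auto simp: measurable_ident_sphere_measure)
  define k where "k c = indicator {0<..} c * ennreal (h0 (- c))" for c
  have [measurable]: "k \<in> borel_measurable borel" unfolding k_def[abs_def] by measurable
  have "(\<integral>\<^sup>+\<sigma>. ennreal (hsym (\<eta> \<bullet> \<sigma>)) \<partial>sphere_borel)
    = (\<integral>\<^sup>+\<sigma>. indicator {0<..} (\<eta> \<bullet> \<sigma>) * ennreal (h0 (\<eta> \<bullet> \<sigma>)) + k (\<eta> \<bullet> \<sigma>) \<partial>sphere_borel)"
  proof (rule nn_integral_cong)
    fix \<sigma> :: "real^'n"
    show "ennreal (hsym (\<eta> \<bullet> \<sigma>)) = indicator {0<..} (\<eta> \<bullet> \<sigma>) * ennreal (h0 (\<eta> \<bullet> \<sigma>)) + k (\<eta> \<bullet> \<sigma>)"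
      using h0_nonneg[of "\<eta> \<bullet> \<sigma>"] h0_nonneg[of "- (\<eta> \<bullet> \<sigma>)"]
      by (auto simp: hsym_def h0_def k_def ennreal_plus split: split_indicator)
  qed
  also have "\<dots> = (\<integral>\<^sup>+\<sigma>. indicator {0<..} (\<eta> \<bullet> \<sigma>) * ennreal (h0 (\<eta> \<bullet> \<sigma>)) \<partial>sphere_borel)
      + (\<integral>\<^sup>+\<sigma>. k (\<eta> \<bullet> \<sigma>) \<partial>sphere_borel)"
    by (rule nn_integral_add) measurable
  also have "(\<integral>\<^sup>+\<sigma>. k (\<eta> \<bullet> \<sigma>) \<partial>sphere_borel) = (\<integral>\<^sup>+\<sigma>. k ((- \<eta>) \<bullet> \<sigma>) \<partial>sphere_borel)"
    using assms by (intro nn_integral_sphere_zonal) auto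
  also have "(\<integral>\<^sup>+\<sigma>. indicator {0<..} (\<eta> \<bullet> \<sigma>) * ennreal (h0 (\<eta> \<bullet> \<sigma>)) \<partial>sphere_borel)
      + (\<integral>\<^sup>+\<sigma>. k ((- \<eta>) \<bullet> \<sigma>) \<partial>sphere_borel)
      = (\<integral>\<^sup>+\<sigma>. indicator {0<..} (\<eta> \<bullet> \<sigma>) * ennreal (h0 (\<eta> \<bullet> \<sigma>)) + k ((- \<eta>) \<bullet> \<sigma>) \<partial>sphere_borel)"
    by (rule nn_integral_add[symmetric]) measurable
  also have "\<dots> = (\<integral>\<^sup>+\<sigma>. ennreal (h0 (\<eta> \<bullet> \<sigma>)) \<partial>sphere_borel)"
    using AE_sphere_borel_not_orthogonal[OF \<open>\<eta> \<noteq> 0\<close>]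
    by (intro nn_integral_cong_AE) (auto simp: k_def split: split_indicator)
  finally show ?thesis using tot by simp
qed

text \<open>The caps shrink to the pole, where \<open>hsym\<close> is 0, so their mass tends to 0 by
  dominated convergence with majorant \<open>hsym\<close>. The computation is made for one axis e;
  zonal symmetry makes \<delta> independent of \<eta>.\<close>

lemma nn_integral_hsym_cap:
  assumes "0 < (\<epsilon>::real)"
  obtains \<delta> where "0 < \<delta>" "\<delta> < 1"
    "\<And>\<eta> :: real^'n. norm \<eta> = 1 \<Longrightarrow>
      (\<integral>\<^sup>+\<sigma>. indicator {1 - \<delta><..} (\<eta> \<bullet> \<sigma>) * ennreal (hsym (\<eta> \<bullet> \<sigma>)) \<partial>sphere_borel) \<le> ennreal \<epsilon>"
proof -
  obtain e :: "real^'n" where e: "norm e = 1" using vector_choose_size[of 1] by auto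
  define u where "u n \<sigma> = indicator {1 - 1 / (real n + 2)<..} (e \<bullet> \<sigma>)
      * ennreal (hsym (e \<bullet> \<sigma>))" for n :: nat and \<sigma>
  have [measurable]: "u n \<in> borel_measurable borel" for n unfolding u_def[abs_def] by measurable
  have "(\<lambda>n. \<integral>\<^sup>+\<sigma>. u n \<sigma> \<partial>sphere_borel) \<longlonglongrightarrow> (\<integral>\<^sup>+\<sigma>. 0 \<partial>(sphere_borel :: (real^'n) measure))"
  proof (rule nn_integral_dominated_convergence[where w = "\<lambda>\<sigma>. ennreal (hsym (e \<bullet> \<sigma>))"])
    show "(\<integral>\<^sup>+\<sigma>. ennreal (hsym (e \<bullet> \<sigma>)) \<partial>sphere_borel) < \<infinity>" by (simp add: nn_integral_hsym e)
    show "AE \<sigma> in sphere_borel. u n \<sigma> \<le> ennreal (hsym (e \<bullet> \<sigma>))" for n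
      by (auto simp: u_def split: split_indicator)
    show "AE \<sigma> in sphere_borel. (\<lambda>n. u n \<sigma>) \<longlonglongrightarrow> 0"
    proof (rule AE_I2)
      fix \<sigma> :: "real^'n"
      show "(\<lambda>n. u n \<sigma>) \<longlonglongrightarrow> 0"
      proof (cases "e \<bullet> \<sigma> < 1")
        case True
        have "(\<lambda>n. 1 / (real n + 2)) \<longlonglongrightarrow> 0"
          using LIMSEQ_ignore_initial_segment[OF lim_1_over_n, of 2] by (simp add: add.commute)
        then have "\<forall>\<^sub>F n in sequentially. 1 / (real n + 2) < 1 - e \<bullet> \<sigma>"
          using True by (auto intro: order_tendstoD)
        then have "\<forall>\<^sub>F n in sequentially. u n \<sigma> = 0"
          by eventually_elim (auto simp: u_def split: split_indicator)
        then show ?thesis by (rule tendsto_eventually)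
      qed (simp add: u_def hsym_def)
    qed
  qed measurable
  then have "(\<lambda>n. \<integral>\<^sup>+\<sigma>. u n \<sigma> \<partial>sphere_borel) \<longlonglongrightarrow> 0" by simp
  then have "\<forall>\<^sub>F n in sequentially. (\<integral>\<^sup>+\<sigma>. u n \<sigma> \<partial>sphere_borel) < ennreal \<epsilon>"
    using assms by (intro order_tendstoD) auto
  then obtain n where n: "(\<integral>\<^sup>+\<sigma>. u n \<sigma> \<partial>sphere_borel) < ennreal \<epsilon>"
    using eventually_happens trivial_limit_sequentially by blast
  show ?thesis
  proof (rule that[of "1 / (real n + 2)"])
    fix \<eta> :: "real^'n" assume \<eta>: "norm \<eta> = 1"
    have "(\<integral>\<^sup>+\<sigma>. indicator {1 - 1 / (real n + 2)<..} (\<eta> \<bullet> \<sigma>) * ennreal (hsym (\<eta> \<bullet> \<sigma>)) \<partial>sphere_borel)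
      = (\<integral>\<^sup>+\<sigma>. u n \<sigma> \<partial>sphere_borel)"
      unfolding u_def by (rule nn_integral_sphere_zonal[where k =
        "\<lambda>c. indicator {1 - 1 / (real n + 2)<..} c * ennreal (hsym c)"]) (use e \<eta> in measurable)
    then show "(\<integral>\<^sup>+\<sigma>. indicator {1 - 1 / (real n + 2)<..} (\<eta> \<bullet> \<sigma>) * ennreal (hsym (\<eta> \<bullet> \<sigma>))
        \<partial>sphere_borel) \<le> ennreal \<epsilon>"
      using n by simp
  qed auto
qed

text \<open>
  In polar coordinates \<open>z = r \<omega>\<close> the two unit vectors \<open>\<omega>\<close> and \<open>\<sigma>\<close> enter the kernel symmetrically;
  interchanging them is the pre-post-collisional change of variables in the centre-of-mass frame.
\<close>

lemma nn_integral_Bsym_swap: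
  fixes g :: "real^'n \<Rightarrow> ennreal"
  assumes [measurable]: "g \<in> borel_measurable borel"
  shows "(\<integral>\<^sup>+z. \<integral>\<^sup>+\<sigma>. g (norm z *\<^sub>R \<sigma>) * ennreal (Bsym z \<sigma>) \<partial>sphere_borel \<partial>lborel)
    = (\<integral>\<^sup>+z. g z * ennreal (norm z powr \<beta>) \<partial>lborel)"
proof -
  let ?J = "\<lambda>r::real. indicator {0<..} r * ennreal (r ^ (DIM(real^'n) - 1))"
  have *: "(\<integral>\<^sup>+\<omega>. \<integral>\<^sup>+\<sigma>. g (norm (r *\<^sub>R \<omega>) *\<^sub>R \<sigma>) * ennreal (Bsym (r *\<^sub>R \<omega>) \<sigma>) \<partial>sphere_borel
      \<partial>sphere_borel)
      = (\<integral>\<^sup>+\<sigma>. g (r *\<^sub>R \<sigma>) * ennreal (norm (r *\<^sub>R \<sigma>) powr \<beta>) \<partial>sphere_borel)" if r: "0 < r" for r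
  proof -
    have "(\<integral>\<^sup>+\<omega>. \<integral>\<^sup>+\<sigma>. g (norm (r *\<^sub>R \<omega>) *\<^sub>R \<sigma>) * ennreal (Bsym (r *\<^sub>R \<omega>) \<sigma>) \<partial>sphere_borel
        \<partial>sphere_borel)
      = (\<integral>\<^sup>+\<omega>. \<integral>\<^sup>+\<sigma>. g (r *\<^sub>R \<sigma>) * ennreal (r powr \<beta>) * ennreal (hsym (\<sigma> \<bullet> \<omega>)) \<partial>sphere_borel
          \<partial>sphere_borel)"
      using AE_sphere_borel_norm
      by (intro nn_integral_cong_AE, eventually_elim)
        (use r in \<open>simp add: Bsym_def cos_angle_def inner_commute ennreal_mult mult.assoc\<close>)
    also have "\<dots> = (\<integral>\<^sup>+\<sigma>. \<integral>\<^sup>+\<omega>. g (r *\<^sub>R \<sigma>) * ennreal (r powr \<beta>) * ennreal (hsym (\<sigma> \<bullet> \<omega>))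
        \<partial>sphere_borel \<partial>sphere_borel)"
      by (rule sphere_pair.Fubini') measurable
    also have "\<dots> = (\<integral>\<^sup>+\<sigma>. g (r *\<^sub>R \<sigma>) * ennreal (norm (r *\<^sub>R \<sigma>) powr \<beta>) \<partial>sphere_borel)"
      using AE_sphere_borel_norm
      by (intro nn_integral_cong_AE, eventually_elim) (use r in \<open>simp add: nn_integral_cmult nn_integral_hsym\<close>)
    finally show ?thesis .
  qed
  have "(\<integral>\<^sup>+z. \<integral>\<^sup>+\<sigma>. g (norm z *\<^sub>R \<sigma>) * ennreal (Bsym z \<sigma>) \<partial>sphere_borel \<partial>lborel)
      = (\<integral>\<^sup>+r. ?J r * (\<integral>\<^sup>+\<omega>. \<integral>\<^sup>+\<sigma>. g (norm (r *\<^sub>R \<omega>) *\<^sub>R \<sigma>) * ennreal (Bsym (r *\<^sub>R \<omega>) \<sigma>) \<partial>sphere_borel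
          \<partial>sphere_borel) \<partial>lborel)"
    by (rule nn_integral_polar) measurable
  also have "\<dots> = (\<integral>\<^sup>+r. ?J r * (\<integral>\<^sup>+\<sigma>. g (r *\<^sub>R \<sigma>) * ennreal (norm (r *\<^sub>R \<sigma>) powr \<beta>) \<partial>sphere_borel)
      \<partial>lborel)"
  proof (rule nn_integral_cong)
    fix r
    show "?J r * (\<integral>\<^sup>+\<omega>. \<integral>\<^sup>+\<sigma>. g (norm (r *\<^sub>R \<omega>) *\<^sub>R \<sigma>) * ennreal (Bsym (r *\<^sub>R \<omega>) \<sigma>) \<partial>sphere_borel
        \<partial>sphere_borel)
      = ?J r * (\<integral>\<^sup>+\<sigma>. g (r *\<^sub>R \<sigma>) * ennreal (norm (r *\<^sub>R \<sigma>) powr \<beta>) \<partial>sphere_borel)"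
      by (cases "0 < r") (simp_all only: *, simp)
  qed
  also have "\<dots> = (\<integral>\<^sup>+z. g z * ennreal (norm z powr \<beta>) \<partial>lborel)"
    by (rule nn_integral_polar[symmetric]) measurable
  finally show ?thesis .
qed

text \<open>The collision keeps the centre of mass u and sends z to |z| \<sigma>, so at fixed u this
  is the interchange of the directions of z and \<sigma>. The angular kernel disappears from the
  right-hand side because it integrates to 1.\<close>

lemma nn_integral_collision:
  fixes \<Phi> :: "real^'n \<Rightarrow> real^'n \<Rightarrow> ennreal"
  assumes \<Phi>[measurable]: "case_prod \<Phi> \<in> borel_measurable (borel \<Otimes>\<^sub>M borel)"
  shows "(\<integral>\<^sup>+v. \<integral>\<^sup>+w. \<integral>\<^sup>+\<sigma>. \<Phi> (post v w \<sigma>) (post_star v w \<sigma>) * ennreal (Bsym (v - w) \<sigma>) \<partial>sphere_borel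
      \<partial>lborel \<partial>lborel)
    = (\<integral>\<^sup>+v. \<integral>\<^sup>+w. \<Phi> v w * ennreal (norm (v - w) powr \<beta>) \<partial>lborel \<partial>lborel)"
proof -
  let ?W = "\<lambda>v w. \<integral>\<^sup>+\<sigma>. \<Phi> (post v w \<sigma>) (post_star v w \<sigma>) * ennreal (Bsym (v - w) \<sigma>) \<partial>sphere_borel"
  have half: "(u + (1/2) *\<^sub>R z) - (u - (1/2) *\<^sub>R z) = z" for u z :: "real^'n"
    by (simp add: algebra_simps flip: scaleR_add_left)
  have mid: "(1/2) *\<^sub>R ((u + (1/2) *\<^sub>R z) + (u - (1/2) *\<^sub>R z)) = u" for u z :: "real^'n"
    by (simp add: algebra_simps flip: scaleR_2)
  have "(\<integral>\<^sup>+v. \<integral>\<^sup>+w. ?W v w \<partial>lborel \<partial>lborel)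
      = (\<integral>\<^sup>+u. \<integral>\<^sup>+z. ?W (u + (1/2) *\<^sub>R z) (u - (1/2) *\<^sub>R z) \<partial>lborel \<partial>lborel)"
    by (rule nn_integral_center_of_mass) measurable
  also have "\<dots> = (\<integral>\<^sup>+u. \<integral>\<^sup>+z. \<integral>\<^sup>+\<sigma>. (\<lambda>y. \<Phi> (u + (1/2) *\<^sub>R y) (u - (1/2) *\<^sub>R y)) (norm z *\<^sub>R \<sigma>)
      * ennreal (Bsym z \<sigma>) \<partial>sphere_borel \<partial>lborel \<partial>lborel)"
    unfolding post_def post_star_def half mid by simp
  also have "\<dots> = (\<integral>\<^sup>+u. \<integral>\<^sup>+z. \<Phi> (u + (1/2) *\<^sub>R z) (u - (1/2) *\<^sub>R z) * ennreal (norm z powr \<beta>) \<partial>lborel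
      \<partial>lborel)"
    by (intro nn_integral_cong nn_integral_Bsym_swap) measurable
  also have "\<dots> = (\<integral>\<^sup>+v. \<integral>\<^sup>+w. \<Phi> v w * ennreal (norm (v - w) powr \<beta>) \<partial>lborel \<partial>lborel)"
    by (subst nn_integral_center_of_mass) (simp_all only: half, measurable)
  finally show ?thesis .
qed

end

section \<open>The gain term at large velocities\<close>

lemma maxwellian_pos [simp]: "0 < maxwellian a c v"
  by (simp add: maxwellian_def)

lemma maxwellian_nonneg [simp]: "0 \<le> maxwellian a c v"
  by (simp add: maxwellian_def)

lemma maxwellian_measurable [measurable (raw)]:
  fixes f :: "'z \<Rightarrow> real^'n"
  assumes [measurable]: "f \<in> borel_measurable M"
  shows "(\<lambda>x. maxwellian a c (f x)) \<in> borel_measurable M"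
  unfolding maxwellian_def by measurable

text \<open>The factor 2 + s is what remains of |v - w|^\<beta> after |v|^\<beta> has been split
  off, with s = |w|; being at least 1, it may also be dropped.\<close>

lemma gaussian_decay:
  fixes b \<epsilon> :: real
  assumes "0 < b" "0 < \<epsilon>"
  obtains r where "0 < r" "\<And>s. r \<le> s \<Longrightarrow> (2 + s) * exp (- b * s\<^sup>2) \<le> \<epsilon>"
proof
  \<comment> \<open>For s \<ge> 1 one has 2 + s \<le> 3 s, and exp(b s^2) \<ge> b s^2; the quotient
    3/(b s) is at most \<epsilon> beyond 3/(b \<epsilon>).\<close>
  let ?r = "max 1 (3 / (b * \<epsilon>))"
  show "0 < ?r" by simp
  fix s assume s: "?r \<le> s"
  then have s1: "1 \<le> s" and s2: "3 / (b * \<epsilon>) \<le> s" by auto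
  have "3 \<le> b * \<epsilon> * s" using s2 assms by (simp add: field_simps)
  then have "3 * s \<le> b * \<epsilon> * s * s" using s1 by (intro mult_right_mono) auto
  moreover have "2 + s \<le> 3 * s" using s1 by simp
  ultimately have "2 + s \<le> b * \<epsilon> * s * s" by (rule order_trans[rotated])
  also have "\<dots> = \<epsilon> * (b * s\<^sup>2)" by (simp add: power2_eq_square)
  also have "\<dots> \<le> \<epsilon> * exp (b * s\<^sup>2)"
    using assms exp_ge_add_one_self[of "b * s\<^sup>2"] by (intro mult_left_mono) linarith+
  finally show "(2 + s) * exp (- b * s\<^sup>2) \<le> \<epsilon>"
    by (simp add: exp_minus divide_simps)
qed

lemma gaussian_bound:
  fixes b :: real
  assumes "0 < b"
  obtains A where "1 \<le> A" "\<And>s. 0 \<le> s \<Longrightarrow> (2 + s) * exp (- b * s\<^sup>2) \<le> A"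
proof -
  obtain r where r: "0 < r" "\<And>s. r \<le> s \<Longrightarrow> (2 + s) * exp (- b * s\<^sup>2) \<le> 1"
    using gaussian_decay[OF assms, of 1] by auto
  show ?thesis
  proof (rule that[of "2 + r"])
    fix s :: real assume s: "0 \<le> s"
    show "(2 + s) * exp (- b * s\<^sup>2) \<le> 2 + r"
    proof (cases "r \<le> s")
      case True
      then show ?thesis using r by (smt (verit))
    next
      case False
      have "(2 + s) * exp (- b * s\<^sup>2) \<le> (2 + s) * 1"
        using s assms by (intro mult_left_mono) auto
      then show ?thesis using False by simp
    qed
  qed (use r in simp)
qed

section \<open>The angular average in the gain term\<close>

context hard_potential
begin

text \<open>The \<sigma>-integral left over in the gain term at fixed v'_* = w and y = v - w, after
  energy conservation has pulled out M(v).\<close>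

definition cap_integral :: "real \<Rightarrow> real^'n \<Rightarrow> real^'n \<Rightarrow> ennreal" where
  "cap_integral a w y = (\<integral>\<^sup>+\<sigma>. ennreal (hsym (sgn y \<bullet> \<sigma>)
     * exp (- a * (norm (w + (norm y / (sgn y \<bullet> \<sigma>)) *\<^sub>R \<sigma> - y))\<^sup>2)) \<partial>sphere_borel)"

lemma cap_integral_le_1:
  assumes "0 < a"
  shows "cap_integral a w y \<le> 1"
proof (cases "y = 0")
  case True
  then show ?thesis by (simp add: cap_integral_def hsym_def)
next
  case False
  have "cap_integral a w y \<le> (\<integral>\<^sup>+\<sigma>. ennreal (hsym (sgn y \<bullet> \<sigma>)) \<partial>sphere_borel)"
    unfolding cap_integral_def using assms
    by (intro nn_integral_mono ennreal_leI) (simp add: mult_left_le)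
  then show ?thesis using False by (simp add: nn_integral_hsym norm_sgn)
qed

lemma cap_integral_measurable [measurable (raw)]:
  assumes [measurable]: "f \<in> borel_measurable M" "g \<in> borel_measurable M"
  shows "(\<lambda>x. cap_integral a (f x) (g x)) \<in> borel_measurable M"
  unfolding cap_integral_def by measurable

text \<open>
  With \<open>y = v - v'\<^sub>*\<close> and \<open>w = v'\<^sub>*\<close> the exponent is \<open>-a|v\<^sub>*|\<^sup>2\<close>, and
  \<open>|v\<^sub>* - v'\<^sub>*| = |y| tan \<phi>\<close> where \<open>\<phi>\<close> is the angle between \<open>y\<close> and \<open>\<sigma>\<close>. Hence for large \<open>y\<close> only
  small \<open>\<phi>\<close> contribute.
\<close>

lemma cap_integral_small:
  assumes a: "0 < a" and \<epsilon>: "0 < \<epsilon>" and r: "0 \<le> r"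
  obtains Y where "0 < Y" "\<And>w y. norm w \<le> r \<Longrightarrow> Y \<le> norm y \<Longrightarrow> cap_integral a w y \<le> ennreal \<epsilon>"
proof -
  obtain \<delta> where \<delta>: "0 < \<delta>" "\<delta> < 1" and cap: "\<And>\<eta> :: real^'n. norm \<eta> = 1 \<Longrightarrow>
      (\<integral>\<^sup>+\<sigma>. indicator {1 - \<delta><..} (\<eta> \<bullet> \<sigma>) * ennreal (hsym (\<eta> \<bullet> \<sigma>)) \<partial>sphere_borel) \<le> ennreal (\<epsilon> / 2)"
    using nn_integral_hsym_cap[of "\<epsilon> / 2"] \<epsilon> by auto
  obtain q where q: "0 < q" "\<And>s. q \<le> s \<Longrightarrow> (2 + s) * exp (- a * s\<^sup>2) \<le> \<epsilon> / 2"
    using gaussian_decay[OF a, of "\<epsilon> / 2"] \<epsilon> by auto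
  \<comment> \<open>Off the cap, |v_* - v'_*| is at least |y| sqrt(2 \<delta>). This choice of Y
    makes it at least q + r, and after |w| \<le> r has been subtracted, |v_*| is still at least
    q.\<close>
  define Y where "Y = (q + r) / sqrt (2 * \<delta>)"
  have Y: "0 < Y" using q(1) r \<delta> by (simp add: Y_def)
  show ?thesis
  proof (rule that[OF Y])
    fix w y :: "real^'n" assume w: "norm w \<le> r" and y: "Y \<le> norm y"
    then have y0: "y \<noteq> 0" using Y by auto
    define \<eta> where "\<eta> = sgn y"
    have \<eta>: "norm \<eta> = 1" using y0 by (simp add: \<eta>_def norm_sgn)
    have y\<eta>: "y = norm y *\<^sub>R \<eta>" using y0 by (simp add: \<eta>_def sgn_div_norm)
    have "cap_integral a w y \<le> (\<integral>\<^sup>+\<sigma>. indicator {1 - \<delta><..} (\<eta> \<bullet> \<sigma>) * ennreal (hsym (\<eta> \<bullet> \<sigma>))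
        + ennreal (\<epsilon> / 2) * ennreal (hsym (\<eta> \<bullet> \<sigma>)) \<partial>sphere_borel)"
      unfolding cap_integral_def
    proof (rule nn_integral_mono_AE)
      show "AE \<sigma> in sphere_borel. ennreal (hsym (sgn y \<bullet> \<sigma>)
          * exp (- a * (norm (w + (norm y / (sgn y \<bullet> \<sigma>)) *\<^sub>R \<sigma> - y))\<^sup>2))
        \<le> indicator {1 - \<delta><..} (\<eta> \<bullet> \<sigma>) * ennreal (hsym (\<eta> \<bullet> \<sigma>)) + ennreal (\<epsilon> / 2)
            * ennreal (hsym (\<eta> \<bullet> \<sigma>))"
        using AE_sphere_borel_norm
      proof eventually_elim
        case (elim \<sigma>)
        let ?c = "\<eta> \<bullet> \<sigma>"
        let ?E = "exp (- a * (norm (w + (norm y / ?c) *\<^sub>R \<sigma> - y))\<^sup>2)"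
        consider "?c \<le> 0" | "1 - \<delta> < ?c" | "0 < ?c" "?c \<le> 1 - \<delta>" by linarith
        then show ?case
        proof cases
          case 1
          then show ?thesis by (simp add: hsym_def \<eta>_def)
        next
          case 2
          have "hsym ?c * ?E \<le> hsym ?c * 1"
            using a by (intro mult_left_mono) auto
          then have "ennreal (hsym ?c * ?E) \<le> ennreal (hsym ?c)" by (intro ennreal_leI) simp
          then have "ennreal (hsym ?c * ?E) \<le> ennreal (hsym ?c) + ennreal (\<epsilon> / 2) * ennreal (hsym ?c)"
            by (rule order_trans) simp
          then show ?thesis using 2 by (simp add: \<eta>_def)
        next
          case 3
          define p where "p = (norm y / ?c) *\<^sub>R \<sigma> - y"
          have ss: "\<sigma> \<bullet> \<sigma> = 1" and ee: "\<eta> \<bullet> \<eta> = 1" using elim \<eta> by (simp_all add: norm_eq_1)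
          have "p = norm y *\<^sub>R ((1 / ?c) *\<^sub>R \<sigma> - \<eta>)"
            using y\<eta> by (simp add: p_def scaleR_diff_right)
          then have "(norm p)\<^sup>2 = (norm y)\<^sup>2 * (norm ((1 / ?c) *\<^sub>R \<sigma> - \<eta>))\<^sup>2"
            by (simp add: power_mult_distrib)
          also have "(norm ((1 / ?c) *\<^sub>R \<sigma> - \<eta>))\<^sup>2 = 1 / ?c\<^sup>2 - 1"
            unfolding power2_norm_eq_inner using 3
            by (simp add: inner_diff_left inner_diff_right ss ee inner_commute power2_eq_square
              field_simps)
          finally have np: "(norm p)\<^sup>2 = (norm y)\<^sup>2 * (1 / ?c\<^sup>2 - 1)" .
          \<comment> \<open>The squared tangent is 1/c^2 - 1; for c \<le> 1 - \<delta> it is at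
            least 2 \<delta>, because (1 + 2 \<delta>)(1 - \<delta>)^2 \<le> 1.\<close>
          have "(1 + 2 * \<delta>) * ?c\<^sup>2 \<le> (1 + 2 * \<delta>) * (1 - \<delta>)\<^sup>2"
            using 3 \<delta> by (intro mult_left_mono power_mono) auto
          also have "\<dots> = 1 - \<delta>\<^sup>2 * (3 - 2 * \<delta>)" by (simp add: power2_eq_square algebra_simps)
          also have "\<dots> \<le> 1" using \<delta> by simp
          finally have "2 * \<delta> \<le> 1 / ?c\<^sup>2 - 1" using 3 by (simp add: field_simps)
          then have "(norm y)\<^sup>2 * (2 * \<delta>) \<le> (norm p)\<^sup>2" unfolding np by (intro mult_left_mono) auto
          then have "(norm y * sqrt (2 * \<delta>))\<^sup>2 \<le> (norm p)\<^sup>2" using \<delta> by (simp add: power_mult_distrib)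
          then have "norm y * sqrt (2 * \<delta>) \<le> norm p" by (rule power2_le_imp_le) simp
          moreover have "q + r \<le> norm y * sqrt (2 * \<delta>)"
            using y \<delta> by (simp add: Y_def field_simps)
          moreover have "norm p - norm w \<le> norm (w + p)" using norm_triangle_ineq2[of p "- w"]
            by (simp add: add.commute)
          ultimately have "q \<le> norm (w + p)" using w by linarith
          then have "(2 + norm (w + p)) * exp (- a * (norm (w + p))\<^sup>2) \<le> \<epsilon> / 2" by (rule q(2))
          moreover have "1 * exp (- a * (norm (w + p))\<^sup>2) \<le> (2 + norm (w + p))
              * exp (- a * (norm (w + p))\<^sup>2)"
            using norm_ge_zero[of "w + p"] by (intro mult_right_mono) auto
          ultimately have "exp (- a * (norm (w + p))\<^sup>2) \<le> \<epsilon> / 2" by linarith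
          then have "?E \<le> \<epsilon> / 2" by (simp add: p_def add_diff_eq)
          then have "hsym ?c * ?E \<le> \<epsilon> / 2 * hsym ?c" by (metis hsym_nonneg mult.commute mult_left_mono)
          then have "ennreal (hsym ?c * ?E) \<le> ennreal (\<epsilon> / 2) * ennreal (hsym ?c)"
            using \<epsilon> by (simp add: ennreal_mult[symmetric] del: ennreal_half)
          then show ?thesis using 3 by (simp add: \<eta>_def)
        qed
      qed
    qed
    also have "\<dots> = (\<integral>\<^sup>+\<sigma>. indicator {1 - \<delta><..} (\<eta> \<bullet> \<sigma>) * ennreal (hsym (\<eta> \<bullet> \<sigma>)) \<partial>sphere_borel)
        + ennreal (\<epsilon> / 2) * (\<integral>\<^sup>+\<sigma>. ennreal (hsym (\<eta> \<bullet> \<sigma>)) \<partial>sphere_borel)"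
      by (simp add: nn_integral_add nn_integral_cmult)
    also have "\<dots> \<le> ennreal (\<epsilon> / 2) + ennreal (\<epsilon> / 2) * 1"
      using cap[OF \<eta>] by (intro add_mono) (simp_all add: nn_integral_hsym[OF \<eta>])
    also have "\<dots> = ennreal \<epsilon>" using \<epsilon> by (simp add: ennreal_plus[symmetric] del: ennreal_plus)
    finally show "cap_integral a w y \<le> ennreal \<epsilon>" .
  qed
qed

text \<open>
  At fixed \<open>v\<close> and \<open>\<sigma>\<close> pass from \<open>z = v - v\<^sub>*\<close> to \<open>y = v - v'\<^sub>* = (z + |z| \<sigma>) / 2\<close>, whose inverse is
  \<open>z = 2 y - (|y|\<^sup>2 / (y \<bullet> \<sigma>)) \<sigma>\<close>. If \<open>c\<close> is the cosine of the angle between \<open>y\<close> and \<open>\<sigma>\<close>, then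
  \<open>cos \<vartheta> = 2 c\<^sup>2 - 1 \<le> c\<close>, so by monotonicity the kernel at \<open>\<vartheta>\<close> is at most the kernel at \<open>c\<close>.
\<close>

lemma nn_integral_gain_le:
  fixes f :: "real^'n \<Rightarrow> real"
  assumes [measurable]: "f \<in> borel_measurable borel" and a: "0 < a"
  shows "(\<integral>\<^sup>+w. \<integral>\<^sup>+\<sigma>. ennreal (\<bar>f (post_star v w \<sigma>)\<bar> * maxwellian a c (post v w \<sigma>))
      * ennreal (Bsym (v - w) \<sigma>) \<partial>sphere_borel \<partial>lborel)
    \<le> ennreal (2 ^ (CARD('n) + 1) * maxwellian a c v) *
       (\<integral>\<^sup>+w. ennreal (\<bar>f w\<bar> * exp (a * (norm w)\<^sup>2) * norm (v - w) powr \<beta>) * cap_integral a w (v - w)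
           \<partial>lborel)"
proof -
  define I where "I w \<sigma> = ennreal (\<bar>f (post_star v w \<sigma>)\<bar> * maxwellian a c (post v w \<sigma>))
      * ennreal (Bsym (v - w) \<sigma>)" for w \<sigma>
  have I[measurable]: "case_prod I \<in> borel_measurable (borel \<Otimes>\<^sub>M borel)"
    unfolding I_def by measurable
  define Z where "Z \<sigma> y = 2 *\<^sub>R y - ((norm y)\<^sup>2 / (y \<bullet> \<sigma>)) *\<^sub>R \<sigma>" for \<sigma> y :: "real^'n"
  define G where "G \<sigma> y = indicator {0<..} (y \<bullet> \<sigma>) *
    ennreal (\<bar>f (v - y)\<bar> * maxwellian a c (v - Z \<sigma> y + y) * Bsym (Z \<sigma> y) \<sigma>)" for \<sigma> y
  have G[measurable]: "case_prod G \<in> borel_measurable (borel \<Otimes>\<^sub>M borel)"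
    unfolding G_def Z_def by measurable
  \<comment> \<open>Replacing z by 2 z turns y = (z + |z| \<sigma>)/2 into the expanding shear; this
    scaling is the origin of the factor 2^d.\<close>
  have shear: "(\<integral>\<^sup>+z. I (v - z) \<sigma> \<partial>lborel) \<le> ennreal (2 ^ CARD('n)) * (\<integral>\<^sup>+y. G \<sigma> y \<partial>lborel)"
    if \<sigma>: "norm \<sigma> = 1" for \<sigma>
  proof -
    have ss: "\<sigma> \<bullet> \<sigma> = 1" using \<sigma> by (simp add: norm_eq_1)
    have [measurable]: "G \<sigma> \<in> borel_measurable borel" unfolding G_def Z_def by measurable
    have IG: "I (v - z) \<sigma> = indicator {0<..} (z \<bullet> \<sigma>) * G \<sigma> ((1/2) *\<^sub>R (z + norm z *\<^sub>R \<sigma>))" for z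
    proof (cases "0 < z \<bullet> \<sigma>")
      case True
      then have z0: "0 < norm z" by auto
      let ?y = "(1/2) *\<^sub>R (z + norm z *\<^sub>R \<sigma>)"
      have y\<sigma>: "?y \<bullet> \<sigma> = (z \<bullet> \<sigma> + norm z) / 2" by (simp add: inner_add_left ss)
      have "(norm ?y)\<^sup>2 = (1/4) * (norm (z + norm z *\<^sub>R \<sigma>))\<^sup>2"
        by (simp add: power_divide)
      also have "(norm (z + norm z *\<^sub>R \<sigma>))\<^sup>2 = 2 * norm z * (z \<bullet> \<sigma> + norm z)"
      proof -
        have "z \<bullet> z = norm z * norm z" by (simp flip: power2_norm_eq_inner power2_eq_square)
        then show ?thesis
          unfolding power2_norm_eq_inner
          by (simp add: inner_add_left inner_add_right ss inner_commute algebra_simps)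
      qed
      also have "(1/4) * (2 * norm z * (z \<bullet> \<sigma> + norm z)) = norm z * (?y \<bullet> \<sigma>)"
        unfolding y\<sigma> by simp
      finally have ny: "(norm ?y)\<^sup>2 = norm z * (?y \<bullet> \<sigma>)" .
      have "(norm ?y)\<^sup>2 / (?y \<bullet> \<sigma>) = norm z" unfolding ny y\<sigma> using True z0 add_pos_pos[OF True z0]
        by simp
      then have Zy: "Z \<sigma> ?y = z" by (simp add: Z_def scaleR_add_right)
      have ps: "post_star v (v - z) \<sigma> = v - ?y" "post v (v - z) \<sigma> = v - z + ?y"
      proof -
        have "v = (1/2) *\<^sub>R v + (1/2) *\<^sub>R v" "z = (1/2) *\<^sub>R z + (1/2) *\<^sub>R z"
          by (simp_all flip: scaleR_add_left)
        then show "post_star v (v - z) \<sigma> = v - ?y" "post v (v - z) \<sigma> = v - z + ?y"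
          unfolding post_star_def post_def
          by (simp_all add: scaleR_add_right scaleR_diff_right)
      qed
      have "0 < ?y \<bullet> \<sigma>" unfolding y\<sigma> using add_pos_pos[OF True z0] by simp
      then show ?thesis using True
        by (simp add: I_def G_def Zy ps ennreal_mult)
    next
      \<comment> \<open>Where z \<bullet> \<sigma> \<le> 0 the kernel vanishes, so restricting to
        the half space on which the shear expands loses nothing.\<close>
      case False
      then have "cos_angle z \<sigma> \<le> 0" by (simp add: cos_angle_def divide_nonpos_nonneg)
      then show ?thesis using False by (simp add: I_def Bsym_def hsym_def)
    qed
    have "(\<integral>\<^sup>+z. I (v - z) \<sigma> \<partial>lborel) = (\<integral>\<^sup>+z. indicator {0<..} (z \<bullet> \<sigma>)
        * G \<sigma> ((1/2) *\<^sub>R (z + norm z *\<^sub>R \<sigma>)) \<partial>lborel)"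
      by (simp add: IG)
    also have "\<dots> = ennreal (\<bar>2\<bar> ^ DIM(real^'n))
        * (\<integral>\<^sup>+z. indicator {0<..} ((0 + 2 *\<^sub>R z) \<bullet> \<sigma>)
        * G \<sigma> ((1/2) *\<^sub>R ((0 + 2 *\<^sub>R z) + norm (0 + 2 *\<^sub>R z) *\<^sub>R \<sigma>)) \<partial>lborel)"
    proof (rule nn_integral_lborel_affine)
      have "(\<lambda>z. G \<sigma> ((1/2) *\<^sub>R (z + norm z *\<^sub>R \<sigma>))) \<in> borel_measurable borel"
        by (rule measurable_compose[OF _ \<open>G \<sigma> \<in> borel_measurable borel\<close>]) measurable
      then show "(\<lambda>z. indicator {0<..} (z \<bullet> \<sigma>) * G \<sigma> ((1/2) *\<^sub>R (z + norm z *\<^sub>R \<sigma>)))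
          \<in> borel_measurable borel"
        by (intro borel_measurable_times_ennreal) measurable
    qed simp
    also have "\<dots> = ennreal (2 ^ CARD('n))
        * (\<integral>\<^sup>+z. indicator {0<..} (z \<bullet> \<sigma>) * G \<sigma> (z + norm z *\<^sub>R \<sigma>) \<partial>lborel)"
      by (intro arg_cong2[of _ _ _ _ "(*)"] nn_integral_cong)
        (auto simp: scaleR_add_right zero_less_mult_iff split: split_indicator)
    also have "\<dots> \<le> ennreal (2 ^ CARD('n)) * (\<integral>\<^sup>+y. G \<sigma> y \<partial>lborel)"
      by (intro mult_left_mono nn_integral_shear_le \<sigma>) measurable
    finally show ?thesis .
  qed
  have G_le: "G \<sigma> y \<le> ennreal (2 * maxwellian a c v)
      * (ennreal (\<bar>f (v - y)\<bar> * exp (a * (norm (v - y))\<^sup>2) * norm y powr \<beta>)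
      * ennreal (hsym (sgn y \<bullet> \<sigma>) * exp (- a * (norm (v - y + (norm y / (sgn y \<bullet> \<sigma>)) *\<^sub>R \<sigma> - y))\<^sup>2)))"
    if \<sigma>: "norm \<sigma> = 1" for \<sigma> y
  proof (cases "0 < y \<bullet> \<sigma>")
    case True
    have ss: "\<sigma> \<bullet> \<sigma> = 1" using \<sigma> by (simp add: norm_eq_1)
    define n where "n = norm y"
    define c' where "c' = sgn y \<bullet> \<sigma>"
    have n: "0 < n" using True by (auto simp: n_def)
    have y\<sigma>: "y \<bullet> \<sigma> = n * c'" using n by (simp add: c'_def n_def sgn_div_norm)
    then have \<sigma>y: "\<sigma> \<bullet> y = n * c'" by (simp add: inner_commute)
    have c': "0 < c'" using True n by (simp add: y\<sigma> zero_less_mult_iff)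
    have c'1: "c' \<le> 1"
      using norm_cauchy_schwarz[of "sgn y" \<sigma>] \<sigma> n by (simp add: c'_def norm_sgn n_def split: if_splits)
    have Zy: "Z \<sigma> y = 2 *\<^sub>R y - (n / c') *\<^sub>R \<sigma>"
      using n by (simp add: Z_def y\<sigma> power2_eq_square flip: n_def)
    have yy: "y \<bullet> y = n\<^sup>2" by (simp add: n_def power2_norm_eq_inner)
    have "(norm (Z \<sigma> y))\<^sup>2 = (n / c')\<^sup>2"
      unfolding power2_norm_eq_inner Zy using c' n
      by (simp add: inner_diff_left inner_diff_right ss yy y\<sigma> \<sigma>y power2_eq_square field_simps)
    then have nZ: "norm (Z \<sigma> y) = n / c'"
      using c' n by (subst (asm) power2_eq_iff_nonneg) auto
    have "Z \<sigma> y \<bullet> \<sigma> = 2 * n * c' - n / c'" by (simp add: Zy inner_diff_left ss y\<sigma>)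
    then have ca: "cos_angle (Z \<sigma> y) \<sigma> = 2 * c'\<^sup>2 - 1"
      using n c' by (simp add: cos_angle_def nZ field_simps power2_eq_square)
    \<comment> \<open>Where the left side does not vanish, 2 \<open>c'\<close>^2 > 1, hence
      \<open>c'\<close> \<ge> 1/2 and |Z| = n/\<open>c'\<close> \<le> 2 n. Since \<beta> \<le> 1
      this costs a factor 2, which raises the exponent in the constant from d to d + 1.\<close>
    have hs: "Bsym (Z \<sigma> y) \<sigma> \<le> 2 * n powr \<beta> * hsym c'"
    proof (cases "0 < 2 * c'\<^sup>2 - 1 \<and> c' < 1")
      case True
      have "(2 * c' + 1) * (c' - 1) \<le> 0" using c' c'1 by (intro mult_nonneg_nonpos) auto
      then have "2 * c'\<^sup>2 - 1 \<le> c'" by (simp add: power2_eq_square algebra_simps)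
      then have h: "hsym (2 * c'\<^sup>2 - 1) \<le> hsym c'" using True by (intro hsym_mono) auto
      have "1 / 2 \<le> c'"
      proof (rule ccontr)
        assume "\<not> 1 / 2 \<le> c'"
        then have "c'\<^sup>2 \<le> (1/2)\<^sup>2" using c' by (intro power_mono) auto
        then show False using True by (simp add: power2_eq_square)
      qed
      then have "n / c' \<le> 2 * n" using n c' by (simp add: field_simps)
      then have "(n / c') powr \<beta> \<le> (2 * n) powr \<beta>" using n c' beta_pos by (intro powr_mono2) auto
      also have "\<dots> = 2 powr \<beta> * n powr \<beta>" using n by (simp add: powr_mult)
      also have "\<dots> \<le> 2 powr 1 * n powr \<beta>"
        using beta_le_1 by (intro mult_right_mono powr_mono) auto
      finally have "(n / c') powr \<beta> \<le> 2 * n powr \<beta>" by simp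
      then show ?thesis
        unfolding Bsym_def nZ ca by (intro mult_mono h) auto
    next
      case False
      then have "hsym (2 * c'\<^sup>2 - 1) = 0" using c'1 by (auto simp: hsym_def)
      then show ?thesis by (simp add: Bsym_def ca)
    qed
    \<comment> \<open>By this identity v - v'_* is orthogonal to v'_* - v_*, as on Thales' circle;
      what follows from it is conservation of energy, |v'|^2 + |v'_*|^2 = |v|^2 + |v_*|^2.\<close>
    have yZ: "y \<bullet> Z \<sigma> y = n\<^sup>2"
      using c' n by (simp add: Zy inner_diff_right yy y\<sigma> power2_eq_square)
    have nv: "(norm (v - Z \<sigma> y + y))\<^sup>2 = (norm v)\<^sup>2 + (norm (v - Z \<sigma> y))\<^sup>2 - (norm (v - y))\<^sup>2"
      using yZ unfolding power2_norm_eq_inner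
      by (simp add: inner_add_left inner_add_right inner_diff_left inner_diff_right yy inner_commute
        algebra_simps)
    have mx: "maxwellian a c (v - Z \<sigma> y + y) = maxwellian a c v * exp (a * (norm (v - y))\<^sup>2)
        * exp (- a * (norm (v - Z \<sigma> y))\<^sup>2)"
      unfolding maxwellian_def nv exp_add[symmetric] by (simp add: algebra_simps)
    have vZ: "v - Z \<sigma> y = v - y + (n / c') *\<^sub>R \<sigma> - y" by (simp add: Zy scaleR_2 algebra_simps)
    let ?E = "exp (- a * (norm (v - Z \<sigma> y))\<^sup>2)"
    have "\<bar>f (v - y)\<bar> * maxwellian a c (v - Z \<sigma> y + y) * Bsym (Z \<sigma> y) \<sigma>
      \<le> \<bar>f (v - y)\<bar> * maxwellian a c (v - Z \<sigma> y + y) * (2 * n powr \<beta> * hsym c')"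
      by (intro mult_left_mono hs) auto
    also have "\<dots> = 2 * maxwellian a c v * ((\<bar>f (v - y)\<bar> * exp (a * (norm (v - y))\<^sup>2) * n powr \<beta>)
        * (hsym c' * ?E))"
      by (simp add: mx mult_ac)
    finally have "ennreal (\<bar>f (v - y)\<bar> * maxwellian a c (v - Z \<sigma> y + y) * Bsym (Z \<sigma> y) \<sigma>)
      \<le> ennreal (2 * maxwellian a c v) * (ennreal (\<bar>f (v - y)\<bar> * exp (a * (norm (v - y))\<^sup>2)
          * n powr \<beta>) * ennreal (hsym c' * ?E))"
      by (simp add: ennreal_mult[symmetric] ennreal_leI)
    then show ?thesis using True
      by (simp add: G_def vZ flip: n_def c'_def)
  qed (simp add: G_def)
  have "(\<integral>\<^sup>+w. \<integral>\<^sup>+\<sigma>. I w \<sigma> \<partial>sphere_borel \<partial>lborel) = (\<integral>\<^sup>+z. \<integral>\<^sup>+\<sigma>. I (v - z) \<sigma> \<partial>sphere_borel \<partial>lborel)"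
    by (rule nn_integral_lborel_reflect[symmetric]) measurable
  also have "\<dots> = (\<integral>\<^sup>+\<sigma>. \<integral>\<^sup>+z. I (v - z) \<sigma> \<partial>lborel \<partial>sphere_borel)"
    by (rule lborel_sphere.Fubini'[symmetric]) measurable
  also have "\<dots> \<le> (\<integral>\<^sup>+\<sigma>. ennreal (2 ^ CARD('n)) * (\<integral>\<^sup>+y. G \<sigma> y \<partial>lborel) \<partial>sphere_borel)"
    using AE_sphere_borel_norm by (intro nn_integral_mono_AE, eventually_elim) (rule shear)
  also have "\<dots> = ennreal (2 ^ CARD('n)) * (\<integral>\<^sup>+\<sigma>. \<integral>\<^sup>+y. G \<sigma> y \<partial>lborel \<partial>sphere_borel)"
    by (rule nn_integral_cmult) measurable
  also have "(\<integral>\<^sup>+\<sigma>. \<integral>\<^sup>+y. G \<sigma> y \<partial>lborel \<partial>sphere_borel) = (\<integral>\<^sup>+y. \<integral>\<^sup>+\<sigma>. G \<sigma> y \<partial>sphere_borel \<partial>lborel)"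
    by (rule lborel_sphere.Fubini') measurable
  also have "\<dots> \<le> (\<integral>\<^sup>+y. \<integral>\<^sup>+\<sigma>. ennreal (2 * maxwellian a c v)
      * (ennreal (\<bar>f (v - y)\<bar> * exp (a * (norm (v - y))\<^sup>2) * norm y powr \<beta>)
      * ennreal (hsym (sgn y \<bullet> \<sigma>) * exp (- a * (norm (v - y + (norm y / (sgn y \<bullet> \<sigma>)) *\<^sub>R \<sigma> - y))\<^sup>2)))
          \<partial>sphere_borel \<partial>lborel)"
    by (rule nn_integral_mono, rule nn_integral_mono_AE, rule eventually_mono[OF AE_sphere_borel_norm])
      (rule G_le)
  also have "\<dots> = (\<integral>\<^sup>+y. ennreal (2 * maxwellian a c v)
      * (ennreal (\<bar>f (v - y)\<bar> * exp (a * (norm (v - y))\<^sup>2) * norm y powr \<beta>)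
      * cap_integral a (v - y) y) \<partial>lborel)"
    unfolding cap_integral_def by (intro nn_integral_cong) (simp add: nn_integral_cmult)
  also have "\<dots> = ennreal (2 * maxwellian a c v)
      * (\<integral>\<^sup>+y. ennreal (\<bar>f (v - y)\<bar> * exp (a * (norm (v - y))\<^sup>2) * norm y powr \<beta>)
      * cap_integral a (v - y) y \<partial>lborel)"
    by (rule nn_integral_cmult) measurable
  also have "(\<integral>\<^sup>+y. ennreal (\<bar>f (v - y)\<bar> * exp (a * (norm (v - y))\<^sup>2) * norm y powr \<beta>)
      * cap_integral a (v - y) y \<partial>lborel)
    = (\<integral>\<^sup>+w. ennreal (\<bar>f (v - (v - w))\<bar> * exp (a * (norm (v - (v - w)))\<^sup>2) * norm (v - w) powr \<beta>)
        * cap_integral a (v - (v - w)) (v - w) \<partial>lborel)"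
    by (rule nn_integral_lborel_reflect[symmetric]) measurable
  finally have "(\<integral>\<^sup>+w. \<integral>\<^sup>+\<sigma>. I w \<sigma> \<partial>sphere_borel \<partial>lborel) \<le> ennreal (2 ^ CARD('n))
      * (ennreal (2 * maxwellian a c v) *
      (\<integral>\<^sup>+w. ennreal (\<bar>f w\<bar> * exp (a * (norm w)\<^sup>2) * norm (v - w) powr \<beta>) * cap_integral a w (v - w)
          \<partial>lborel))"
    by (simp add: mult_left_mono)
  also have "ennreal (2 ^ CARD('n)) * (ennreal (2 * maxwellian a c v) * X)
      = ennreal (2 ^ (CARD('n) + 1) * maxwellian a c v) * X" for X
    by (subst mult.assoc[symmetric], subst ennreal_mult[symmetric]) (simp_all add: mult_ac)
  finally show ?thesis unfolding I_def .
qed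

section \<open>Measurability and absolute convergence of the collision integrals\<close>

lemma B_bar_measurable [measurable (raw)]:
  assumes [measurable]: "f \<in> borel_measurable M" and g: "g \<in> M \<rightarrow>\<^sub>M sphere_measure"
  shows "(\<lambda>x. B_bar B (f x) (g x)) \<in> borel_measurable M"
proof -
  have [measurable]: "g \<in> borel_measurable M"
    using measurable_compose[OF g measurable_ident_sphere_measure] .
  define h0 where "h0 c = (if c \<in> {-1<..<1} then h c else 0)" for c
  have [measurable]: "h0 \<in> borel_measurable borel"
    using h_cut_measurable unfolding h0_def[abs_def] .
  \<comment> \<open>\<open>B_bar\<close> itself, and not only its almost everywhere equal version
    \<open>Bsym\<close>, has to be measurable for the sphere measure, which is not completed.
    Cosines lie in [-1, 1] there, so restoring the two endpoint values of h gives a Borel function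
    of the cosine.\<close>
  define h1 where "h1 c = (if c = 1 then h 1 else if c = -1 then h (-1) else h0 c)" for c
  have [measurable]: "h1 \<in> borel_measurable borel" unfolding h1_def[abs_def] by measurable
  have "(\<lambda>x. B_bar B (f x) (g x)) \<in> borel_measurable M \<longleftrightarrow> (\<lambda>x. if 0 < cos_angle (f x) (g x)
    then norm (f x) powr \<beta> * (h1 (cos_angle (f x) (g x)) + h1 (- cos_angle (f x) (g x))) else 0)
        \<in> borel_measurable M"
  proof (rule measurable_cong)
    fix x assume "x \<in> space M"
    then have "norm (g x) = 1" using measurable_space[OF g] by simp
    then have "\<bar>f x \<bullet> g x\<bar> \<le> norm (f x)" using Cauchy_Schwarz_ineq2[of "f x" "g x"] by simp
    then have "\<bar>cos_angle (f x) (g x)\<bar> \<le> 1" by (simp add: cos_angle_def divide_le_eq_1)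
    then have "h1 (cos_angle (f x) (g x)) = h (cos_angle (f x) (g x))"
      "h1 (- cos_angle (f x) (g x)) = h (- cos_angle (f x) (g x))"
      by (auto simp: h1_def h0_def)
    moreover have "cos_angle (f x) (- g x) = - cos_angle (f x) (g x)" by (simp add: cos_angle_def)
    moreover have "B z \<sigma> = norm z powr \<beta> * h (cos_angle z \<sigma>)" for z \<sigma>
      using kernel by (auto simp: hard_potential_cutoff_def)
    ultimately show "B_bar B (f x) (g x) = (if 0 < cos_angle (f x) (g x)
      then norm (f x) powr \<beta> * (h1 (cos_angle (f x) (g x)) + h1 (- cos_angle (f x) (g x))) else 0)"
      by (simp add: B_bar_def algebra_simps)
  qed
  then show ?thesis by simp
qed

lemma gain_integrand_measurable:
  fixes F :: "'z \<Rightarrow> real^'n \<Rightarrow> real" and g :: "real^'n \<Rightarrow> real"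
  assumes F: "case_prod F \<in> borel_measurable (N \<Otimes>\<^sub>M borel)"
    and [measurable]: "g \<in> borel_measurable borel" "V \<in> borel_measurable N"
  shows "(\<lambda>(y, p). gain_integrand B (F y) g (V y) p)
      \<in> borel_measurable (N \<Otimes>\<^sub>M (lborel \<Otimes>\<^sub>M sphere_measure))"
proof -
  let ?M = "N \<Otimes>\<^sub>M (lborel \<Otimes>\<^sub>M (sphere_measure :: (real^'n) measure))"
  have s: "(\<lambda>x. snd (snd x)) \<in> ?M \<rightarrow>\<^sub>M sphere_measure" by measurable
  note [measurable] = measurable_compose[OF s measurable_ident_sphere_measure]
  have "(\<lambda>x. (fst x, post_star (V (fst x)) (fst (snd x)) (snd (snd x)))) \<in> ?M \<rightarrow>\<^sub>M N \<Otimes>\<^sub>M borel"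
    by measurable
  from measurable_compose[OF this F]
  have [measurable]: "(\<lambda>x. F (fst x) (post_star (V (fst x)) (fst (snd x)) (snd (snd x))))
      \<in> borel_measurable ?M"
    by simp
  show ?thesis unfolding gain_integrand_def by measurable
qed

lemma sigma_finite_gain: "sigma_finite_measure (lborel \<Otimes>\<^sub>M (sphere_measure :: (real^'n) measure))"
  by (intro sigma_finite_pair_measure lborel.sigma_finite_measure_axioms
    sphere_measure.sigma_finite_measure_axioms)

lemma Q_plus_measurable:
  fixes F :: "'z \<Rightarrow> real^'n \<Rightarrow> real" and g :: "real^'n \<Rightarrow> real"
  assumes "case_prod F \<in> borel_measurable (N \<Otimes>\<^sub>M borel)"
    and "g \<in> borel_measurable borel" "V \<in> borel_measurable N"
  shows "(\<lambda>y. Q_plus B (F y) g (V y)) \<in> borel_measurable N"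
  unfolding Q_plus_def
  using sigma_finite_measure.borel_measurable_lebesgue_integral[OF sigma_finite_gain
    gain_integrand_measurable[OF assms]] .

lemma gain_integrand_measurable_at:
  fixes f g :: "real^'n \<Rightarrow> real"
  assumes [measurable]: "f \<in> borel_measurable borel" "g \<in> borel_measurable borel"
  shows "gain_integrand B f g v \<in> borel_measurable (lborel \<Otimes>\<^sub>M sphere_measure)"
  using measurable_compose_Pair1[OF _ gain_integrand_measurable[of "\<lambda>_. f" borel g "\<lambda>_. v"], of
    "0::real"] assms
  by simp

text \<open>Replaces \<open>B_bar\<close> by the nonnegative \<open>Bsym\<close> and the sphere
  measure by its version on the whole space; the estimates of the gain term start from this
  form.\<close>

lemma nn_integral_gain_integrand:
  fixes f g :: "real^'n \<Rightarrow> real"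
  assumes [measurable]: "f \<in> borel_measurable borel" "g \<in> borel_measurable borel"
  shows "(\<integral>\<^sup>+p. ennreal \<bar>gain_integrand B f g v p\<bar> \<partial>(lborel \<Otimes>\<^sub>M sphere_measure))
    = (\<integral>\<^sup>+w. \<integral>\<^sup>+\<sigma>. ennreal (\<bar>f (post_star v w \<sigma>)\<bar> * \<bar>g (post v w \<sigma>)\<bar>) * ennreal (Bsym (v - w) \<sigma>)
        \<partial>sphere_borel \<partial>lborel)"
proof -
  note gain_integrand_measurable_at[OF assms, measurable]
  have "(\<integral>\<^sup>+p. ennreal \<bar>gain_integrand B f g v p\<bar> \<partial>(lborel \<Otimes>\<^sub>M sphere_measure))
      = (\<integral>\<^sup>+w. \<integral>\<^sup>+\<sigma>. ennreal \<bar>gain_integrand B f g v (w, \<sigma>)\<bar> \<partial>sphere_measure \<partial>lborel)"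
    by (rule sphere_measure.nn_integral_fst[symmetric]) measurable
  also have "\<dots> = (\<integral>\<^sup>+w. \<integral>\<^sup>+\<sigma>. ennreal (\<bar>f (post_star v w \<sigma>)\<bar> * \<bar>g (post v w \<sigma>)\<bar>)
      * ennreal (Bsym (v - w) \<sigma>) \<partial>sphere_borel \<partial>lborel)"
  proof (rule nn_integral_cong)
    fix w
    have "(\<integral>\<^sup>+\<sigma>. ennreal (\<bar>f (post_star v w \<sigma>)\<bar> * \<bar>g (post v w \<sigma>)\<bar>) * ennreal (Bsym (v - w) \<sigma>)
        \<partial>sphere_borel)
      = (\<integral>\<^sup>+\<sigma>. ennreal (\<bar>f (post_star v w \<sigma>)\<bar> * \<bar>g (post v w \<sigma>)\<bar>) * ennreal (Bsym (v - w) \<sigma>)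
          \<partial>sphere_measure)"
      unfolding sphere_borel_def
      by (rule nn_integral_distr) (auto simp: measurable_ident_sphere_measure)
    also have "\<dots> = (\<integral>\<^sup>+\<sigma>. ennreal \<bar>gain_integrand B f g v (w, \<sigma>)\<bar> \<partial>sphere_measure)"
    proof (rule nn_integral_cong_AE)
      have "AE \<sigma> in sphere_measure. B_bar B (v - w) \<sigma> = Bsym (v - w) \<sigma>"
        using AE_distrD[OF measurable_ident_sphere_measure AE_B_bar_eq[of
          "v - w", unfolded sphere_borel_def]] .
      then show "AE \<sigma> in sphere_measure. ennreal (\<bar>f (post_star v w \<sigma>)\<bar> * \<bar>g (post v w \<sigma>)\<bar>)
          * ennreal (Bsym (v - w) \<sigma>)
          = ennreal \<bar>gain_integrand B f g v (w, \<sigma>)\<bar>"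
        by eventually_elim (simp add: gain_integrand_def abs_mult ennreal_mult)
    qed
    finally show "(\<integral>\<^sup>+\<sigma>. ennreal \<bar>gain_integrand B f g v (w, \<sigma>)\<bar> \<partial>sphere_measure)
      = (\<integral>\<^sup>+\<sigma>. ennreal (\<bar>f (post_star v w \<sigma>)\<bar> * \<bar>g (post v w \<sigma>)\<bar>) * ennreal (Bsym (v - w) \<sigma>)
          \<partial>sphere_borel)" ..
  qed
  finally show ?thesis .
qed

text \<open>Holds also in the divergent case, where \<open>Q_plus\<close> is 0 by the convention for
  Bochner integrals.\<close>

lemma ennreal_abs_Q_plus_le:
  "ennreal \<bar>Q_plus B f g v\<bar> \<le> (\<integral>\<^sup>+p. ennreal \<bar>gain_integrand B f g v p\<bar> \<partial>(lborel \<Otimes>\<^sub>M sphere_measure))"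
proof (cases "integrable (lborel \<Otimes>\<^sub>M sphere_measure) (gain_integrand B f g v)")
  case True
  from integral_norm_bound_ennreal[OF this] show ?thesis by (simp add: Q_plus_def)
qed (simp add: Q_plus_def not_integrable_integral_eq)

section \<open>Smallness of the gain and the sign of the collision term at large velocities\<close>

lemma maxwellian_ratio:
  "exp (a * (norm w)\<^sup>2) * maxwellian a1 c1 w = exp c1 * exp (- (a1 - a) * (norm w)\<^sup>2)"
  by (simp add: maxwellian_def algebra_simps flip: exp_add)

text \<open>The w-integral in the bound for the gain is split at |w| = r. Outside, the Gaussian
  factor with exponent a1 - a is small and the angular average is only bounded by 1; inside, |v - w|
  is large and the angular average is small.\<close>

lemma gain_small:
  fixes a a1 c1 K \<epsilon> :: real
  assumes a: "0 < a" "a < a1" and \<epsilon>: "0 < \<epsilon>" and K: "0 \<le> K"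
  obtains R where "1 \<le> R"
    "\<And>f v c. f \<in> borel_measurable borel \<Longrightarrow> (\<integral>\<^sup>+w. ennreal (\<bar>f w\<bar> / maxwellian a1 c1 w) \<partial>lborel)
        \<le> ennreal K
      \<Longrightarrow> R \<le> norm v \<Longrightarrow> Q_plus B f (maxwellian a c) v \<le> \<epsilon> * norm v powr \<beta> * maxwellian a c v"
proof -
  define b where "b = a1 - a"
  have b: "0 < b" using a by (simp add: b_def)
  obtain A0 where A0: "1 \<le> A0" "\<And>s. 0 \<le> s \<Longrightarrow> (2 + s) * exp (- b * s\<^sup>2) \<le> A0"
    using gaussian_bound[OF b] by auto
  \<comment> \<open>The \<open>+ 1\<close> secures A \<ge> 1, so that the constant A e serves in
    both regions. Then e is fixed by 2^(d+1) A e (K + 1) = \<epsilon>, where K + 1 is positive even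
    for K = 0.\<close>
  define A where "A = A0 * exp c1 + 1"
  have A: "1 \<le> A" using A0 by (simp add: A_def)
  define e where "e = \<epsilon> / (2 ^ (CARD('n) + 1) * A * (K + 1))"
  have e: "0 < e" using \<epsilon> A K by (simp add: e_def)
  obtain r where r: "0 < r" "\<And>s. r \<le> s \<Longrightarrow> (2 + s) * exp (- b * s\<^sup>2) \<le> e / exp c1"
    using gaussian_decay[OF b, of "e / exp c1"] e by auto
  obtain Y where Y: "0 < Y" "\<And>w y :: real^'n. norm w \<le> r \<Longrightarrow> Y \<le> norm y \<Longrightarrow> cap_integral a w y \<le> ennreal e"
    using cap_integral_small[OF a(1) e, of r] r(1) by auto
  show ?thesis
  \<comment> \<open>|v| \<ge> 1 gives |v| + |w| \<le> |v| (1 + |w|), and |v| \<ge> Y + r gives |v -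
    w| \<ge> Y for |w| \<le> r.\<close>
  proof (rule that[of "max 1 (Y + r)"])
    fix f :: "real^'n \<Rightarrow> real" and v :: "real^'n" and c :: real
    assume f[measurable]: "f \<in> borel_measurable borel"
      and fK: "(\<integral>\<^sup>+w. ennreal (\<bar>f w\<bar> / maxwellian a1 c1 w) \<partial>lborel) \<le> ennreal K"
      and v: "max 1 (Y + r) \<le> norm v"
    have bound: "ennreal (\<bar>f w\<bar> * exp (a * (norm w)\<^sup>2) * norm (v - w) powr \<beta>) * cap_integral a w (v - w)
      \<le> ennreal (norm v powr \<beta> * (A * e)) * ennreal (\<bar>f w\<bar> / maxwellian a1 c1 w)" for w
    proof -
      have "norm (v - w) \<le> norm v + norm w" by (rule norm_triangle_ineq4)
      also have "\<dots> \<le> norm v * (1 + norm w)" using v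
        by (simp add: algebra_simps mult_left_le_imp_le) (metis max.boundedE mult_right_mono
        norm_ge_zero mult_1)
      finally have "norm (v - w) powr \<beta> \<le> (norm v * (1 + norm w)) powr \<beta>"
        using beta_pos by (intro powr_mono2) auto
      also have "\<dots> = norm v powr \<beta> * (1 + norm w) powr \<beta>" by (simp add: powr_mult)
      also have "\<dots> \<le> norm v powr \<beta> * (1 + norm w) powr 1"
        using beta_le_1 by (intro mult_left_mono powr_mono) auto
      also have "\<dots> \<le> norm v powr \<beta> * (2 + norm w)" by (intro mult_left_mono) auto
      finally have p: "norm (v - w) powr \<beta> \<le> norm v powr \<beta> * (2 + norm w)" .
      have q: "\<bar>f w\<bar> * exp (a * (norm w)\<^sup>2) * norm (v - w) powr \<beta>
        \<le> norm v powr \<beta> * ((2 + norm w) * exp (- b * (norm w)\<^sup>2) * exp c1)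
            * (\<bar>f w\<bar> / maxwellian a1 c1 w)"
      proof -
        have E: "exp (a * (norm w)\<^sup>2) = exp c1 * exp (- b * (norm w)\<^sup>2) / maxwellian a1 c1 w"
          by (simp add: eq_divide_eq less_imp_neq[OF maxwellian_pos, symmetric] maxwellian_ratio b_def)
        have "\<bar>f w\<bar> * exp (a * (norm w)\<^sup>2) * norm (v - w) powr \<beta>
          \<le> \<bar>f w\<bar> * exp (a * (norm w)\<^sup>2) * (norm v powr \<beta> * (2 + norm w))"
          by (intro mult_left_mono p) auto
        then show ?thesis unfolding E by (simp add: mult_ac)
      qed
      let ?g = "\<bar>f w\<bar> / maxwellian a1 c1 w"
      have g: "0 \<le> ?g" by (simp add: less_imp_le)
      show ?thesis
      proof (cases "norm w \<le> r")
        case True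
        have "norm v - norm w \<le> norm (v - w)" by (rule norm_triangle_ineq2)
        then have "Y \<le> norm (v - w)" using True v by simp
        then have J: "cap_integral a w (v - w) \<le> ennreal e" by (intro Y(2) True)
        have "(2 + norm w) * exp (- b * (norm w)\<^sup>2) * exp c1 \<le> A0 * exp c1"
          by (intro mult_right_mono A0(2)) auto
        also have "\<dots> \<le> A" by (simp add: A_def)
        finally have "norm v powr \<beta> * ((2 + norm w) * exp (- b * (norm w)\<^sup>2) * exp c1) * ?g
            \<le> norm v powr \<beta> * A * ?g"
          by (intro mult_right_mono[OF _ g] mult_left_mono) auto
        with q have "\<bar>f w\<bar> * exp (a * (norm w)\<^sup>2) * norm (v - w) powr \<beta> \<le> norm v powr \<beta> * A * ?g"
          by linarith
        then have "ennreal (\<bar>f w\<bar> * exp (a * (norm w)\<^sup>2) * norm (v - w) powr \<beta>)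
            * cap_integral a w (v - w)
          \<le> ennreal (norm v powr \<beta> * A * ?g) * ennreal e"
          by (rule mult_mono[OF ennreal_leI J]) auto
        also have "\<dots> = ennreal (norm v powr \<beta> * (A * e)) * ennreal ?g"
          using A e g by (simp add: ennreal_mult[symmetric] mult_ac)
        finally show ?thesis .
      next
        case False
        then have "(2 + norm w) * exp (- b * (norm w)\<^sup>2) \<le> e / exp c1" by (intro r(2)) simp
        then have "(2 + norm w) * exp (- b * (norm w)\<^sup>2) * exp c1 \<le> e" by (simp add: field_simps)
        also have "\<dots> \<le> A * e" using A e by simp
        finally have "norm v powr \<beta> * ((2 + norm w) * exp (- b * (norm w)\<^sup>2) * exp c1) * ?g
            \<le> norm v powr \<beta> * (A * e) * ?g"
          by (intro mult_right_mono[OF _ g] mult_left_mono) auto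
        with q have "\<bar>f w\<bar> * exp (a * (norm w)\<^sup>2) * norm (v - w) powr \<beta> \<le> norm v powr \<beta> * (A * e)
            * ?g" by linarith
        then have "ennreal (\<bar>f w\<bar> * exp (a * (norm w)\<^sup>2) * norm (v - w) powr \<beta>)
            * cap_integral a w (v - w)
          \<le> ennreal (norm v powr \<beta> * (A * e) * ?g) * 1"
          by (rule mult_mono[OF ennreal_leI cap_integral_le_1[OF a(1)]]) auto
        also have "\<dots> = ennreal (norm v powr \<beta> * (A * e)) * ennreal ?g"
          using A e g by (simp add: ennreal_mult[symmetric] mult_ac)
        finally show ?thesis .
      qed
    qed
    have "ennreal (Q_plus B f (maxwellian a c) v) \<le> ennreal \<bar>Q_plus B f (maxwellian a c) v\<bar>"
      by (intro ennreal_leI) simp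
    also have "\<dots> \<le> (\<integral>\<^sup>+w. \<integral>\<^sup>+\<sigma>. ennreal (\<bar>f (post_star v w \<sigma>)\<bar> * maxwellian a c (post v w \<sigma>))
        * ennreal (Bsym (v - w) \<sigma>) \<partial>sphere_borel \<partial>lborel)"
      using ennreal_abs_Q_plus_le[of f "maxwellian a c" v]
      by (simp add: nn_integral_gain_integrand)
    also have "\<dots> \<le> ennreal (2 ^ (CARD('n) + 1) * maxwellian a c v) *
       (\<integral>\<^sup>+w. ennreal (\<bar>f w\<bar> * exp (a * (norm w)\<^sup>2) * norm (v - w) powr \<beta>) * cap_integral a w (v - w)
           \<partial>lborel)"
      by (rule nn_integral_gain_le[OF f a(1)])
    also have "\<dots> \<le> ennreal (2 ^ (CARD('n) + 1) * maxwellian a c v) *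
       (\<integral>\<^sup>+w. ennreal (norm v powr \<beta> * (A * e)) * ennreal (\<bar>f w\<bar> / maxwellian a1 c1 w) \<partial>lborel)"
      by (intro mult_left_mono nn_integral_mono bound) simp
    also have "\<dots> = ennreal (2 ^ (CARD('n) + 1) * maxwellian a c v) *
       (ennreal (norm v powr \<beta> * (A * e)) * (\<integral>\<^sup>+w. ennreal (\<bar>f w\<bar> / maxwellian a1 c1 w) \<partial>lborel))"
      by (subst nn_integral_cmult) auto
    also have "\<dots> \<le> ennreal (2 ^ (CARD('n) + 1) * maxwellian a c v)
        * (ennreal (norm v powr \<beta> * (A * e)) * ennreal K)"
      by (intro mult_left_mono fK) auto
    also have "\<dots> = ennreal (2 ^ (CARD('n) + 1) * maxwellian a c v * (norm v powr \<beta> * (A * e) * K))"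
      using A e K by (simp add: ennreal_mult)
    also have "\<dots> \<le> ennreal (\<epsilon> * norm v powr \<beta> * maxwellian a c v)"
    proof (rule ennreal_leI)
      have "2 ^ (CARD('n) + 1) * (A * e) * (K + 1) = \<epsilon>"
        using A K by (simp add: e_def)
      moreover have "2 ^ (CARD('n) + 1) * (A * e) * K \<le> 2 ^ (CARD('n) + 1) * (A * e) * (K + 1)"
        using A e K by (intro mult_left_mono) auto
      ultimately have "2 ^ (CARD('n) + 1) * (A * e) * K \<le> \<epsilon>" by linarith
      then have "(2 ^ (CARD('n) + 1) * (A * e) * K) * (norm v powr \<beta> * maxwellian a c v) \<le> \<epsilon>
          * (norm v powr \<beta> * maxwellian a c v)"
        by (intro mult_right_mono) auto
      then show "2 ^ (CARD('n) + 1) * maxwellian a c v * (norm v powr \<beta> * (A * e) * K) \<le> \<epsilon>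
          * norm v powr \<beta> * maxwellian a c v"
        by (simp add: mult_ac)
    qed
    finally show "Q_plus B f (maxwellian a c) v \<le> \<epsilon> * norm v powr \<beta> * maxwellian a c v"
      using \<epsilon> by (subst (asm) ennreal_le_iff) auto
  qed simp
qed

text \<open>The loss is bounded below by means of f - e g with g = f/M_1. For |w| \<le> |v|/2 this
  is at most f, and |v - w| \<ge> |v|/2; for larger w it is nonpositive, because M_1 \<le> e there.
  Its integral is at least \<rho>0 - e K \<ge> \<rho>0/2, so the loss is at least (\<rho>0/4)
  |v|^\<beta> M(v), which the gain does not exceed for large v.\<close>

lemma Q_bilin_maxwellian_nonpos:
  fixes a a1 c1 \<rho>0 C1 :: real
  assumes a: "0 < a" "a < a1" and \<rho>0: "0 < \<rho>0"
  obtains R where "1 \<le> R"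
    "\<And>f v c. f \<in> borel_measurable borel \<Longrightarrow> AE w in lborel. 0 \<le> f w \<Longrightarrow> \<rho>0 \<le> (\<integral>w. f w \<partial>lborel)
      \<Longrightarrow> (\<integral>\<^sup>+w. ennreal (f w / maxwellian a1 c1 w) \<partial>lborel) \<le> ennreal C1
      \<Longrightarrow> R \<le> norm v \<Longrightarrow> Q_bilin B \<beta> f (maxwellian a c) v \<le> 0"
proof -
  \<comment> \<open>\<open>C1\<close> is not assumed nonnegative; passing to its positive part does
    not change \<open>ennreal C1\<close>.\<close>
  define K where "K = max 0 C1"
  have K: "0 \<le> K" "ennreal C1 = ennreal K" by (simp_all add: K_def max_def ennreal_neg)
  define e where "e = \<rho>0 / (2 * (K + 1))"
  have e: "0 < e" using \<rho>0 K by (simp add: e_def)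
  have eK: "e * K \<le> \<rho>0 / 2"
  proof -
    have "e * K \<le> e * (K + 1)" using e by simp
    also have "\<dots> = \<rho>0 / 2" using K by (simp add: e_def divide_simps)
    finally show ?thesis .
  qed
  have "0 < a1" using a by simp
  then obtain A0 where A0: "1 \<le> A0" "\<And>s. 0 \<le> s \<Longrightarrow> (2 + s) * exp (- a1 * s\<^sup>2) \<le> A0"
    using gaussian_bound by blast
  obtain r where r: "0 < r" "\<And>s. r \<le> s \<Longrightarrow> (2 + s) * exp (- a1 * s\<^sup>2) \<le> e / exp c1"
    using gaussian_decay[OF \<open>0 < a1\<close>, of "e / exp c1"] e by auto
  obtain R where R: "1 \<le> R" "\<And>(f :: real^'n \<Rightarrow> real) v c. f \<in> borel_measurable borel \<Longrightarrow>
      (\<integral>\<^sup>+w. ennreal (\<bar>f w\<bar> / maxwellian a1 c1 w) \<partial>lborel) \<le> ennreal K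
      \<Longrightarrow> R \<le> norm v \<Longrightarrow> Q_plus B f (maxwellian a c) v \<le> \<rho>0 / 4 * norm v powr \<beta> * maxwellian a c v"
    using gain_small[OF a, of "\<rho>0 / 4" K] \<rho>0 K by auto
  show ?thesis
  proof (rule that[of "max R (2 * r)"])
    fix f :: "real^'n \<Rightarrow> real" and v :: "real^'n" and c :: real
    assume f[measurable]: "f \<in> borel_measurable borel" and nonneg: "AE w in lborel. 0 \<le> f w"
      and mass: "\<rho>0 \<le> (\<integral>w. f w \<partial>lborel)"
      and fK: "(\<integral>\<^sup>+w. ennreal (f w / maxwellian a1 c1 w) \<partial>lborel) \<le> ennreal C1"
      and v: "max R (2 * r) \<le> norm v"
    have fK': "(\<integral>\<^sup>+w. ennreal (\<bar>f w\<bar> / maxwellian a1 c1 w) \<partial>lborel) \<le> ennreal K"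
    proof -
      have "(\<integral>\<^sup>+w. ennreal (\<bar>f w\<bar> / maxwellian a1 c1 w) \<partial>lborel)
          = (\<integral>\<^sup>+w. ennreal (f w / maxwellian a1 c1 w) \<partial>lborel)"
        using nonneg by (intro nn_integral_cong_AE) (auto elim: eventually_mono)
      then show ?thesis using fK K by simp
    qed
    \<comment> \<open>A positive lower bound on the Bochner integral forces integrability, since a
      divergent integral would be 0.\<close>
    have int_f: "integrable lborel f"
    proof (rule ccontr)
      assume "\<not> integrable lborel f"
      then have "(\<integral>w. f w \<partial>lborel) = 0" by (rule not_integrable_integral_eq)
      with mass \<rho>0 show False by simp
    qed
    define g where "g w = f w / maxwellian a1 c1 w" for w
    have [measurable]: "g \<in> borel_measurable borel" unfolding g_def[abs_def] by measurable
    have g_nonneg: "AE w in lborel. 0 \<le> g w"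
      using nonneg by eventually_elim (simp add: g_def)
    have "(\<integral>\<^sup>+w. ennreal (norm (g w)) \<partial>lborel) \<le> ennreal K"
      using fK' by (simp add: g_def)
    then have "(\<integral>\<^sup>+w. ennreal (norm (g w)) \<partial>lborel) < \<infinity>"
      by (rule le_less_trans) simp
    then have int_g: "integrable lborel g"
      by (intro integrableI_bounded) measurable
    have gK: "(\<integral>w. g w \<partial>lborel) \<le> K"
    proof -
      have "ennreal (\<integral>w. g w \<partial>lborel) = (\<integral>\<^sup>+w. ennreal (g w) \<partial>lborel)"
        by (rule nn_integral_eq_integral[OF int_g g_nonneg, symmetric])
      also have "\<dots> \<le> ennreal K" using fK K by (simp add: g_def)
      finally show ?thesis using K by simp
    qed
    have fg: "f w = exp c1 * exp (- a1 * (norm w)\<^sup>2) * g w" for w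
      by (simp add: g_def maxwellian_def add.commute flip: exp_add)
    define n where "n = norm v"
    have n: "1 \<le> n" "r \<le> n / 2" using v R(1) by (auto simp: n_def)
    \<comment> \<open>From \<beta> \<le> 1 one gets 2^(-\<beta>) \<ge> 1/2; together with the mass
      \<rho>0/2 that remains this yields the constant \<rho>0/4.\<close>
    have nb: "(n / 2) powr \<beta> \<ge> n powr \<beta> / 2"
    proof -
      have "(1/2::real) powr 1 \<le> (1/2) powr \<beta>" using beta_le_1 by (intro powr_mono') auto
      then have "n powr \<beta> * (1/2) \<le> n powr \<beta> * (1/2) powr \<beta>" by (intro mult_left_mono) auto
      then show ?thesis using n by (simp add: powr_mult[symmetric])
    qed
    have int_loss: "integrable lborel (\<lambda>w. f w * norm (v - w) powr \<beta>)"
    proof (rule Bochner_Integration.integrable_bound)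
      show "integrable lborel (\<lambda>w. n * (A0 * exp c1) * g w)" using int_g by simp
      show "AE w in lborel. norm (f w * norm (v - w) powr \<beta>) \<le> norm (n * (A0 * exp c1) * g w)"
        using g_nonneg
      proof eventually_elim
        case (elim w)
        have "norm (v - w) powr \<beta> \<le> (n + norm w) powr \<beta>"
          unfolding n_def using beta_pos norm_triangle_ineq4 by (intro powr_mono2) auto
        also have "\<dots> \<le> (n * (1 + norm w)) powr \<beta>"
          using n beta_pos by (intro powr_mono2) (auto simp: algebra_simps mult_le_cancel_right1)
        also have "\<dots> \<le> (n * (1 + norm w)) powr 1"
        proof (rule powr_mono[OF beta_le_1])
          have "1 * 1 \<le> n * (1 + norm w)" using n by (intro mult_mono) auto
          then show "1 \<le> n * (1 + norm w)" by simp
        qed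
        also have "\<dots> \<le> n * (2 + norm w)" using n by (auto intro!: mult_left_mono)
        finally have p: "norm (v - w) powr \<beta> \<le> n * (2 + norm w)" .
        have "\<bar>f w\<bar> * norm (v - w) powr \<beta> \<le> \<bar>f w\<bar> * (n * (2 + norm w))" by (intro mult_left_mono p) auto
        also have "\<dots> = n * ((2 + norm w) * exp (- a1 * (norm w)\<^sup>2) * exp c1) * g w"
          using elim by (simp add: fg[of w] abs_mult)
        also have "\<dots> \<le> n * (A0 * exp c1) * g w"
          using n elim by (intro mult_right_mono mult_left_mono A0(2)) auto
        finally show ?case using n A0 elim by (simp add: abs_mult)
      qed
    qed measurable
    have "n powr \<beta> / 2 * (\<rho>0 / 2) \<le> n powr \<beta> / 2 * ((\<integral>w. f w \<partial>lborel) - e * (\<integral>w. g w \<partial>lborel))"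
    proof (intro mult_left_mono)
      have "e * (\<integral>w. g w \<partial>lborel) \<le> e * K" using gK e by simp
      then show "\<rho>0 / 2 \<le> (\<integral>w. f w \<partial>lborel) - e * (\<integral>w. g w \<partial>lborel)" using eK mass by linarith
    qed simp
    also have "\<dots> = (\<integral>w. n powr \<beta> / 2 * (f w - e * g w) \<partial>lborel)"
      using int_f int_g by simp
    also have "\<dots> \<le> (\<integral>w. f w * norm (v - w) powr \<beta> \<partial>lborel)"
    proof (rule integral_mono_AE)
      show "integrable lborel (\<lambda>w. n powr \<beta> / 2 * (f w - e * g w))" using int_f int_g by simp
      show "AE w in lborel. n powr \<beta> / 2 * (f w - e * g w) \<le> f w * norm (v - w) powr \<beta>"
        using g_nonneg nonneg
      proof eventually_elim
        case (elim w)
        show ?case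
        proof (cases "norm w \<le> n / 2")
          case True
          have "norm v - norm w \<le> norm (v - w)" by (rule norm_triangle_ineq2)
          then have "n / 2 \<le> norm (v - w)" using True by (simp add: n_def)
          then have "(n / 2) powr \<beta> \<le> norm (v - w) powr \<beta>" using n beta_pos by (intro powr_mono2) auto
          with nb have "n powr \<beta> / 2 \<le> norm (v - w) powr \<beta>" by linarith
          then have "f w * (n powr \<beta> / 2) \<le> f w * norm (v - w) powr \<beta>" using elim
            by (intro mult_left_mono) auto
          moreover have "n powr \<beta> / 2 * (f w - e * g w) \<le> n powr \<beta> / 2 * f w"
            using elim e by (intro mult_left_mono) auto
          ultimately show ?thesis by (simp add: mult.commute)
        next
          case False
          then have "r \<le> norm w" using n by linarith
          then have "(2 + norm w) * exp (- a1 * (norm w)\<^sup>2) \<le> e / exp c1" by (rule r(2))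
          moreover have "1 * exp (- a1 * (norm w)\<^sup>2) \<le> (2 + norm w) * exp (- a1 * (norm w)\<^sup>2)"
            by (intro mult_right_mono) auto
          ultimately have "exp (- a1 * (norm w)\<^sup>2) \<le> e / exp c1" by linarith
          then have "exp c1 * exp (- a1 * (norm w)\<^sup>2) \<le> e" by (simp add: field_simps)
          then have "f w \<le> e * g w" unfolding fg[of w] using elim by (intro mult_right_mono) auto
          then have "n powr \<beta> / 2 * (f w - e * g w) \<le> 0" by (intro mult_nonneg_nonpos) auto
          also have "0 \<le> f w * norm (v - w) powr \<beta>" using elim by simp
          finally show ?thesis .
        qed
      qed
    qed (rule int_loss)
    finally have "\<rho>0 / 4 * n powr \<beta> * maxwellian a c v \<le> Q_minus \<beta> f (maxwellian a c) v"
      unfolding Q_minus_def by (intro mult_right_mono) (auto simp: mult_ac)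
    moreover have "Q_plus B f (maxwellian a c) v \<le> \<rho>0 / 4 * n powr \<beta> * maxwellian a c v"
      unfolding n_def using v by (intro R(2) fK') auto
    ultimately show "Q_bilin B \<beta> f (maxwellian a c) v \<le> 0" by (simp add: Q_bilin_def)
  qed (use R(1) in simp)
qed

end

section \<open>Integration over phase space\<close>

lemma torus_cube_measurable [measurable]: "{x :: real^'n. \<forall>i. 0 \<le> x $ i \<and> x $ i < 1} \<in> sets borel"
proof -
  have [measurable]: "(\<lambda>x :: real^'n. x $ i) \<in> borel_measurable borel" for i
    by (intro borel_measurable_continuous_onI continuous_intros)
  show ?thesis by measurable
qed

lemma sets_torus [measurable_cong]:
  "sets (torus :: (real^'n) measure) = sets (restrict_space borel {x. \<forall>i. 0 \<le> x $ i \<and> x $ i < 1})"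
  unfolding torus_def by (rule sets_restrict_space_cong) simp

lemma space_torus: "space (torus :: (real^'n) measure) = {x. \<forall>i. 0 \<le> x $ i \<and> x $ i < 1}"
  by (simp add: torus_def space_restrict_space)

lemma measurable_ident_torus: "(\<lambda>x. x) \<in> torus \<rightarrow>\<^sub>M borel"
  by (simp add: measurable_cong_sets[OF sets_torus refl] measurable_restrict_space1)

lemma finite_measure_torus: "finite_measure (torus :: (real^'n) measure)"
proof
  let ?C = "{x :: real^'n. \<forall>i. 0 \<le> x $ i \<and> x $ i < 1}"
  have "emeasure (torus :: (real^'n) measure) (space torus) = emeasure lborel ?C"
    unfolding torus_def by (subst emeasure_restrict_space) (auto simp: space_restrict_space)
  also have "\<dots> \<le> emeasure lborel (cbox 0 (1 :: real^'n))"
    by (rule emeasure_mono) (auto simp: mem_box_cart less_imp_le)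
  also have "\<dots> < \<infinity>" by (rule emeasure_lborel_cbox_finite)
  finally show "emeasure (torus :: (real^'n) measure) (space torus) \<noteq> \<infinity>" by simp
qed

interpretation torus: finite_measure torus
  by (rule finite_measure_torus)

lemma space_time: "space (time T) = {0..T}"
  by (simp add: time_def space_restrict_space)

lemma sets_time [measurable_cong]: "sets (time T) = sets (restrict_space borel {0..T})"
  unfolding time_def by (rule sets_restrict_space_cong) simp

lemma measurable_ident_time: "(\<lambda>x. x) \<in> time T \<rightarrow>\<^sub>M borel"
  by (simp add: measurable_cong_sets[OF sets_time refl] measurable_restrict_space1)

lemma emeasure_time: "emeasure (time T) (space (time T)) = ennreal T"
  unfolding time_def
  by (subst emeasure_restrict_space) (auto simp: space_restrict_space emeasure_lborel_Icc_eq
    ennreal_neg)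

lemma finite_measure_time: "finite_measure (time T)"
  by (intro finite_measureI) (simp add: emeasure_time)

interpretation time: finite_measure "time T" for T
  by (rule finite_measure_time)

interpretation lborel_sphere_measure: pair_sigma_finite lborel sphere_measure ..
interpretation lborel_time: pair_sigma_finite lborel "time T" for T ..
interpretation torus_time: pair_sigma_finite torus "time T" for T ..
interpretation torus_lborel: pair_sigma_finite torus lborel ..

lemma sigma_finite_phase: "sigma_finite_measure phase"
  unfolding phase_def by (intro sigma_finite_pair_measure torus.sigma_finite_measure_axioms
    lborel.sigma_finite_measure_axioms)

interpretation phase: sigma_finite_measure phase
  by (rule sigma_finite_phase)

interpretation phase_time_pair: pair_sigma_finite phase "time T" for T ..

interpretation TT_lborel: pair_sigma_finite "torus \<Otimes>\<^sub>M time T" lborel for T ..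

lemma sigma_finite_lborel_time: "sigma_finite_measure (lborel \<Otimes>\<^sub>M time T)"
  by (intro sigma_finite_pair_measure lborel.sigma_finite_measure_axioms
    time.sigma_finite_measure_axioms)

lemma phase_time_permute:
  assumes "F \<in> phase_time T \<rightarrow>\<^sub>M M"
  shows "(\<lambda>((x, t), v). F (x, v, t)) \<in> (torus \<Otimes>\<^sub>M time T) \<Otimes>\<^sub>M lborel \<rightarrow>\<^sub>M M"
    and "(\<lambda>((x, v), t). F (x, v, t)) \<in> phase \<Otimes>\<^sub>M time T \<rightarrow>\<^sub>M M"
proof -
  have "(\<lambda>z. (fst (fst z), snd z, snd (fst z))) \<in> (torus \<Otimes>\<^sub>M time T) \<Otimes>\<^sub>M lborel \<rightarrow>\<^sub>M phase_time T"
    unfolding phase_time_def by measurable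
  from measurable_compose[OF this assms]
  show "(\<lambda>((x, t), v). F (x, v, t)) \<in> (torus \<Otimes>\<^sub>M time T) \<Otimes>\<^sub>M lborel \<rightarrow>\<^sub>M M"
    by (simp add: case_prod_unfold)
  have "(\<lambda>z. (fst (fst z), snd (fst z), snd z)) \<in> phase \<Otimes>\<^sub>M time T \<rightarrow>\<^sub>M phase_time T"
    unfolding phase_time_def phase_def by measurable
  from measurable_compose[OF this assms]
  show "(\<lambda>((x, v), t). F (x, v, t)) \<in> phase \<Otimes>\<^sub>M time T \<rightarrow>\<^sub>M M"
    by (simp add: case_prod_unfold)
qed

lemma nn_integral_phase_time_x:
  fixes F :: "(real^'n) \<times> (real^'n) \<times> real \<Rightarrow> ennreal"
  assumes F: "F \<in> borel_measurable (phase_time T)"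
  shows "(\<integral>\<^sup>+y. F y \<partial>phase_time T) = (\<integral>\<^sup>+x. \<integral>\<^sup>+v. \<integral>\<^sup>+t. F (x, v, t) \<partial>time T \<partial>lborel \<partial>torus)"
proof -
  note [measurable] = F[unfolded phase_time_def]
  have "(\<integral>\<^sup>+y. F y \<partial>phase_time T) = (\<integral>\<^sup>+x. \<integral>\<^sup>+z. F (x, z) \<partial>(lborel \<Otimes>\<^sub>M time T) \<partial>torus)"
    unfolding phase_time_def by (rule sigma_finite_measure.nn_integral_fst[OF
      sigma_finite_lborel_time, symmetric]) measurable
  also have "\<dots> = (\<integral>\<^sup>+x. \<integral>\<^sup>+v. \<integral>\<^sup>+t. F (x, v, t) \<partial>time T \<partial>lborel \<partial>torus)"
    by (intro nn_integral_cong time.nn_integral_fst[symmetric, where f = "\<lambda>z. F (_, z)"])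
      (auto intro!: measurable_compose[OF measurable_Pair1' F[unfolded phase_time_def]])
  finally show ?thesis .
qed

lemma phase_time_section:
  fixes F :: "(real^'n) \<times> (real^'n) \<times> real \<Rightarrow> 'b"
  assumes F: "F \<in> phase_time T \<rightarrow>\<^sub>M M" and "x \<in> space torus"
  shows "(\<lambda>(v, t). F (x, v, t)) \<in> lborel \<Otimes>\<^sub>M time T \<rightarrow>\<^sub>M M"
  using measurable_compose[OF measurable_Pair1'[OF assms(2)] F[unfolded phase_time_def]]
  by (simp add: case_prod_unfold)

lemma phase_time_slice:
  fixes F :: "(real^'n) \<times> (real^'n) \<times> real \<Rightarrow> 'b"
  assumes F: "F \<in> phase_time T \<rightarrow>\<^sub>M M" and "x \<in> space torus" "t \<in> {0..T}"
  shows "(\<lambda>v. F (x, v, t)) \<in> borel \<rightarrow>\<^sub>M M"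
proof -
  have "(x, t) \<in> space (torus \<Otimes>\<^sub>M time T)" using assms by (simp add: space_pair_measure space_time)
  from measurable_compose[OF measurable_Pair1'[OF this] phase_time_permute(1)[OF F]]
  show ?thesis by simp
qed

text \<open>\<open>phase_time\<close> nests x, v, t in this order. The dissipativity inequality
  integrates v inside (x, t), and continuity in L^1 is about (x, v) inside t; Fubini supplies both
  orders.\<close>

lemma nn_integral_phase_time:
  fixes F :: "(real^'n) \<times> (real^'n) \<times> real \<Rightarrow> ennreal"
  assumes F: "F \<in> borel_measurable (phase_time T)"
  shows "(\<integral>\<^sup>+y. F y \<partial>phase_time T) = (\<integral>\<^sup>+(x, t). \<integral>\<^sup>+v. F (x, v, t) \<partial>lborel \<partial>(torus \<Otimes>\<^sub>M time T))"
    and "(\<integral>\<^sup>+y. F y \<partial>phase_time T) = (\<integral>\<^sup>+t. \<integral>\<^sup>+(x, v). F (x, v, t) \<partial>phase \<partial>time T)"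
proof -
  note P = phase_time_permute[OF F]
  have 0: "(\<integral>\<^sup>+y. F y \<partial>phase_time T) = (\<integral>\<^sup>+x. \<integral>\<^sup>+v. \<integral>\<^sup>+t. F (x, v, t) \<partial>time T \<partial>lborel \<partial>torus)"
    by (rule nn_integral_phase_time_x[OF F])
  also have "\<dots> = (\<integral>\<^sup>+x. \<integral>\<^sup>+t. \<integral>\<^sup>+v. F (x, v, t) \<partial>lborel \<partial>time T \<partial>torus)"
    using phase_time_section[OF F] by (intro nn_integral_cong lborel_time.Fubini'[symmetric])
  also have "\<dots> = (\<integral>\<^sup>+x. \<integral>\<^sup>+t. (case (x, t) of (x, t) \<Rightarrow> \<integral>\<^sup>+v. F (x, v, t) \<partial>lborel) \<partial>time T \<partial>torus)"
    by simp
  also have "\<dots> = (\<integral>\<^sup>+(x, t). \<integral>\<^sup>+v. F (x, v, t) \<partial>lborel \<partial>(torus \<Otimes>\<^sub>M time T))"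
    using lborel.borel_measurable_nn_integral_fst[OF P(1)]
    by (intro time.nn_integral_fst) (simp add: case_prod_unfold)
  finally show "(\<integral>\<^sup>+y. F y \<partial>phase_time T)
      = (\<integral>\<^sup>+(x, t). \<integral>\<^sup>+v. F (x, v, t) \<partial>lborel \<partial>(torus \<Otimes>\<^sub>M time T))" .
  have "(\<integral>\<^sup>+y. F y \<partial>phase_time T) = (\<integral>\<^sup>+x. \<integral>\<^sup>+v. (case (x, v) of (x, v) \<Rightarrow> \<integral>\<^sup>+t. F (x, v, t) \<partial>time T)
      \<partial>lborel \<partial>torus)"
    by (simp add: 0)
  also have "\<dots> = (\<integral>\<^sup>+(x, v). \<integral>\<^sup>+t. F (x, v, t) \<partial>time T \<partial>phase)"
    unfolding phase_def
    using time.borel_measurable_nn_integral_fst[OF P(2)]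
    by (intro lborel.nn_integral_fst) (simp add: case_prod_unfold phase_def)
  also have "\<dots> = (\<integral>\<^sup>+z. \<integral>\<^sup>+t. (case z of (x, v) \<Rightarrow> F (x, v, t)) \<partial>time T \<partial>phase)"
    by (simp add: case_prod_unfold)
  also have "\<dots> = (\<integral>\<^sup>+t. \<integral>\<^sup>+z. (case z of (x, v) \<Rightarrow> F (x, v, t)) \<partial>phase \<partial>time T)"
    using P(2) by (intro phase_time_pair.Fubini'[symmetric]) (simp add: case_prod_unfold)
  finally show "(\<integral>\<^sup>+y. F y \<partial>phase_time T) = (\<integral>\<^sup>+t. \<integral>\<^sup>+(x, v). F (x, v, t) \<partial>phase \<partial>time T)" .
qed

lemma nn_integral_phase_const:
  fixes g :: "real^'n \<Rightarrow> ennreal"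
  assumes [measurable]: "g \<in> borel_measurable borel"
  shows "(\<integral>\<^sup>+(x, v). g v \<partial>(phase :: ((real^'n) \<times> (real^'n)) measure)) = (\<integral>\<^sup>+v. g v \<partial>lborel)
      * emeasure (torus :: (real^'n) measure) (space torus)"
proof -
  have "(\<integral>\<^sup>+(x, v). g v \<partial>(phase :: ((real^'n) \<times> (real^'n)) measure))
      = (\<integral>\<^sup>+x. \<integral>\<^sup>+v. (case (x, v) of (x, v) \<Rightarrow> g v) \<partial>lborel \<partial>(torus :: (real^'n) measure))"
    unfolding phase_def by (rule lborel.nn_integral_fst[symmetric]) measurable
  then show ?thesis by simp
qed

section \<open>Gaussian moments\<close>

lemma gaussian_power_bound:
  fixes a :: real
  assumes "0 < a"
  obtains A where "0 < A" "\<And>s. 0 \<le> s \<Longrightarrow> (2 + s) ^ k * exp (- a * s\<^sup>2) \<le> A"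
proof -
  \<comment> \<open>The exponent a is shared equally among k + 1 factors, each bounded by the case
    of a linear weight.\<close>
  obtain A where A: "1 \<le> A" "\<And>s. 0 \<le> s \<Longrightarrow> (2 + s) * exp (- (a / (k + 1)) * s\<^sup>2) \<le> A"
    using gaussian_bound[of "a / (k + 1)"] assms by auto
  show ?thesis
  proof (rule that[of "A ^ (k + 1)"])
    fix s :: real assume s: "0 \<le> s"
    have "(2 + s) ^ k * exp (- a * s\<^sup>2) \<le> (2 + s) ^ (k + 1) * exp (- a * s\<^sup>2)"
      using s by (intro mult_right_mono power_increasing) auto
    also have "\<dots> = ((2 + s) * exp (- (a / (k + 1)) * s\<^sup>2)) ^ (k + 1)"
    proof -
      have "exp (- a * s\<^sup>2) = exp (- (a / (k + 1)) * s\<^sup>2) ^ (k + 1)"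
        by (simp only: exp_of_nat_mult[symmetric]) (simp add: field_simps)
      then show ?thesis by (simp only: power_mult_distrib)
    qed
    also have "\<dots> \<le> A ^ (k + 1)" using s by (intro power_mono A(2)) auto
    finally show "(2 + s) ^ k * exp (- a * s\<^sup>2) \<le> A ^ (k + 1)" .
  qed (use A(1) in simp)
qed

text \<open>The Gaussian absorbs d + 3 powers of 2 + |v|: two for the weight and d + 1 for a
  convergent tail. In polar coordinates the latter is controlled by the integral of (2 +
  r)^(-2).\<close>

lemma maxwellian_moment_finite:
  fixes a c :: real
  assumes "0 < a"
  shows "(\<integral>\<^sup>+v. ennreal (maxwellian a c v * (2 + norm v)\<^sup>2) \<partial>(lborel :: (real^'n) measure)) < \<infinity>"
proof -
  define d where "d = DIM(real^'n)"
  have d: "0 < d" by (simp add: d_def)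
  obtain A where A: "0 < A" "\<And>s. 0 \<le> s \<Longrightarrow> (2 + s) ^ (d + 3) * exp (- a * s\<^sup>2) \<le> A"
    using gaussian_power_bound[OF assms] by blast
  have le: "maxwellian a c v * (2 + norm v)\<^sup>2 \<le> A * exp c * inverse ((2 + norm v) ^ (d + 1))" for v ::
    "real^'n"
  proof -
    have "(2 + norm v) ^ (d + 3) = (2 + norm v) ^ (d + 1) * (2 + norm v)\<^sup>2"
    proof -
      have "d + 1 + 2 = d + 3" by simp
      with power_add[of "2 + norm v" "d + 1" 2] show ?thesis by metis
    qed
    then have "(2 + norm v) ^ (d + 1) * ((2 + norm v)\<^sup>2 * exp (- a * (norm v)\<^sup>2)) \<le> A"
      using A(2)[of "norm v"] by (simp add: mult.assoc)
    moreover have "0 < (2 + norm v) ^ (d + 1)" by (intro zero_less_power add_pos_nonneg) auto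
    ultimately have "(2 + norm v)\<^sup>2 * exp (- a * (norm v)\<^sup>2) \<le> A * inverse ((2 + norm v) ^ (d + 1))"
      by (simp add: field_simps)
    then have "exp c * ((2 + norm v)\<^sup>2 * exp (- a * (norm v)\<^sup>2)) \<le> exp c
        * (A * inverse ((2 + norm v) ^ (d + 1)))"
      by (rule mult_left_mono) simp
    moreover have "maxwellian a c v = exp c * exp (- a * (norm v)\<^sup>2)"
      unfolding maxwellian_def exp_add by (rule mult.commute)
    ultimately show ?thesis by (simp add: mult_ac)
  qed
  let ?S = "emeasure sphere_borel (UNIV :: (real^'n) set)"
  have "(\<integral>\<^sup>+v. ennreal (inverse ((2 + norm v) ^ (d + 1))) \<partial>(lborel :: (real^'n) measure))
    = (\<integral>\<^sup>+r. indicator {0<..} r * ennreal (r ^ (d - 1))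
        * (\<integral>\<^sup>+\<sigma>. ennreal (inverse ((2 + norm (r *\<^sub>R \<sigma>)) ^ (d + 1)))
        \<partial>(sphere_borel :: (real^'n) measure)) \<partial>lborel)"
    unfolding d_def by (rule nn_integral_polar) measurable
  also have "\<dots> \<le> (\<integral>\<^sup>+r. ennreal (real 1 * inverse ((2 + r) ^ (1 + 1))) * indicator {2..} (2 + r) * ?S
      \<partial>lborel)"
  proof (rule nn_integral_mono)
    fix r :: real
    show "indicator {0<..} r * ennreal (r ^ (d - 1))
        * (\<integral>\<^sup>+\<sigma>. ennreal (inverse ((2 + norm (r *\<^sub>R \<sigma>)) ^ (d + 1)))
        \<partial>(sphere_borel :: (real^'n) measure))
      \<le> ennreal (real 1 * inverse ((2 + r) ^ (1 + 1))) * indicator {2..} (2 + r) * ?S"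
    proof (cases "0 < r")
      case True
      have "(\<integral>\<^sup>+\<sigma>. ennreal (inverse ((2 + norm (r *\<^sub>R \<sigma>)) ^ (d + 1)))
          \<partial>(sphere_borel :: (real^'n) measure))
        = (\<integral>\<^sup>+\<sigma>. ennreal (inverse ((2 + r) ^ (d + 1))) \<partial>(sphere_borel :: (real^'n) measure))"
        using AE_sphere_borel_norm by (intro nn_integral_cong_AE, eventually_elim) (use True in simp)
      also have "\<dots> = ennreal (inverse ((2 + r) ^ (d + 1))) * ?S" by simp
      finally have I: "(\<integral>\<^sup>+\<sigma>. ennreal (inverse ((2 + norm (r *\<^sub>R \<sigma>)) ^ (d + 1)))
          \<partial>(sphere_borel :: (real^'n) measure)) = ennreal (inverse ((2 + r) ^ (d + 1))) * ?S" .
      obtain e where e: "d = Suc e" using d by (cases d) auto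
      have "r ^ e * inverse ((2 + r) ^ (d + 1)) \<le> (2 + r) ^ e * inverse ((2 + r) ^ (d + 1))"
        using True by (intro mult_right_mono power_mono) auto
      also have "\<dots> = inverse ((2 + r) ^ (1 + 1))"
        using True by (simp add: e inverse_mult_distrib less_imp_neq[OF add_pos_pos, symmetric])
      finally have "ennreal (r ^ (d - 1)) * ennreal (inverse ((2 + r) ^ (d + 1)))
          \<le> ennreal (real 1 * inverse ((2 + r) ^ (1 + 1)))"
        using True by (simp add: e ennreal_mult[symmetric] ennreal_leI del: power_Suc)
      then show ?thesis unfolding I using True
        by (auto simp: mult.assoc[symmetric] intro!: mult_right_mono)
    qed simp
  qed
  also have "\<dots> = (\<integral>\<^sup>+r. ennreal (real 1 * inverse (r ^ (1 + 1))) * indicator {2..} r * ?S \<partial>lborel)"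
    by (rule nn_integral_lborel_translate) measurable
  also have "\<dots> = ennreal (inverse (2 ^ 1)) * ?S"
    by (subst nn_integral_multc) (simp_all only: nn_integral_powr_tail[of 2 1], simp_all)
  also have "\<dots> < \<infinity>"
    unfolding infinity_ennreal_def ennreal_mult_less_top
    using sphere_borel.emeasure_finite[of "UNIV :: (real^'n) set"] ennreal_less_top less_top by blast
  finally have fin: "(\<integral>\<^sup>+v. ennreal (inverse ((2 + norm v) ^ (d + 1)))
      \<partial>(lborel :: (real^'n) measure)) < \<infinity>" .
  have "(\<integral>\<^sup>+v. ennreal (maxwellian a c v * (2 + norm v)\<^sup>2) \<partial>(lborel :: (real^'n) measure))
    \<le> (\<integral>\<^sup>+v. ennreal (A * exp c) * ennreal (inverse ((2 + norm v) ^ (d + 1)))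
        \<partial>(lborel :: (real^'n) measure))"
  proof (rule nn_integral_mono)
    fix v :: "real^'n"
    have "ennreal (maxwellian a c v * (2 + norm v)\<^sup>2)
        \<le> ennreal (A * exp c * inverse ((2 + norm v) ^ (d + 1)))"
      by (rule ennreal_leI[OF le])
    also have "\<dots> = ennreal (A * exp c) * ennreal (inverse ((2 + norm v) ^ (d + 1)))"
      using A(1) by (intro ennreal_mult) auto
    finally show "ennreal (maxwellian a c v * (2 + norm v)\<^sup>2) \<le> ennreal (A * exp c)
        * ennreal (inverse ((2 + norm v) ^ (d + 1)))" .
  qed
  also have "\<dots> = ennreal (A * exp c) * (\<integral>\<^sup>+v. ennreal (inverse ((2 + norm v) ^ (d + 1)))
      \<partial>(lborel :: (real^'n) measure))"
    by (rule nn_integral_cmult) measurable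
  also have "\<dots> < \<infinity>" using fin by (simp add: ennreal_mult_less_top)
  finally show ?thesis .
qed

definition moment :: "(real^'n \<Rightarrow> real) \<Rightarrow> ennreal" where
  "moment f = (\<integral>\<^sup>+w. ennreal (\<bar>f w\<bar> * (1 + (norm w)\<^sup>2)) \<partial>lborel)"

text \<open>The v-part of the separated bound |v - w|^\<beta> \<le> 2 (2 + |v|)^2 (1 + |w|^2),
  integrated against M; the w-part, integrated against |f|, is \<open>moment\<close>.\<close>

definition maxwellian_mass :: "real \<Rightarrow> real \<Rightarrow> 'n::finite itself \<Rightarrow> ennreal" where
  "maxwellian_mass a c _ = 2 * (\<integral>\<^sup>+v. ennreal (maxwellian a c v * (2 + norm v)\<^sup>2)
      \<partial>(lborel :: (real^'n) measure))"

lemma nn_integral_abs_finite: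
  fixes f :: "'z \<Rightarrow> real"
  assumes "f \<in> borel_measurable M" "(\<integral>\<^sup>+x. ennreal \<bar>f x\<bar> \<partial>M) \<noteq> \<infinity>"
  shows "integrable M f"
  using assms by (intro integrableI_bounded) (auto simp: less_top)

section \<open>Velocity-integrated bounds and conservation of mass\<close>

context hard_potential
begin

lemma nn_integral_gain_measurable:
  fixes F :: "'z \<Rightarrow> real^'n \<Rightarrow> real" and g :: "real^'n \<Rightarrow> real"
  assumes "case_prod F \<in> borel_measurable (N \<Otimes>\<^sub>M borel)"
    and "g \<in> borel_measurable borel" "V \<in> borel_measurable N"
  shows "(\<lambda>y. \<integral>\<^sup>+p. ennreal \<bar>gain_integrand B (F y) g (V y) p\<bar> \<partial>(lborel \<Otimes>\<^sub>M sphere_measure))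
      \<in> borel_measurable N"
proof -
  have "(\<lambda>z. ennreal \<bar>case z of (y, p) \<Rightarrow> gain_integrand B (F y) g (V y) p\<bar>)
      \<in> borel_measurable (N \<Otimes>\<^sub>M (lborel \<Otimes>\<^sub>M sphere_measure))"
    by (rule measurable_compose[OF gain_integrand_measurable[OF assms]]) measurable
  from sigma_finite_measure.borel_measurable_nn_integral_fst[OF sigma_finite_gain this]
  show ?thesis by simp
qed

text \<open>The collisional change of variables for \<Phi>(v, w) = |f(w)| |g(v)|: gain and loss have
  the same total. Integrability of the gain, its insensitivity to null sets and conservation of mass
  all come from this identity.\<close>

lemma nn_integral_gain_total:
  fixes f g :: "real^'n \<Rightarrow> real"
  assumes [measurable]: "f \<in> borel_measurable borel" "g \<in> borel_measurable borel"
  shows "(\<integral>\<^sup>+v. \<integral>\<^sup>+p. ennreal \<bar>gain_integrand B f g v p\<bar> \<partial>(lborel \<Otimes>\<^sub>M sphere_measure) \<partial>lborel)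
    = (\<integral>\<^sup>+v. \<integral>\<^sup>+w. ennreal (\<bar>f w\<bar> * norm (v - w) powr \<beta> * \<bar>g v\<bar>) \<partial>lborel \<partial>lborel)"
proof -
  have "(\<integral>\<^sup>+v. \<integral>\<^sup>+p. ennreal \<bar>gain_integrand B f g v p\<bar> \<partial>(lborel \<Otimes>\<^sub>M sphere_measure) \<partial>lborel)
    = (\<integral>\<^sup>+v. \<integral>\<^sup>+w. \<integral>\<^sup>+\<sigma>. (\<lambda>v w. ennreal (\<bar>f w\<bar> * \<bar>g v\<bar>)) (post v w \<sigma>) (post_star v w \<sigma>)
        * ennreal (Bsym (v - w) \<sigma>) \<partial>sphere_borel \<partial>lborel \<partial>lborel)"
    by (simp add: nn_integral_gain_integrand)
  also have "\<dots> = (\<integral>\<^sup>+v. \<integral>\<^sup>+w. ennreal (\<bar>f w\<bar> * \<bar>g v\<bar>) * ennreal (norm (v - w) powr \<beta>) \<partial>lborel \<partial>lborel)"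
    by (rule nn_integral_collision) measurable
  also have "\<dots> = (\<integral>\<^sup>+v. \<integral>\<^sup>+w. ennreal (\<bar>f w\<bar> * norm (v - w) powr \<beta> * \<bar>g v\<bar>) \<partial>lborel \<partial>lborel)"
    by (simp add: ennreal_mult[symmetric] mult_ac)
  finally show ?thesis .
qed

lemma powr_norm_diff_le: "norm (v - w) powr \<beta> \<le> 2 * (2 + norm v)\<^sup>2 * (1 + (norm w)\<^sup>2)" for v w ::
  "real^'n"
proof -
  \<comment> \<open>Adding 1 makes the base at least 1, where the exponent may be raised from
    \<beta> to 1.\<close>
  have "norm (v - w) powr \<beta> \<le> (1 + norm (v - w)) powr \<beta>" using beta_pos by (intro powr_mono2) auto
  also have "\<dots> \<le> (1 + norm (v - w)) powr 1" using beta_le_1 by (intro powr_mono) auto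
  also have "\<dots> \<le> 1 + (norm v + norm w)" using norm_triangle_ineq4[of v w] by simp
  also have "\<dots> \<le> (2 + norm v) * (1 + norm w)" by (simp add: algebra_simps)
  also have "\<dots> \<le> (2 + norm v)\<^sup>2 * (2 * (1 + (norm w)\<^sup>2))"
  proof (intro mult_mono)
    have "(2 + norm v) * 1 \<le> (2 + norm v) * (2 + norm v)" by (intro mult_left_mono) auto
    then show "2 + norm v \<le> (2 + norm v)\<^sup>2" by (simp add: power2_eq_square)
    have "0 \<le> (1 - norm w)\<^sup>2" by simp
    then have "2 * norm w \<le> 1 + (norm w)\<^sup>2" unfolding power2_diff by simp
    moreover have "0 \<le> (norm w)\<^sup>2" by simp
    ultimately show "1 + norm w \<le> 2 * (1 + (norm w)\<^sup>2)" by (smt (verit))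
  qed auto
  also have "\<dots> = 2 * (2 + norm v)\<^sup>2 * (1 + (norm w)\<^sup>2)" by (simp only: mult_ac)
  finally show ?thesis .
qed

lemma nn_integral_loss_total_le:
  fixes f :: "real^'n \<Rightarrow> real"
  assumes [measurable]: "f \<in> borel_measurable borel"
  shows "(\<integral>\<^sup>+v. \<integral>\<^sup>+w. ennreal (\<bar>f w\<bar> * norm (v - w) powr \<beta> * \<bar>maxwellian a c v\<bar>) \<partial>lborel \<partial>lborel)
    \<le> maxwellian_mass a c TYPE('n) * moment f"
proof -
  have "(\<integral>\<^sup>+v. \<integral>\<^sup>+w. ennreal (\<bar>f w\<bar> * norm (v - w) powr \<beta> * \<bar>maxwellian a c v\<bar>) \<partial>lborel \<partial>lborel)
    \<le> (\<integral>\<^sup>+v. \<integral>\<^sup>+w. (2 * ennreal (maxwellian a c v * (2 + norm v)\<^sup>2))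
        * ennreal (\<bar>f w\<bar> * (1 + (norm w)\<^sup>2)) \<partial>lborel \<partial>(lborel :: (real^'n) measure))"
  proof (intro nn_integral_mono)
    fix v w :: "real^'n"
    have "\<bar>f w\<bar> * norm (v - w) powr \<beta> * \<bar>maxwellian a c v\<bar> \<le> \<bar>f w\<bar>
        * (2 * (2 + norm v)\<^sup>2 * (1 + (norm w)\<^sup>2)) * \<bar>maxwellian a c v\<bar>"
      by (intro mult_right_mono mult_left_mono powr_norm_diff_le) auto
    also have "\<dots> = 2 * (maxwellian a c v * (2 + norm v)\<^sup>2) * (\<bar>f w\<bar> * (1 + (norm w)\<^sup>2))" by simp
    finally have "ennreal (\<bar>f w\<bar> * norm (v - w) powr \<beta> * \<bar>maxwellian a c v\<bar>)
      \<le> ennreal (2 * (maxwellian a c v * (2 + norm v)\<^sup>2) * (\<bar>f w\<bar> * (1 + (norm w)\<^sup>2)))"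
        by (rule ennreal_leI)
    also have "\<dots> = (2 * ennreal (maxwellian a c v * (2 + norm v)\<^sup>2))
        * ennreal (\<bar>f w\<bar> * (1 + (norm w)\<^sup>2))"
      by (subst ennreal_mult, simp, simp, subst ennreal_mult) (simp_all del: ennreal_mult'')
    finally show "ennreal (\<bar>f w\<bar> * norm (v - w) powr \<beta> * \<bar>maxwellian a c v\<bar>)
      \<le> (2 * ennreal (maxwellian a c v * (2 + norm v)\<^sup>2)) * ennreal (\<bar>f w\<bar> * (1 + (norm w)\<^sup>2))" .
  qed
  also have "\<dots> = (\<integral>\<^sup>+v. (2 * ennreal (maxwellian a c v * (2 + norm v)\<^sup>2)) * moment f
      \<partial>(lborel :: (real^'n) measure))"
    unfolding moment_def by (intro nn_integral_cong nn_integral_cmult) measurable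
  also have "\<dots> = maxwellian_mass a c TYPE('n) * moment f"
    unfolding maxwellian_mass_def by (subst nn_integral_multc, measurable) (simp add: nn_integral_cmult)
  finally show ?thesis .
qed

lemma nn_integral_Q_plus_le:
  fixes f :: "real^'n \<Rightarrow> real"
  assumes "f \<in> borel_measurable borel"
  shows "(\<integral>\<^sup>+v. ennreal \<bar>Q_plus B f (maxwellian a c) v\<bar> \<partial>lborel) \<le> maxwellian_mass a c TYPE('n)
      * moment f"
proof -
  have "(\<integral>\<^sup>+v. ennreal \<bar>Q_plus B f (maxwellian a c) v\<bar> \<partial>lborel)
    \<le> (\<integral>\<^sup>+v. \<integral>\<^sup>+p. ennreal \<bar>gain_integrand B f (maxwellian a c) v p\<bar> \<partial>(lborel \<Otimes>\<^sub>M sphere_measure)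
        \<partial>lborel)"
    by (intro nn_integral_mono ennreal_abs_Q_plus_le)
  also have "\<dots> = (\<integral>\<^sup>+v. \<integral>\<^sup>+w. ennreal (\<bar>f w\<bar> * norm (v - w) powr \<beta> * \<bar>maxwellian a c v\<bar>) \<partial>lborel
      \<partial>lborel)"
    by (intro nn_integral_gain_total assms) measurable
  also have "\<dots> \<le> maxwellian_mass a c TYPE('n) * moment f" by (rule nn_integral_loss_total_le[OF assms])
  finally show ?thesis .
qed

lemma nn_integral_Q_minus_le:
  fixes f :: "real^'n \<Rightarrow> real"
  assumes [measurable]: "f \<in> borel_measurable borel"
  shows "(\<integral>\<^sup>+v. ennreal \<bar>Q_minus \<beta> f (maxwellian a c) v\<bar> \<partial>lborel) \<le> maxwellian_mass a c TYPE('n)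
      * moment f"
proof -
  have "ennreal \<bar>Q_minus \<beta> f (maxwellian a c) v\<bar>
      \<le> (\<integral>\<^sup>+w. ennreal (\<bar>f w\<bar> * norm (v - w) powr \<beta> * \<bar>maxwellian a c v\<bar>) \<partial>lborel)" for v
  proof (cases "integrable lborel (\<lambda>w. f w * norm (v - w) powr \<beta>)")
    case True
    have "ennreal \<bar>Q_minus \<beta> f (maxwellian a c) v\<bar>
        = ennreal (norm (\<integral>w. f w * norm (v - w) powr \<beta> \<partial>lborel)) * ennreal (maxwellian a c v)"
      by (simp add: Q_minus_def abs_mult ennreal_mult)
    also have "\<dots> \<le> (\<integral>\<^sup>+w. ennreal (norm (f w * norm (v - w) powr \<beta>)) \<partial>lborel)
        * ennreal (maxwellian a c v)"
      by (intro mult_right_mono integral_norm_bound_ennreal True) simp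
    also have "\<dots> = (\<integral>\<^sup>+w. ennreal (\<bar>f w\<bar> * norm (v - w) powr \<beta> * \<bar>maxwellian a c v\<bar>) \<partial>lborel)"
      by (subst nn_integral_multc[symmetric]) (auto simp: abs_mult ennreal_mult)
    finally show ?thesis .
  qed (simp add: Q_minus_def not_integrable_integral_eq)
  then have "(\<integral>\<^sup>+v. ennreal \<bar>Q_minus \<beta> f (maxwellian a c) v\<bar> \<partial>lborel)
    \<le> (\<integral>\<^sup>+v. \<integral>\<^sup>+w. ennreal (\<bar>f w\<bar> * norm (v - w) powr \<beta> * \<bar>maxwellian a c v\<bar>) \<partial>lborel \<partial>lborel)"
    by (intro nn_integral_mono)
  also have "\<dots> \<le> maxwellian_mass a c TYPE('n) * moment f" by (rule nn_integral_loss_total_le) measurable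
  finally show ?thesis .
qed

lemma maxwellian_mass_finite: "0 < a \<Longrightarrow> maxwellian_mass a c TYPE('n) < \<infinity>"
  using maxwellian_moment_finite[of a c, where 'n = 'n]
    by (simp add: maxwellian_mass_def ennreal_mult_less_top)

lemma Q_minus_measurable:
  fixes F :: "'z \<Rightarrow> real^'n \<Rightarrow> real" and g :: "real^'n \<Rightarrow> real"
  assumes [measurable]: "case_prod F \<in> borel_measurable (N \<Otimes>\<^sub>M borel)"
    "g \<in> borel_measurable borel" "V \<in> borel_measurable N"
  shows "(\<lambda>y. Q_minus \<beta> (F y) g (V y)) \<in> borel_measurable N"
  unfolding Q_minus_def by measurable

lemma Q_measurable_at:
  fixes f g :: "real^'n \<Rightarrow> real"
  assumes [measurable]: "f \<in> borel_measurable borel" "g \<in> borel_measurable borel"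
  shows "Q_plus B f g \<in> borel_measurable borel" "Q_minus \<beta> f g \<in> borel_measurable borel"
proof -
  have "case_prod (\<lambda>_::real^'n. f) \<in> borel_measurable (borel \<Otimes>\<^sub>M borel)" by measurable
  note 1 = Q_plus_measurable[OF this assms(2), of "\<lambda>v. v"] Q_minus_measurable[OF this assms(2), of
    "\<lambda>v. v"]
  show "Q_plus B f g \<in> borel_measurable borel" by (rule 1(1)) measurable
  show "Q_minus \<beta> f g \<in> borel_measurable borel" by (rule 1(2)) measurable
qed

lemma Q_integrable:
  fixes f :: "real^'n \<Rightarrow> real"
  assumes f: "f \<in> borel_measurable borel" and a: "0 < a" and m: "moment f \<noteq> \<infinity>"
  shows "integrable lborel (Q_plus B f (maxwellian a c))"
    "integrable lborel (Q_minus \<beta> f (maxwellian a c))"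
    and "(\<integral>\<^sup>+v. \<integral>\<^sup>+w. ennreal (\<bar>f w\<bar> * norm (v - w) powr \<beta> * \<bar>maxwellian a c v\<bar>) \<partial>lborel \<partial>lborel) < \<infinity>"
proof -
  have fin: "maxwellian_mass a c TYPE('n) * moment f < \<infinity>"
    using maxwellian_mass_finite[OF a] m by (simp add: ennreal_mult_less_top less_top)
  show "integrable lborel (Q_plus B f (maxwellian a c))"
  proof (rule nn_integral_abs_finite)
    show "(\<integral>\<^sup>+v. ennreal \<bar>Q_plus B f (maxwellian a c) v\<bar> \<partial>lborel) \<noteq> \<infinity>"
      using le_less_trans[OF nn_integral_Q_plus_le[OF f] fin] by simp
  qed (simp add: Q_measurable_at f)
  show "integrable lborel (Q_minus \<beta> f (maxwellian a c))"
  proof (rule nn_integral_abs_finite)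
    show "(\<integral>\<^sup>+v. ennreal \<bar>Q_minus \<beta> f (maxwellian a c) v\<bar> \<partial>lborel) \<noteq> \<infinity>"
      using le_less_trans[OF nn_integral_Q_minus_le[OF f] fin] by simp
  qed (simp add: Q_measurable_at f)
  show "(\<integral>\<^sup>+v. \<integral>\<^sup>+w. ennreal (\<bar>f w\<bar> * norm (v - w) powr \<beta> * \<bar>maxwellian a c v\<bar>) \<partial>lborel \<partial>lborel) < \<infinity>"
    by (rule le_less_trans[OF nn_integral_loss_total_le[OF f] fin])
qed

text \<open>The gain of |f - f'| integrated over v equals its loss, which is 0; hence for almost
  every v the two gain integrands agree almost everywhere. Preimages of null sets under the
  collision map need not be analysed.\<close>

lemma Q_plus_cong_AE:
  fixes f g :: "real^'n \<Rightarrow> real"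
  assumes [measurable]: "f \<in> borel_measurable borel" "f' \<in> borel_measurable borel"
    "g \<in> borel_measurable borel"
    and ae: "AE w in lborel. f w = f' w"
  shows "AE v in lborel. Q_plus B f g v = Q_plus B f' g v"
proof -
  let ?G = "\<lambda>v. \<integral>\<^sup>+p. ennreal \<bar>gain_integrand B (\<lambda>w. f w - f' w) g v p\<bar> \<partial>(lborel \<Otimes>\<^sub>M sphere_measure)"
  have "(\<integral>\<^sup>+v. ?G v \<partial>lborel) = (\<integral>\<^sup>+v. \<integral>\<^sup>+w. ennreal (\<bar>f w - f' w\<bar> * norm (v - w) powr \<beta> * \<bar>g v\<bar>)
      \<partial>lborel \<partial>lborel)"
    by (rule nn_integral_gain_total) measurable
  also have "\<dots> = (\<integral>\<^sup>+v. \<integral>\<^sup>+w. 0 \<partial>(lborel :: (real^'n) measure) \<partial>(lborel :: (real^'n) measure))"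
    by (rule nn_integral_cong, rule nn_integral_cong_AE, rule eventually_mono[OF ae]) simp
  finally have 0: "(\<integral>\<^sup>+v. ?G v \<partial>lborel) = 0" by simp
  have "?G \<in> borel_measurable lborel"
    by (rule nn_integral_gain_measurable[where F = "\<lambda>_ w. f w - f' w" and V = "\<lambda>v. v"]) measurable
  then have "AE v in lborel. ?G v = 0" using 0 by (simp add: nn_integral_0_iff_AE)
  then show ?thesis
  proof eventually_elim
    case (elim v)
    have [measurable]: "gain_integrand B (\<lambda>w. f w - f' w) g v
        \<in> borel_measurable (lborel \<Otimes>\<^sub>M sphere_measure)"
      by (rule gain_integrand_measurable_at) measurable
    note [measurable] = gain_integrand_measurable_at[of f g v] gain_integrand_measurable_at[of f' g v]
    have "AE p in lborel \<Otimes>\<^sub>M sphere_measure. ennreal \<bar>gain_integrand B (\<lambda>w. f w - f' w) g v p\<bar> = 0"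
      using elim by (subst (asm) nn_integral_0_iff_AE) auto
    then have "AE p in lborel \<Otimes>\<^sub>M sphere_measure. gain_integrand B f g v p = gain_integrand B f' g v p"
      by eventually_elim (auto simp: gain_integrand_def algebra_simps split: prod.splits)
    then show ?case unfolding Q_plus_def by (intro integral_cong_AE) auto
  qed
qed

text \<open>Both sides are computed as nonnegative integrals, where the totals of gain and loss
  agree; the common value is finite, so the equality passes to Bochner integrals.\<close>

lemma integral_Q_plus_eq_Q_minus:
  fixes f :: "real^'n \<Rightarrow> real"
  assumes f[measurable]: "f \<in> borel_measurable borel" and nonneg: "AE w in lborel. 0 \<le> f w"
    and a: "0 < a" and m: "moment f \<noteq> \<infinity>"
  shows "(\<integral>v. Q_plus B f (maxwellian a c) v \<partial>lborel) = (\<integral>v. Q_minus \<beta> f (maxwellian a c) v \<partial>lborel)"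
proof -
  \<comment> \<open>f is nonnegative only almost everywhere. With |f| in its place the gain
    integrand is nonnegative for every v up to null sets of directions, and \<open>Q_plus\<close>
    changes only on a null set.\<close>
  let ?M = "maxwellian a c" and ?f = "\<lambda>w. \<bar>f w\<bar>"
  let ?G = "\<lambda>v. \<integral>\<^sup>+p. ennreal \<bar>gain_integrand B ?f ?M v p\<bar> \<partial>(lborel \<Otimes>\<^sub>M sphere_measure)"
  let ?L = "\<lambda>v. \<integral>\<^sup>+w. ennreal (\<bar>f w\<bar> * norm (v - w) powr \<beta> * \<bar>?M v\<bar>) \<partial>lborel"
  have GL: "(\<integral>\<^sup>+v. ?G v \<partial>lborel) = (\<integral>\<^sup>+v. ?L v \<partial>lborel)"
    using nn_integral_gain_total[of ?f ?M] by simp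
  have fin: "(\<integral>\<^sup>+v. ?L v \<partial>lborel) < \<infinity>" by (rule Q_integrable(3)[OF f a m])
  have Lm: "?L \<in> borel_measurable lborel" by measurable
  have Gm: "?G \<in> borel_measurable lborel"
    by (rule nn_integral_gain_measurable[where F = "\<lambda>_. ?f" and V = "\<lambda>v. v"]) measurable
  have "AE v in lborel. Q_plus B f ?M v = Q_plus B ?f ?M v"
    using nonneg by (intro Q_plus_cong_AE) (auto elim: eventually_mono)
  moreover have "AE v in lborel. ennreal (Q_plus B ?f ?M v) = ?G v \<and> 0 \<le> Q_plus B ?f ?M v"
  proof -
    have "AE v in lborel. ?G v \<noteq> \<infinity>" using GL fin by (intro nn_integral_PInf_AE Gm) simp
    then show ?thesis
    proof eventually_elim
      case (elim v)
      have gv: "gain_integrand B ?f ?M v \<in> borel_measurable (lborel \<Otimes>\<^sub>M sphere_measure)"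
        by (rule gain_integrand_measurable_at) measurable
      have int: "integrable (lborel \<Otimes>\<^sub>M sphere_measure) (gain_integrand B ?f ?M v)"
        by (rule nn_integral_abs_finite[OF gv elim])
      have aeB: "AE p in lborel \<Otimes>\<^sub>M sphere_measure. 0 \<le> gain_integrand B ?f ?M v p"
      proof -
        have "AE w in lborel. AE \<sigma> in sphere_measure. 0 \<le> gain_integrand B ?f ?M v (w, \<sigma>)"
        proof (rule AE_I2)
          fix w
          have "AE \<sigma> in sphere_measure. B_bar B (v - w) \<sigma> = Bsym (v - w) \<sigma>"
            using AE_distrD[OF measurable_ident_sphere_measure AE_B_bar_eq[of
              "v - w", unfolded sphere_borel_def]] .
          then show "AE \<sigma> in sphere_measure. 0 \<le> gain_integrand B ?f ?M v (w, \<sigma>)"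
            by eventually_elim (simp add: gain_integrand_def)
        qed
        moreover have "{p \<in> space (lborel \<Otimes>\<^sub>M sphere_measure). 0 \<le> gain_integrand B ?f ?M v p}
            \<in> sets (lborel \<Otimes>\<^sub>M sphere_measure)"
          using gv by measurable
        ultimately show ?thesis by (intro lborel_sphere_measure.AE_pair_measure) auto
      qed
      have "ennreal (Q_plus B ?f ?M v) = (\<integral>\<^sup>+p. ennreal (gain_integrand B ?f ?M v p)
          \<partial>(lborel \<Otimes>\<^sub>M sphere_measure))"
        unfolding Q_plus_def by (rule nn_integral_eq_integral[OF int aeB, symmetric])
      also have "\<dots> = ?G v" using aeB by (intro nn_integral_cong_AE) auto
      finally show ?case using aeB unfolding Q_plus_def by (auto intro: integral_nonneg_AE)
    qed
  qed
  ultimately have P: "AE v in lborel. ennreal (Q_plus B f ?M v) = ?G v"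
    "AE v in lborel. 0 \<le> Q_plus B f ?M v"
    by auto
  have N: "AE v in lborel. ennreal (Q_minus \<beta> f ?M v) = ?L v \<and> 0 \<le> Q_minus \<beta> f ?M v"
  proof -
    have "AE v in lborel. ?L v \<noteq> \<infinity>" using fin by (intro nn_integral_PInf_AE Lm) simp
    then show ?thesis
    proof eventually_elim
      case (elim v)
      have ae: "AE w in lborel. 0 \<le> f w * norm (v - w) powr \<beta> * ?M v"
        using nonneg by eventually_elim simp
      have int: "integrable lborel (\<lambda>w. f w * norm (v - w) powr \<beta> * ?M v)"
        using elim by (intro nn_integral_abs_finite) (auto simp: abs_mult)
      have "ennreal (Q_minus \<beta> f ?M v) = ennreal (\<integral>w. f w * norm (v - w) powr \<beta> * ?M v \<partial>lborel)"
        by (simp add: Q_minus_def)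
      also have "\<dots> = (\<integral>\<^sup>+w. ennreal (f w * norm (v - w) powr \<beta> * ?M v) \<partial>lborel)"
        by (rule nn_integral_eq_integral[OF int ae, symmetric])
      also have "\<dots> = ?L v" using nonneg by (intro nn_integral_cong_AE) auto
      finally show ?case using integral_nonneg_AE[OF ae] by (simp add: Q_minus_def)
    qed
  qed
  have "ennreal (\<integral>v. Q_plus B f ?M v \<partial>lborel) = (\<integral>\<^sup>+v. ennreal (Q_plus B f ?M v) \<partial>lborel)"
    by (rule nn_integral_eq_integral[OF Q_integrable(1)[OF f a m] P(2), symmetric])
  also have "\<dots> = (\<integral>\<^sup>+v. ?L v \<partial>lborel)" unfolding GL[symmetric] using P(1) by (intro nn_integral_cong_AE)
  also have "\<dots> = (\<integral>\<^sup>+v. ennreal (Q_minus \<beta> f ?M v) \<partial>lborel)" using N by (intro nn_integral_cong_AE) auto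
  also have "\<dots> = ennreal (\<integral>v. Q_minus \<beta> f ?M v \<partial>lborel)"
    using N by (intro nn_integral_eq_integral Q_integrable(2)[OF f a m]) auto
  finally show ?thesis
    using P(2) N by (subst (asm) ennreal_inj) (auto intro!: integral_nonneg_AE)
qed

end

section \<open>Maxwellians as comparison functions\<close>

text \<open>For H depending on f in a Lipschitz way, the L^1 distance of two time slices of f
  controls the difference of the integrals. The case L = 1 covers |f| and |f - M|.\<close>

lemma cont_L1_integral_continuous:
  fixes f H :: "real^'n \<Rightarrow> real^'n \<Rightarrow> real \<Rightarrow> real"
  assumes f: "cont_L1 T f"
    and H: "\<And>t. t \<in> {0..T} \<Longrightarrow> integrable phase (\<lambda>(x, v). H x v t)"
    and lip: "\<And>x v s t. \<bar>H x v s - H x v t\<bar> \<le> L * \<bar>f x v s - f x v t\<bar>"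
  shows "continuous_on {0..T} (\<lambda>t. \<integral>(x, v). H x v t \<partial>phase)"
  unfolding continuous_on_def
proof
  fix t assume t: "t \<in> {0..T}"
  have lim: "((\<lambda>s. L * (\<integral>(x, v). \<bar>f x v s - f x v t\<bar> \<partial>phase)) \<longlongrightarrow> L * 0) (at t within {0..T})"
    using f t unfolding cont_L1_def by (intro tendsto_mult_left) auto
  show "((\<lambda>s. \<integral>(x, v). H x v s \<partial>phase) \<longlongrightarrow> (\<integral>(x, v). H x v t \<partial>phase)) (at t within {0..T})"
  proof (rule tendsto_dist_iff[THEN iffD2], rule tendsto_sandwich[OF _ _ tendsto_const lim[simplified]])
    show "\<forall>\<^sub>F s in at t within {0..T}. dist (\<integral>(x, v). H x v s \<partial>phase) (\<integral>(x, v). H x v t \<partial>phase)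
      \<le> L * (\<integral>(x, v). \<bar>f x v s - f x v t\<bar> \<partial>phase)"
      unfolding eventually_at_filter
    proof (intro always_eventually allI impI)
      fix s assume s: "s \<in> {0..T}"
      have int: "integrable phase (\<lambda>z. \<bar>(case z of (x, v) \<Rightarrow> f x v s) - (case z of (x, v) \<Rightarrow> f x v t)\<bar>)"
        using f s t unfolding cont_L1_def
          by (intro integrable_abs Bochner_Integration.integrable_diff) auto
      have "dist (\<integral>(x, v). H x v s \<partial>phase) (\<integral>(x, v). H x v t \<partial>phase)
        = norm (\<integral>z. (case z of (x, v) \<Rightarrow> H x v s) - (case z of (x, v) \<Rightarrow> H x v t) \<partial>phase)"
        by (subst Bochner_Integration.integral_diff[OF H[OF s] H[OF t]]) (simp add: dist_norm)
      also have "\<dots> \<le> (\<integral>z. norm ((case z of (x, v) \<Rightarrow> H x v s) - (case z of (x, v) \<Rightarrow> H x v t)) \<partial>phase)"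
        by (rule integral_norm_bound)
      also have "\<dots> \<le> (\<integral>z. L * \<bar>(case z of (x, v) \<Rightarrow> f x v s) - (case z of (x, v) \<Rightarrow> f x v t)\<bar> \<partial>phase)"
        using H s t int lip by (intro integral_mono integrable_norm
          Bochner_Integration.integrable_diff integrable_mult_right) auto
      also have "\<dots> = L * (\<integral>(x, v). \<bar>f x v s - f x v t\<bar> \<partial>phase)"
        by (simp add: case_prod_unfold)
      finally show "dist (\<integral>(x, v). H x v s \<partial>phase) (\<integral>(x, v). H x v t \<partial>phase)
        \<le> L * (\<integral>(x, v). \<bar>f x v s - f x v t\<bar> \<partial>phase)" .
    qed
  qed auto
qed

text \<open>The part |f| is bounded uniformly on [0, T] by continuity in L^1 and compactness; the
  part |f| |v|^2 is bounded for almost every t by the second moment hypothesis.\<close>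

lemma moment_phase_time_finite:
  fixes f :: "real^'n \<Rightarrow> real^'n \<Rightarrow> real \<Rightarrow> real"
  assumes f: "cont_L1 T f" and sm: "second_moment_bounded T f"
  shows "(\<integral>\<^sup>+(x, t). moment (\<lambda>v. f x v t) \<partial>(torus \<Otimes>\<^sub>M time T)) < \<infinity>"
proof -
  have fm: "(\<lambda>(x, v, t). f x v t) \<in> borel_measurable (phase_time T)" using f by (simp add: cont_L1_def)
  have int: "integrable phase (\<lambda>(x, v). f x v t)" if "t \<in> {0..T}" for t
    using f that by (simp add: cont_L1_def)
  have "continuous_on {0..T} (\<lambda>t. \<integral>(x, v). \<bar>f x v t\<bar> \<partial>phase)"
    by (rule cont_L1_integral_continuous[OF f, where L = 1])
      (use integrable_abs[OF int] in \<open>auto simp: case_prod_unfold abs_triangle_ineq3\<close>)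
  then have "bounded ((\<lambda>t. \<integral>(x, v). \<bar>f x v t\<bar> \<partial>phase) ` {0..T})"
    by (intro compact_imp_bounded compact_continuous_image) auto
  then obtain C where C: "\<forall>t\<in>{0..T}. \<bar>\<integral>(x, v). \<bar>f x v t\<bar> \<partial>phase\<bar> \<le> C"
    unfolding bounded_iff by auto
  obtain K :: real where K: "AE t in time T. (\<integral>\<^sup>+(x, v). ennreal (\<bar>f x v t\<bar> * (norm v)\<^sup>2) \<partial>phase)
      \<le> ennreal K"
    using sm by (auto simp: second_moment_bounded_def)
  define F where "F = (\<lambda>(x :: real^'n, v :: real^'n, t). ennreal (\<bar>f x v t\<bar> * (1 + (norm v)\<^sup>2)))"
  have vm[measurable]: "(\<lambda>y. fst (snd y)) \<in> borel_measurable (phase_time T)"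
    unfolding phase_time_def by measurable
  have F: "F \<in> borel_measurable (phase_time T)"
  proof -
    have "(\<lambda>y. ennreal (\<bar>(\<lambda>(x, v, t). f x v t) y\<bar> * (1 + (norm (fst (snd y)))\<^sup>2)))
        \<in> borel_measurable (phase_time T)"
      using fm by measurable
    then show ?thesis by (simp add: F_def case_prod_unfold)
  qed
  have "(\<integral>\<^sup>+(x, t). moment (\<lambda>v. f x v t) \<partial>(torus \<Otimes>\<^sub>M time T)) = (\<integral>\<^sup>+y. F y \<partial>phase_time T)"
    unfolding nn_integral_phase_time(1)[OF F] by (simp add: moment_def F_def)
  also have "\<dots> = (\<integral>\<^sup>+t. \<integral>\<^sup>+(x, v). F (x, v, t) \<partial>phase \<partial>time T)"
    by (rule nn_integral_phase_time(2)[OF F])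
  also have "\<dots> \<le> (\<integral>\<^sup>+t. ennreal C + ennreal K \<partial>time T)"
  proof (rule nn_integral_mono_AE)
    show "AE t in time T. (\<integral>\<^sup>+(x, v). F (x, v, t) \<partial>phase) \<le> ennreal C + ennreal K"
      using K AE_space
    proof eventually_elim
      case (elim t)
      then have t: "t \<in> {0..T}" by (simp add: space_time)
      have fp: "(\<lambda>z. f (fst z) (snd z) t) \<in> borel_measurable phase"
        using int[OF t] by (simp add: case_prod_unfold)
      have n: "(\<lambda>z. norm (snd z)) \<in> borel_measurable (phase :: ((real^'n) \<times> (real^'n)) measure)"
        unfolding phase_def by measurable
      have "(\<integral>\<^sup>+(x, v). F (x, v, t) \<partial>phase)
          = (\<integral>\<^sup>+z. ennreal \<bar>f (fst z) (snd z) t\<bar> + ennreal (\<bar>f (fst z) (snd z) t\<bar> * (norm (snd z))\<^sup>2)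
          \<partial>phase)"
        by (intro nn_integral_cong) (simp add: F_def case_prod_unfold distrib_left)
      also have "\<dots> = (\<integral>\<^sup>+z. ennreal \<bar>f (fst z) (snd z) t\<bar> \<partial>phase)
          + (\<integral>\<^sup>+z. ennreal (\<bar>f (fst z) (snd z) t\<bar> * (norm (snd z))\<^sup>2) \<partial>phase)"
        by (intro nn_integral_add measurable_compose[OF _ measurable_ennreal] borel_measurable_abs
            borel_measurable_times borel_measurable_power fp n)
      also have "(\<integral>\<^sup>+z. ennreal \<bar>f (fst z) (snd z) t\<bar> \<partial>phase) = ennreal (\<integral>(x, v). \<bar>f x v t\<bar> \<partial>phase)"
        using integrable_abs[OF int[OF t]]
          by (subst nn_integral_eq_integral) (auto simp: case_prod_unfold)
      also have "\<dots> \<le> ennreal C" using C t by (intro ennreal_leI) (auto dest: bspec)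
      also have "(\<integral>\<^sup>+z. ennreal (\<bar>f (fst z) (snd z) t\<bar> * (norm (snd z))\<^sup>2) \<partial>phase) \<le> ennreal K"
        using elim(1) by (simp add: case_prod_unfold)
      finally show ?case by (simp add: add_mono)
    qed
  qed
  also have "\<dots> = (ennreal C + ennreal K) * ennreal T" by (simp add: emeasure_time)
  also have "\<dots> < \<infinity>" by (simp add: ennreal_mult_less_top)
  finally show ?thesis .
qed

lemma moment_measurable:
  fixes f :: "real^'n \<Rightarrow> real^'n \<Rightarrow> real \<Rightarrow> real"
  assumes fm: "(\<lambda>(x, v, t). f x v t) \<in> borel_measurable (phase_time T)"
  shows "(\<lambda>(x, t). moment (\<lambda>v. f x v t)) \<in> borel_measurable (torus \<Otimes>\<^sub>M time T)"
proof -
  have [measurable]: "(\<lambda>z. f (fst (fst z)) (snd z) (snd (fst z)))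
      \<in> borel_measurable ((torus \<Otimes>\<^sub>M time T) \<Otimes>\<^sub>M lborel)"
    using phase_time_permute(1)[OF fm] by (simp add: case_prod_unfold)
  have "(\<lambda>y. \<integral>\<^sup>+w. ennreal (\<bar>f (fst y) w (snd y)\<bar> * (1 + (norm w)\<^sup>2)) \<partial>lborel)
      \<in> borel_measurable (torus \<Otimes>\<^sub>M time T)"
    by (rule lborel.borel_measurable_nn_integral) (simp add: case_prod_unfold, measurable)
  then show ?thesis by (simp add: moment_def case_prod_unfold)
qed

lemma phase_time_curry_measurable:
  fixes f :: "real^'n \<Rightarrow> real^'n \<Rightarrow> real \<Rightarrow> real"
  assumes fm: "(\<lambda>(x, v, t). f x v t) \<in> borel_measurable (phase_time T)"
  shows "case_prod (\<lambda>y u. f (fst y) u (snd (snd y))) \<in> borel_measurable (phase_time T \<Otimes>\<^sub>M borel)"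
proof -
  have "(\<lambda>z. (fst (fst z), snd z, snd (snd (fst z)))) \<in> phase_time T \<Otimes>\<^sub>M borel \<rightarrow>\<^sub>M phase_time T"
    unfolding phase_time_def by measurable
  from measurable_compose[OF this fm] show ?thesis by (simp add: case_prod_unfold)
qed

section \<open>Integrability of the collision terms with a Maxwellian\<close>

context hard_potential
begin

lemma Q_maxwellian_regular:
  fixes f :: "real^'n \<Rightarrow> real^'n \<Rightarrow> real \<Rightarrow> real"
  assumes a: "0 < a" and f: "cont_L1 T f" and sm: "second_moment_bounded T f"
  shows "AE (x, v, t) in phase_time T. Q_converges B \<beta> (\<lambda>u. f x u t) (maxwellian a c) v"
    and "integrable (phase_time T) (\<lambda>(x, v, t). Q_plus B (\<lambda>u. f x u t) (maxwellian a c) v)"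
    and "integrable (phase_time T) (\<lambda>(x, v, t). Q_minus \<beta> (\<lambda>u. f x u t) (maxwellian a c) v)"
proof -
  have fm: "(\<lambda>(x, v, t). f x v t) \<in> borel_measurable (phase_time T)" using f by (simp add: cont_L1_def)
  let ?F = "\<lambda>y u. f (fst y) u (snd (snd y))" and ?V = "\<lambda>y. fst (snd y)"
  let ?M = "maxwellian a c :: real^'n \<Rightarrow> real"
  note F = phase_time_curry_measurable[OF fm]
  have V: "?V \<in> borel_measurable (phase_time T)" unfolding phase_time_def by measurable
  have M: "?M \<in> borel_measurable borel" by measurable
  have fs: "(\<lambda>v. f x v t) \<in> borel_measurable borel" if "x \<in> space torus" "t \<in> {0..T}" for x t
    using phase_time_slice[OF fm that] by simp
  let ?m = "maxwellian_mass a c TYPE('n)"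
  have fin: "(\<integral>\<^sup>+(x, t). ?m * moment (\<lambda>v. f x v t) \<partial>(torus \<Otimes>\<^sub>M time T)) < \<infinity>"
  proof -
    have "(\<integral>\<^sup>+(x, t). ?m * moment (\<lambda>v. f x v t) \<partial>(torus \<Otimes>\<^sub>M time T)) = ?m
        * (\<integral>\<^sup>+(x, t). moment (\<lambda>v. f x v t) \<partial>(torus \<Otimes>\<^sub>M time T))"
      using moment_measurable[OF fm] by (subst nn_integral_cmult[symmetric]) (auto simp:
        case_prod_unfold)
    then show ?thesis
      using moment_phase_time_finite[OF f sm] maxwellian_mass_finite[OF a]
        by (simp add: ennreal_mult_less_top)
  qed
  \<comment> \<open>All three claims reduce to this: a bound of the v-integral by a constant times
    the moment of f, which is integrable in (x, t).\<close>
  have bound: "(\<integral>\<^sup>+y. H y \<partial>phase_time T) \<noteq> \<infinity>"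
    if H: "H \<in> borel_measurable (phase_time T)"
      and le: "\<And>x t. x \<in> space torus \<Longrightarrow> t \<in> {0..T} \<Longrightarrow> (\<integral>\<^sup>+v. H (x, v, t) \<partial>lborel) \<le> ?m
          * moment (\<lambda>v. f x v t)"
    for H :: "(real^'n) \<times> (real^'n) \<times> real \<Rightarrow> ennreal"
  proof -
    have "(\<integral>\<^sup>+y. H y \<partial>phase_time T) = (\<integral>\<^sup>+(x, t). \<integral>\<^sup>+v. H (x, v, t) \<partial>lborel \<partial>(torus \<Otimes>\<^sub>M time T))"
      by (rule nn_integral_phase_time(1)[OF H])
    also have "\<dots> \<le> (\<integral>\<^sup>+(x, t). ?m * moment (\<lambda>v. f x v t) \<partial>(torus \<Otimes>\<^sub>M time T))"
      by (intro nn_integral_mono) (auto simp: space_pair_measure space_time intro!: le)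
    finally show ?thesis using fin by (auto simp: less_top)
  qed
  show "integrable (phase_time T) (\<lambda>(x, v, t). Q_plus B (\<lambda>u. f x u t) ?M v)"
  proof (rule nn_integral_abs_finite)
    have "(\<lambda>y. Q_plus B (?F y) ?M (?V y)) \<in> borel_measurable (phase_time T)"
      by (rule Q_plus_measurable[OF F M V])
    then show m: "(\<lambda>(x, v, t). Q_plus B (\<lambda>u. f x u t) ?M v) \<in> borel_measurable (phase_time T)"
      by (simp add: case_prod_unfold)
    then have "(\<lambda>y. ennreal \<bar>case y of (x, v, t) \<Rightarrow> Q_plus B (\<lambda>u. f x u t) ?M v\<bar>)
        \<in> borel_measurable (phase_time T)"
      by measurable
    then show "(\<integral>\<^sup>+y. ennreal \<bar>case y of (x, v, t) \<Rightarrow> Q_plus B (\<lambda>u. f x u t) ?M v\<bar> \<partial>phase_time T) \<noteq> \<infinity>"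
      by (rule bound) (auto intro!: nn_integral_Q_plus_le fs)
  qed
  show "integrable (phase_time T) (\<lambda>(x, v, t). Q_minus \<beta> (\<lambda>u. f x u t) ?M v)"
  proof (rule nn_integral_abs_finite)
    have "(\<lambda>y. Q_minus \<beta> (?F y) ?M (?V y)) \<in> borel_measurable (phase_time T)"
      by (rule Q_minus_measurable[OF F M V])
    then show m: "(\<lambda>(x, v, t). Q_minus \<beta> (\<lambda>u. f x u t) ?M v) \<in> borel_measurable (phase_time T)"
      by (simp add: case_prod_unfold)
    then have "(\<lambda>y. ennreal \<bar>case y of (x, v, t) \<Rightarrow> Q_minus \<beta> (\<lambda>u. f x u t) ?M v\<bar>)
        \<in> borel_measurable (phase_time T)"
      by measurable
    then show "(\<integral>\<^sup>+y. ennreal \<bar>case y of (x, v, t) \<Rightarrow> Q_minus \<beta> (\<lambda>u. f x u t) ?M v\<bar> \<partial>phase_time T) \<noteq> \<infinity>"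
      by (rule bound) (auto intro!: nn_integral_Q_minus_le fs)
  qed
  have "AE y in phase_time T. (\<integral>\<^sup>+p. ennreal \<bar>gain_integrand B (?F y) ?M (?V y) p\<bar>
      \<partial>(lborel \<Otimes>\<^sub>M sphere_measure)) \<noteq> \<infinity>"
  proof (rule nn_integral_PInf_AE)
    show m: "(\<lambda>y. \<integral>\<^sup>+p. ennreal \<bar>gain_integrand B (?F y) ?M (?V y) p\<bar> \<partial>(lborel \<Otimes>\<^sub>M sphere_measure))
        \<in> borel_measurable (phase_time T)"
      by (rule nn_integral_gain_measurable[OF F M V])
    then show "(\<integral>\<^sup>+y. \<integral>\<^sup>+p. ennreal \<bar>gain_integrand B (?F y) ?M (?V y) p\<bar> \<partial>(lborel \<Otimes>\<^sub>M sphere_measure)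
        \<partial>phase_time T) \<noteq> \<infinity>"
    proof (rule bound)
      fix x t assume "x \<in> space (torus :: (real^'n) measure)" "t \<in> {0..T}"
      note fs = fs[OF this]
      show "(\<integral>\<^sup>+v. \<integral>\<^sup>+p. ennreal \<bar>gain_integrand B (?F (x, v, t)) ?M (?V (x, v, t)) p\<bar>
          \<partial>(lborel \<Otimes>\<^sub>M sphere_measure) \<partial>lborel) \<le> ?m * moment (\<lambda>v. f x v t)"
        using nn_integral_loss_total_le[OF fs] by (simp add: nn_integral_gain_total[OF fs M])
    qed
  qed
  moreover have "AE y in phase_time T. (\<integral>\<^sup>+w. ennreal (\<bar>?F y w\<bar> * norm (?V y - w) powr \<beta>
      * \<bar>?M (?V y)\<bar>) \<partial>lborel) \<noteq> \<infinity>"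
  proof (rule nn_integral_PInf_AE)
    note [measurable] = F V
    show m: "(\<lambda>y. \<integral>\<^sup>+w. ennreal (\<bar>?F y w\<bar> * norm (?V y - w) powr \<beta> * \<bar>?M (?V y)\<bar>) \<partial>lborel)
        \<in> borel_measurable (phase_time T)"
      by measurable
    then show "(\<integral>\<^sup>+y. \<integral>\<^sup>+w. ennreal (\<bar>?F y w\<bar> * norm (?V y - w) powr \<beta> * \<bar>?M (?V y)\<bar>) \<partial>lborel
        \<partial>phase_time T) \<noteq> \<infinity>"
    proof (rule bound)
      fix x t assume "x \<in> space (torus :: (real^'n) measure)" "t \<in> {0..T}"
      note fs = fs[OF this]
      show "(\<integral>\<^sup>+v. \<integral>\<^sup>+w. ennreal (\<bar>?F (x, v, t) w\<bar> * norm (?V (x, v, t) - w) powr \<beta>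
          * \<bar>?M (?V (x, v, t))\<bar>) \<partial>lborel \<partial>lborel) \<le> ?m * moment (\<lambda>v. f x v t)"
        using nn_integral_loss_total_le[OF fs] by simp
    qed
  qed
  ultimately have "AE y in phase_time T. Q_converges B \<beta> (?F y) ?M (?V y)"
    using AE_space
  proof eventually_elim
    case (elim y)
    have [measurable]: "?F y \<in> borel_measurable borel"
      using elim(3) fs[of "fst y" "snd (snd y)"]
        by (auto simp: phase_time_def space_pair_measure space_time)
    have "integrable (lborel \<Otimes>\<^sub>M sphere_measure) (gain_integrand B (?F y) ?M (?V y))"
      by (rule nn_integral_abs_finite[OF gain_integrand_measurable_at elim(1)]) measurable
    moreover have "integrable lborel (\<lambda>w. ?F y w * norm (?V y - w) powr \<beta> * ?M (?V y))"
      by (rule nn_integral_abs_finite) (use elim(2) in \<open>simp_all add: abs_mult\<close>)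
    \<comment> \<open>Finiteness is known with the weight M(v); dividing by this positive constant
      leaves the loss integral itself.\<close>
    then have X: "integrable lborel (\<lambda>w. (?F y w * norm (?V y - w) powr \<beta> * ?M (?V y)) / ?M (?V y))"
      by (rule integrable_divide)
    have eq: "(?F y w * norm (?V y - w) powr \<beta> * ?M (?V y)) / ?M (?V y) = ?F y w
        * norm (?V y - w) powr \<beta>" for w
      using maxwellian_pos[of a c "?V y"] by (intro nonzero_mult_div_cancel_right) linarith
    have "integrable lborel (\<lambda>w. ?F y w * norm (?V y - w) powr \<beta>)"
      using X unfolding eq .
    ultimately show ?case by (simp add: Q_converges_def)
  qed
  then show "AE (x, v, t) in phase_time T. Q_converges B \<beta> (\<lambda>u. f x u t) ?M v"
    by (simp add: case_prod_unfold)
qed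

end

lemma maxwellian_cont_L1:
  assumes a: "0 < a"
  shows "cont_L1 T (\<lambda>(x :: real^'n) v t. maxwellian a c v)" and
    "second_moment_bounded T (\<lambda>(x :: real^'n) v t. maxwellian a c v)"
    and "integrable lborel (maxwellian a c :: real^'n \<Rightarrow> real)"
proof -
  let ?I = "\<integral>\<^sup>+v. ennreal (maxwellian a c v * (2 + norm v)\<^sup>2) \<partial>(lborel :: (real^'n) measure)"
  let ?E = "emeasure (torus :: (real^'n) measure) (space torus)"
  have I: "?I * ?E < \<infinity>"
    unfolding infinity_ennreal_def ennreal_mult_less_top
    using maxwellian_moment_finite[OF a, of c, where 'n = 'n] torus.emeasure_finite[of
      "space (torus :: (real^'n) measure)"] less_top
    by (metis infinity_ennreal_def)
  have sp: "snd \<in> borel_measurable (phase :: ((real^'n) \<times> (real^'n)) measure)" unfolding phase_def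
    by simp
  have le: "maxwellian a c v \<le> maxwellian a c v * (2 + norm v)\<^sup>2"
    "maxwellian a c v * (norm v)\<^sup>2 \<le> maxwellian a c v * (2 + norm v)\<^sup>2" for v :: "real^'n"
  proof -
    have "1 \<le> (2 + norm v)\<^sup>2" by (intro one_le_power) simp
    then show "maxwellian a c v \<le> maxwellian a c v * (2 + norm v)\<^sup>2" by simp
    show "maxwellian a c v * (norm v)\<^sup>2 \<le> maxwellian a c v * (2 + norm v)\<^sup>2"
      by (intro mult_left_mono power_mono) auto
  qed
  show "integrable lborel (maxwellian a c :: real^'n \<Rightarrow> real)"
  proof (rule nn_integral_abs_finite)
    have "(\<integral>\<^sup>+v. ennreal \<bar>maxwellian a c v\<bar> \<partial>(lborel :: (real^'n) measure)) \<le> ?I"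
      using le(1) by (intro nn_integral_mono ennreal_leI) simp
    then show "(\<integral>\<^sup>+v. ennreal \<bar>maxwellian a c v\<bar> \<partial>(lborel :: (real^'n) measure)) \<noteq> \<infinity>"
      using maxwellian_moment_finite[OF a, of c, where 'n = 'n] by (auto simp: top_unique)
  qed measurable
  have "integrable phase (\<lambda>(x :: real^'n, v :: real^'n). maxwellian a c v)"
  proof (rule nn_integral_abs_finite)
    show "(\<lambda>(x :: real^'n, v :: real^'n). maxwellian a c v) \<in> borel_measurable phase"
      using sp by (simp add: case_prod_unfold)
    have "(\<integral>\<^sup>+z. ennreal \<bar>case z of (x, v) \<Rightarrow> maxwellian a c v\<bar>
        \<partial>(phase :: ((real^'n) \<times> (real^'n)) measure))
      = (\<integral>\<^sup>+(x, v). ennreal (maxwellian a c v) \<partial>(phase :: ((real^'n) \<times> (real^'n)) measure))"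
      by (simp add: case_prod_unfold)
    also have "\<dots> = (\<integral>\<^sup>+v. ennreal (maxwellian a c v) \<partial>(lborel :: (real^'n) measure)) * ?E"
      by (rule nn_integral_phase_const) measurable
    also have "\<dots> \<le> ?I * ?E" using le(1) by (intro mult_right_mono nn_integral_mono ennreal_leI) auto
    finally show "(\<integral>\<^sup>+z. ennreal \<bar>case z of (x, v) \<Rightarrow> maxwellian a c v\<bar>
        \<partial>(phase :: ((real^'n) \<times> (real^'n)) measure)) \<noteq> \<infinity>"
      using I by (auto simp: top_unique)
  qed
  moreover have "(\<lambda>(x :: real^'n, v :: real^'n, t). maxwellian a c v) \<in> borel_measurable (phase_time T)"
    unfolding phase_time_def by (simp add: case_prod_unfold)
  ultimately show "cont_L1 T (\<lambda>(x :: real^'n) v t. maxwellian a c v)"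
    by (simp add: cont_L1_def case_prod_unfold)
  have "(\<integral>\<^sup>+(x, v). ennreal (\<bar>maxwellian a c v\<bar> * (norm v)\<^sup>2)
      \<partial>(phase :: ((real^'n) \<times> (real^'n)) measure)) \<le> ?I * ?E"
    by (subst nn_integral_phase_const) (use le(2) in \<open>auto intro!: mult_right_mono nn_integral_mono ennreal_leI\<close>)
  also obtain K where "?I * ?E = ennreal K" using I by (cases "?I * ?E") auto
  finally show "second_moment_bounded T (\<lambda>(x :: real^'n) v t. maxwellian a c v)"
    unfolding second_moment_bounded_def by (auto intro!: exI[of _ K])
qed

text \<open>\<open>phase_time\<close> is the image of the product with (x, t) first under a
  permutation of coordinates. This carries Fubini for signed integrands over to the order in which
  functions of v factor out.\<close>

lemma integral_phase_time:
  fixes F :: "(real^'n) \<times> (real^'n) \<times> real \<Rightarrow> real"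
  assumes F: "integrable (phase_time T) F"
  shows "(\<integral>y. F y \<partial>phase_time T) = (\<integral>v. \<integral>(x, t). F (x, v, t) \<partial>(torus \<Otimes>\<^sub>M time T) \<partial>lborel)"
proof -
  define P where "P z = (fst (fst z), snd z, snd (fst z))" for z :: "((real^'n) \<times> real) \<times> (real^'n)"
  have P: "P \<in> (torus \<Otimes>\<^sub>M time T) \<Otimes>\<^sub>M lborel \<rightarrow>\<^sub>M phase_time T"
    unfolding P_def[abs_def] phase_time_def by measurable
  have D: "phase_time T = distr ((torus \<Otimes>\<^sub>M time T) \<Otimes>\<^sub>M lborel) (phase_time T) P"
  proof (rule measure_eqI)
    fix A assume A: "A \<in> sets (phase_time T :: ((real^'n) \<times> (real^'n) \<times> real) measure)"
    have I: "(indicator A :: _ \<Rightarrow> ennreal) \<in> borel_measurable (phase_time T)" using A by simp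
    have "emeasure (phase_time T) A = (\<integral>\<^sup>+y. indicator A y \<partial>phase_time T)" using A by simp
    also have "\<dots> = (\<integral>\<^sup>+y. \<integral>\<^sup>+v. indicator A (P (y, v)) \<partial>lborel \<partial>(torus \<Otimes>\<^sub>M time T))"
      unfolding nn_integral_phase_time(1)[OF I] by (simp add: P_def case_prod_unfold)
    also have "\<dots> = (\<integral>\<^sup>+z. indicator A (P z) \<partial>((torus \<Otimes>\<^sub>M time T) \<Otimes>\<^sub>M lborel))"
      using measurable_compose[OF P I] by (intro lborel.nn_integral_fst)
    also have "\<dots> = (\<integral>\<^sup>+y. indicator A y \<partial>distr ((torus \<Otimes>\<^sub>M time T) \<Otimes>\<^sub>M lborel) (phase_time T) P)"
      by (rule nn_integral_distr[OF P, symmetric]) (use A in simp)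
    also have "\<dots> = emeasure (distr ((torus \<Otimes>\<^sub>M time T) \<Otimes>\<^sub>M lborel) (phase_time T) P) A" using A by simp
    finally show "emeasure (phase_time T) A
        = emeasure (distr ((torus \<Otimes>\<^sub>M time T) \<Otimes>\<^sub>M lborel) (phase_time T) P) A" .
  qed simp
  have Fm: "F \<in> borel_measurable (phase_time T)" using F by simp
  have int: "integrable ((torus \<Otimes>\<^sub>M time T) \<Otimes>\<^sub>M lborel) (case_prod (\<lambda>y v. F (P (y, v))))"
    using F unfolding integrable_distr_eq[OF P Fm, folded D] by (simp add: case_prod_unfold)
  have "(\<integral>y. F y \<partial>phase_time T) = (\<integral>z. F (P z) \<partial>((torus \<Otimes>\<^sub>M time T) \<Otimes>\<^sub>M lborel))"
    by (subst D) (rule integral_distr[OF P Fm])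
  also have "\<dots> = (\<integral>v. \<integral>y. F (P (y, v)) \<partial>(torus \<Otimes>\<^sub>M time T) \<partial>lborel)"
    using TT_lborel.integral_snd[OF int] by (simp add: case_prod_unfold)
  finally show ?thesis by (simp add: P_def case_prod_unfold)
qed

section \<open>Integration of periodic derivatives over the torus\<close>

lemma finite_measure_torus_time: "finite_measure (torus \<Otimes>\<^sub>M time T)"
  by (intro finite_measure_pair_measure finite_measure_torus finite_measure_time)

lemma torus_subset_cbox: "space (torus :: (real^'n) measure) \<subseteq> cbox 0 1"
  by (auto simp: space_torus mem_box_cart less_imp_le)

lemma integrable_continuous_torus_time:
  fixes g :: "(real^'n) \<times> real \<Rightarrow> real"
  assumes g: "continuous_on UNIV g"
  shows "integrable (torus \<Otimes>\<^sub>M time T) g"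
proof -
  have "bounded (g ` (cbox 0 1 \<times> {0..T}))"
    by (intro compact_imp_bounded compact_continuous_image compact_Times compact_cbox compact_Icc)
      (rule continuous_on_subset[OF g], simp)
  then obtain C where C: "\<forall>y\<in>cbox 0 1 \<times> {0..T}. \<bar>g y\<bar> \<le> C" unfolding bounded_iff by auto
  have gm: "g \<in> borel_measurable borel" using g by (rule borel_measurable_continuous_onI)
  have "(\<lambda>z. (fst z, snd z)) \<in> torus \<Otimes>\<^sub>M time T \<rightarrow>\<^sub>M borel \<Otimes>\<^sub>M borel"
    using measurable_compose[OF measurable_fst measurable_ident_torus, of "time T"]
      measurable_compose[OF measurable_snd measurable_ident_time, of torus T]
    by (intro measurable_Pair) simp_all
  then have "(\<lambda>z. z) \<in> torus \<Otimes>\<^sub>M time T \<rightarrow>\<^sub>M (borel :: ((real^'n) \<times> real) measure)"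
    by (simp add: borel_prod)
  from measurable_compose[OF this gm] have m: "g \<in> borel_measurable (torus \<Otimes>\<^sub>M time T)" by simp
  show ?thesis
  proof (rule finite_measure.integrable_const_bound[OF finite_measure_torus_time _ m])
    show "AE y in torus \<Otimes>\<^sub>M time T. norm (g y) \<le> C"
      using C torus_subset_cbox[where 'n = 'n]
        by (intro AE_I2) (auto simp: space_pair_measure space_time)
  qed
qed

lemma integral_time_derivative:
  fixes G g :: "real \<Rightarrow> real"
  assumes "0 \<le> T" and G: "\<And>t. (G has_real_derivative g t) (at t)" and g: "continuous_on UNIV g"
  shows "(\<integral>t. g t \<partial>time T) = G T - G 0"
proof -
  have "(\<integral>t. g t \<partial>time T) = (\<integral>t. indicator {0..T} t *\<^sub>R g t \<partial>lborel)"
    unfolding time_def by (subst integral_restrict_space) auto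
  also have "\<dots> = G T - G 0"
    using assms(1) G continuous_on_subset[OF g]
    by (intro integral_FTC_atLeastAtMost) (auto intro: has_vector_derivative_at_within simp:
      has_real_derivative_iff_has_vector_derivative)
  finally show ?thesis .
qed

lemma integral_lborel_translate:
  fixes g :: "'a::euclidean_space \<Rightarrow> real"
  assumes "g \<in> borel_measurable borel"
  shows "(\<integral>x. g (c + x) \<partial>lborel) = (\<integral>x. g x \<partial>lborel)"
proof -
  have "(\<integral>x. g x \<partial>lborel) = (\<integral>x. g x \<partial>(distr lborel borel ((+) c)))"
    by (simp add: lborel_distr_plus)
  also have "\<dots> = (\<integral>x. g (c + x) \<partial>lborel)" by (rule integral_distr) (use assms in auto)
  finally show ?thesis ..
qed

lemma integral_torus:
  "(\<integral>x. g x \<partial>torus) = (\<integral>x. indicator {x :: real^'n. \<forall>i. 0 \<le> x $ i \<and> x $ i < 1} x * g x \<partial>lborel)"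
  for g :: "real^'n \<Rightarrow> real"
  unfolding torus_def by (subst integral_restrict_space) auto

lemma integrable_continuous_on_cube_part:
  fixes g :: "real^'n \<Rightarrow> real"
  assumes g: "continuous_on UNIV g" and [measurable]: "S \<in> sets borel" and S: "S \<subseteq> cbox 0 1"
  shows "integrable lborel (\<lambda>x. indicator S x * g x)"
proof -
  have "integrable lborel (\<lambda>x. indicator (cbox 0 1) x *\<^sub>R g x)"
    by (rule borel_integrable_compact[OF compact_cbox continuous_on_subset[OF g]]) simp
  from integrable_mult_indicator[OF _ this, of S] show ?thesis
    by (rule Bochner_Integration.integrable_cong[THEN iffD1, rotated 2]) (use S in \<open>auto split: split_indicator\<close>)
qed

text \<open>
  The cube shifted by \<open>s\<close> along a coordinate axis, \<open>0 \<le> s \<le> 1\<close>, is cut into two pieces; the one sticking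
  out is moved back by a period.
\<close>

lemma integral_torus_shift:
  fixes g :: "real^'n \<Rightarrow> real"
  assumes g: "continuous_on UNIV g" and per: "\<And>x. g (x + axis i 1) = g x" and s: "0 \<le> s" "s \<le> 1"
  shows "(\<integral>x. g (x + s *\<^sub>R axis i 1) \<partial>torus) = (\<integral>x. g x \<partial>torus)"
proof -
  let ?C = "{x :: real^'n. \<forall>i. 0 \<le> x $ i \<and> x $ i < 1}"
  let ?e = "axis i 1 :: real^'n"
  define P where "P = {x \<in> ?C. s \<le> x $ i}"
  define Q where "Q = {x \<in> ?C. x $ i < s}"
  have [measurable]: "g \<in> borel_measurable borel" using g by (rule borel_measurable_continuous_onI)
  have [measurable]: "(\<lambda>x :: real^'n. x $ i) \<in> borel_measurable borel"
    by (intro borel_measurable_continuous_onI continuous_intros)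
  have [measurable]: "P \<in> sets borel" "Q \<in> sets borel" unfolding P_def Q_def by measurable
  have PQ: "P \<subseteq> cbox 0 1" "Q \<subseteq> cbox 0 1" by (auto simp: P_def Q_def mem_box_cart less_imp_le)
  have nth: "(s *\<^sub>R ?e + x) $ j = (if j = i then s + x $ j else x $ j)"
    "(- ?e + x) $ j = (if j = i then x $ j - 1 else x $ j)" for x j s
    by (simp_all add: axis_def)
  have split: "indicator ?C x = (indicator P (s *\<^sub>R ?e + x)
      + indicator Q (- ?e + (s *\<^sub>R ?e + x)) :: real)" for x
  proof -
    let ?R = "\<forall>j. j \<noteq> i \<longrightarrow> 0 \<le> x $ j \<and> x $ j < 1"
    have C: "x \<in> ?C \<longleftrightarrow> ?R \<and> 0 \<le> x $ i \<and> x $ i < 1" by auto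
    have p: "s *\<^sub>R ?e + x \<in> P \<longleftrightarrow> ?R \<and> 0 \<le> x $ i \<and> x $ i < 1 - s"
      unfolding P_def mem_Collect_eq nth using s by (auto split: if_splits)
    have q: "- ?e + (s *\<^sub>R ?e + x) \<in> Q \<longleftrightarrow> ?R \<and> 1 - s \<le> x $ i \<and> x $ i < 1"
      unfolding Q_def mem_Collect_eq nth using s by (auto split: if_splits)
    show ?thesis
      unfolding indicator_def C p q using s by auto
  qed
  let ?k = "\<lambda>y. (indicator P y + indicator Q (- ?e + y)) * g y"
  have "(\<integral>x. g (x + s *\<^sub>R ?e) \<partial>torus) = (\<integral>x. indicator ?C x * g (s *\<^sub>R ?e + x) \<partial>lborel)"
    by (simp add: integral_torus add.commute)
  also have "\<dots> = (\<integral>x. ?k (s *\<^sub>R ?e + x) \<partial>lborel)" by (simp only: split)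
  also have "\<dots> = (\<integral>y. ?k y \<partial>lborel)" by (rule integral_lborel_translate) measurable
  also have "\<dots> = (\<integral>y. indicator P y * g y + indicator Q (- ?e + y) * g (- ?e + y) \<partial>lborel)"
    using per[of "- ?e + _"] by (simp add: distrib_right)
  also have "\<dots> = (\<integral>y. indicator P y * g y \<partial>lborel)
      + (\<integral>y. indicator Q (- ?e + y) * g (- ?e + y) \<partial>lborel)"
  proof (rule Bochner_Integration.integral_add)
    show "integrable lborel (\<lambda>y. indicator P y * g y)"
      by (rule integrable_continuous_on_cube_part[OF g _ PQ(1)]) measurable
    have "integrable (distr lborel borel ((+) (- ?e))) (\<lambda>y. indicator Q y * g y)"
      unfolding lborel_distr_plus by (rule integrable_continuous_on_cube_part[OF g _ PQ(2)]) measurable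
    then show "integrable lborel (\<lambda>y. indicator Q (- ?e + y) * g (- ?e + y))"
      by (subst (asm) integrable_distr_eq) auto
  qed
  also have "(\<integral>y. indicator Q (- ?e + y) * g (- ?e + y) \<partial>lborel) = (\<integral>y. indicator Q y * g y \<partial>lborel)"
    by (rule integral_lborel_translate) measurable
  also have "(\<integral>y. indicator P y * g y \<partial>lborel) + (\<integral>y. indicator Q y * g y \<partial>lborel)
      = (\<integral>y. indicator P y * g y + indicator Q y * g y \<partial>lborel)"
    by (rule Bochner_Integration.integral_add[symmetric]; rule integrable_continuous_on_cube_part[OF
      g]) (auto simp: PQ)
  also have "\<dots> = (\<integral>x. indicator ?C x * g x \<partial>lborel)"
    by (intro Bochner_Integration.integral_cong) (auto simp: P_def Q_def split: split_indicator)
  finally show ?thesis by (simp add: integral_torus)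
qed

text \<open>Averaging over shifts s in [0, 1] along the axis does not change the integral, by
  periodicity of g; after the integrals are interchanged, the inner one is G(x + e) - G(x) = 0. This
  avoids splitting off the i-th coordinate.\<close>

lemma integral_torus_derivative:
  fixes G g :: "real^'n \<Rightarrow> real"
  assumes g: "continuous_on UNIV g"
    and G: "\<And>x s. ((\<lambda>s. G (x + s *\<^sub>R axis i 1)) has_real_derivative g (x + s *\<^sub>R axis i 1)) (at s)"
    and perG: "\<And>x. G (x + axis i 1) = G x" and perg: "\<And>x. g (x + axis i 1) = g x"
  shows "(\<integral>x. g x \<partial>torus) = 0"
proof -
  let ?e = "axis i 1 :: real^'n"
  have c: "continuous_on UNIV (\<lambda>z :: (real^'n) \<times> real. g (fst z + snd z *\<^sub>R ?e))"
    by (intro continuous_on_compose2[OF g] continuous_intros) auto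
  have "(\<integral>s. (\<integral>x. g x \<partial>torus) \<partial>time 1) = (\<integral>s. \<integral>x. g (x + s *\<^sub>R ?e) \<partial>torus \<partial>time 1)"
    by (intro Bochner_Integration.integral_cong refl integral_torus_shift[symmetric] g perg)
      (auto simp: space_time)
  also have "\<dots> = (\<integral>x. \<integral>s. g (x + s *\<^sub>R ?e) \<partial>time 1 \<partial>torus)"
    using integrable_continuous_torus_time[OF c, of 1]
    by (intro torus_time.Fubini_integral[where f =
      "\<lambda>x s. g (x + s *\<^sub>R ?e)"]) (simp add: case_prod_unfold)
  also have "\<dots> = (\<integral>x. G (x + 1 *\<^sub>R ?e) - G (x + 0 *\<^sub>R ?e) \<partial>torus)"
    by (intro Bochner_Integration.integral_cong refl integral_time_derivative G
      continuous_on_compose2[OF g] continuous_intros) auto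
  also have "\<dots> = 0" by (simp add: perG)
  finally show ?thesis by (simp add: measure_def emeasure_time)
qed

lemma test_xvt_partials:
  fixes \<phi> :: "(real^'n) \<times> (real^'n) \<times> real \<Rightarrow> real"
  assumes \<phi>: "test_xvt T \<phi>"
  shows "\<phi> differentiable (at y)"
    and "continuous_on UNIV (\<lambda>y. frechet_derivative \<phi> (at y) (axis i 1, 0, 0))"
    and "continuous_on UNIV (\<lambda>y. frechet_derivative \<phi> (at y) (0, 0, 1))"
proof -
  have "C_k (Suc 0) \<phi>" using \<phi> by (auto simp: test_xvt_def C_infinity_def simp del: C_k.simps)
  then have dc: "(\<forall>y. \<phi> differentiable (at y)) \<and>
      (\<forall>b\<in>Basis. continuous_on UNIV (\<lambda>y. frechet_derivative \<phi> (at y) b))"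
    unfolding C_k.simps .
  then have c: "\<And>b. b \<in> Basis \<Longrightarrow> continuous_on UNIV (\<lambda>y. frechet_derivative \<phi> (at y) b)" by blast
  show "\<phi> differentiable (at y)" using dc by blast
  show "continuous_on UNIV (\<lambda>y. frechet_derivative \<phi> (at y) (axis i 1, 0, 0))"
  proof (rule c)
    have "(axis i 1, 0) \<in> (Basis :: ((real^'n) \<times> (real^'n) \<times> real) set)"
      unfolding Basis_prod_def by (intro UnI1 imageI) (simp add: axis_in_Basis_iff)
    then show "(axis i 1, 0, 0) \<in> (Basis :: ((real^'n) \<times> (real^'n) \<times> real) set)"
      by (simp add: zero_prod_def)
  qed
  show "continuous_on UNIV (\<lambda>y. frechet_derivative \<phi> (at y) (0, 0, 1))"
    by (rule c) (auto simp: Basis_prod_def)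
qed

lemma frechet_derivative_line:
  fixes \<phi> :: "'a::euclidean_space \<Rightarrow> real"
  assumes "\<phi> differentiable (at (y + s *\<^sub>R e))"
  shows "((\<lambda>s. \<phi> (y + s *\<^sub>R e)) has_real_derivative frechet_derivative \<phi> (at (y + s *\<^sub>R e)) e) (at s)"
proof -
  have d: "(\<phi> has_derivative frechet_derivative \<phi> (at (y + s *\<^sub>R e))) (at (y + s *\<^sub>R e))"
    using assms by (simp add: frechet_derivative_works)
  have "((\<lambda>s. y + s *\<^sub>R e) has_derivative (\<lambda>h. h *\<^sub>R e)) (at s)"
    by (auto intro!: derivative_eq_intros)
  from has_derivative_compose[OF this d]
  have "((\<lambda>s. \<phi> (y + s *\<^sub>R e)) has_derivative (\<lambda>h. frechet_derivative \<phi> (at (y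
      + s *\<^sub>R e)) (h *\<^sub>R e))) (at s)" .
  moreover have "frechet_derivative \<phi> (at (y + s *\<^sub>R e)) (h *\<^sub>R e)
      = frechet_derivative \<phi> (at (y + s *\<^sub>R e)) e * h" for h
    using linear_frechet_derivative[OF assms] by (simp add: linear_scale)
  ultimately show ?thesis by (simp add: has_field_derivative_def)
qed

text \<open>At fixed v the direction (v, 0, 1) is a combination of coordinate directions with
  constant coefficients. The spatial derivatives integrate to 0 by periodicity, the time derivative
  because the test function vanishes at 0 and T.\<close>

lemma integral_transport_derivative:
  fixes \<phi> :: "(real^'n) \<times> (real^'n) \<times> real \<Rightarrow> real"
  assumes T: "0 \<le> T" and \<phi>: "test_xvt T \<phi>"
  shows "(\<integral>(x, t). frechet_derivative \<phi> (at (x, v, t)) (v, 0, 1) \<partial>(torus \<Otimes>\<^sub>M time T)) = 0"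
proof -
  define D where "D y = frechet_derivative \<phi> (at y)" for y
  note diff = test_xvt_partials(1)[OF \<phi>]
  have per: "\<phi> (x + axis i 1, v, t) = \<phi> (x, v, t)" for i x v t using \<phi> by (auto simp: test_xvt_def)
  obtain R \<delta> where \<delta>: "0 < \<delta>" "\<And>x v t. \<phi> (x, v, t) \<noteq> 0 \<Longrightarrow> norm v \<le> R \<and> t \<in> {\<delta>..T - \<delta>}"
    using \<phi> unfolding test_xvt_def by blast
  have perD: "D (x + axis i 1, v, t) = D (x, v, t)" for i x v t
  proof -
    have sh: "\<phi> = (\<lambda>y. \<phi> ((axis i 1, 0, 0) + y))" using per by (auto simp: add.commute)
    have "(\<phi> has_derivative D ((axis i 1, 0, 0) + (x, v, t))) (at ((axis i 1, 0, 0) + (x, v, t)))"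
      using diff by (simp add: D_def frechet_derivative_works)
    moreover have "((\<lambda>y. (axis i 1, 0, 0) + y) has_derivative (\<lambda>h. h)) (at (x, v, t))"
      by (auto intro!: derivative_eq_intros)
    ultimately have "((\<lambda>y. \<phi> ((axis i 1, 0, 0) + y)) has_derivative D ((axis i 1, 0, 0)
        + (x, v, t))) (at (x, v, t))"
      using has_derivative_compose by fastforce
    then have "(\<phi> has_derivative D ((axis i 1, 0, 0) + (x, v, t))) (at (x, v, t))" by (simp flip: sh)
    then have "D (x, v, t) = D ((axis i 1, 0, 0) + (x, v, t))"
      unfolding D_def by (rule frechet_derivative_at[symmetric])
    then show ?thesis by (simp add: add.commute)
  qed
  have cx: "continuous_on UNIV (\<lambda>(x, t). D (x, v, t) (axis i 1, 0, 0))" for i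
    unfolding D_def case_prod_unfold
    by (rule continuous_on_compose2[OF test_xvt_partials(2)[OF \<phi>]]) (auto intro!: continuous_intros)
  have ct: "continuous_on UNIV (\<lambda>(x, t). D (x, v, t) (0, 0, 1))"
    unfolding D_def case_prod_unfold
    by (rule continuous_on_compose2[OF test_xvt_partials(3)[OF \<phi>]]) (auto intro!: continuous_intros)
  have 1: "(\<integral>(x, t). D (x, v, t) (axis i 1, 0, 0) \<partial>(torus \<Otimes>\<^sub>M time T)) = 0" for i
  proof -
    have "(\<integral>(x, t). D (x, v, t) (axis i 1, 0, 0) \<partial>(torus \<Otimes>\<^sub>M time T))
        = (\<integral>t. \<integral>x. D (x, v, t) (axis i 1, 0, 0) \<partial>torus \<partial>time T)"
      by (rule torus_time.integral_snd[OF integrable_continuous_torus_time[OF cx], symmetric])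
    also have "\<dots> = (\<integral>t. 0 \<partial>time T)"
    proof (intro Bochner_Integration.integral_cong refl)
      fix t
      show "(\<integral>x. D (x, v, t) (axis i 1, 0, 0) \<partial>torus) = 0"
      proof (rule integral_torus_derivative[where G = "\<lambda>x. \<phi> (x, v, t)" and i = i])
        show "continuous_on UNIV (\<lambda>x. D (x, v, t) (axis i 1, 0, 0))"
          by (rule continuous_on_compose2[OF cx[of i], of UNIV
            "\<lambda>x. (x, t)", simplified]) (intro continuous_intros)
        fix x s
        show "((\<lambda>s. \<phi> (x + s *\<^sub>R axis i 1, v, t)) has_real_derivative D (x
            + s *\<^sub>R axis i 1, v, t) (axis i 1, 0, 0)) (at s)"
          using frechet_derivative_line[of \<phi> "(x, v, t)" s "(axis i 1, 0, 0)"] diff by (simp add: D_def)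
      qed (simp_all add: per perD)
    qed
    finally show ?thesis by simp
  qed
  have 2: "(\<integral>(x, t). D (x, v, t) (0, 0, 1) \<partial>(torus \<Otimes>\<^sub>M time T)) = 0"
  proof -
    have "(\<integral>(x, t). D (x, v, t) (0, 0, 1) \<partial>(torus \<Otimes>\<^sub>M time T))
        = (\<integral>x. \<integral>t. D (x, v, t) (0, 0, 1) \<partial>time T \<partial>torus)"
      by (rule torus_time.integral_fst'[OF integrable_continuous_torus_time[OF ct], symmetric,
        simplified])
    also have "\<dots> = (\<integral>x. \<phi> (x, v, T) - \<phi> (x, v, 0) \<partial>torus)"
    proof (intro Bochner_Integration.integral_cong refl integral_time_derivative T)
      fix x t
      show "((\<lambda>t. \<phi> (x, v, t)) has_real_derivative D (x, v, t) (0, 0, 1)) (at t)"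
        using frechet_derivative_line[of \<phi> "(x, v, 0)" t "(0, 0, 1)"] diff by (simp add: D_def)
      show "continuous_on UNIV (\<lambda>t. D (x, v, t) (0, 0, 1))"
        by (rule continuous_on_compose2[OF ct, of UNIV
          "\<lambda>t. (x, t)", simplified]) (intro continuous_intros)
    qed
    also have "\<dots> = (\<integral>x. 0 \<partial>(torus :: (real^'n) measure))"
      using \<delta> by (intro Bochner_Integration.integral_cong refl) (metis atLeastAtMost_iff diff_0_right
        diff_self le_diff_eq not_le less_add_same_cancel1 add_le_same_cancel1)
    finally show ?thesis by simp
  qed
  have lin: "D y (v, 0, 1) = (\<Sum>i\<in>UNIV. v $ i * D y (axis i 1, 0, 0)) + D y (0, 0, 1)" for y
  proof -
    have l: "linear (D y)" unfolding D_def by (rule linear_frechet_derivative[OF diff])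
    have "(v, 0, 1) = (\<Sum>i\<in>UNIV. v $ i *\<^sub>R (axis i 1, 0, 0)) + (0, 0, 1 :: real)"
    proof -
      have "v = (\<Sum>i\<in>UNIV. v $ i *\<^sub>R axis i 1)"
        using basis_expansion[of v] by (simp add: scalar_mult_eq_scaleR)
      then show ?thesis by (simp add: prod_eq_iff fst_sum snd_sum)
    qed
    then have "D y (v, 0, 1) = D y ((\<Sum>i\<in>UNIV. v $ i *\<^sub>R (axis i 1, 0, 0)) + (0, 0, 1))"
      by (rule arg_cong[of _ _ "D y"])
    also have "\<dots> = (\<Sum>i\<in>UNIV. v $ i * D y (axis i 1, 0, 0)) + D y (0, 0, 1)"
      by (simp only: linear_add[OF l] linear_sum[OF l] linear_scale[OF l] real_scaleR_def)
    finally show ?thesis .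
  qed
  have "(\<integral>(x, t). D (x, v, t) (v, 0, 1) \<partial>(torus \<Otimes>\<^sub>M time T))
    = (\<integral>z. (\<Sum>i\<in>UNIV. v $ i * (case z of (x, t) \<Rightarrow> D (x, v, t) (axis i 1, 0, 0)))
        + (case z of (x, t) \<Rightarrow> D (x, v, t) (0, 0, 1)) \<partial>(torus \<Otimes>\<^sub>M time T))"
    by (intro Bochner_Integration.integral_cong refl) (simp add: lin case_prod_unfold)
  also have "\<dots> = (\<Sum>i\<in>UNIV. v $ i * (\<integral>(x, t). D (x, v, t) (axis i 1, 0, 0) \<partial>(torus \<Otimes>\<^sub>M time T)))
      + (\<integral>(x, t). D (x, v, t) (0, 0, 1) \<partial>(torus \<Otimes>\<^sub>M time T))"
    using integrable_continuous_torus_time[OF cx] integrable_continuous_torus_time[OF ct]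
    by (subst Bochner_Integration.integral_add) (auto simp: Bochner_Integration.integral_sum)
  also have "\<dots> = 0" by (simp add: 1 2)
  finally show ?thesis by (simp add: D_def)
qed

text \<open>A function of v alone factors out of the (x, t)-integral. If the product is not
  integrable, its Bochner integral is 0 by convention, so g may be arbitrary.\<close>

lemma transport_eq_stationary:
  fixes g :: "real^'n \<Rightarrow> real"
  assumes T: "0 \<le> T"
  shows "transport_eq T (\<lambda>x v t. g v) (\<lambda>x v t. 0)"
  unfolding transport_eq_def
proof (intro allI impI)
  fix \<phi> :: "(real^'n) \<times> (real^'n) \<times> real \<Rightarrow> real" assume \<phi>: "test_xvt T \<phi>"
  let ?F = "\<lambda>(x, v, t). g v * frechet_derivative \<phi> (at (x, v, t)) (v, 0, 1)"
  have "(\<integral>y. ?F y \<partial>phase_time T) = 0"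
  proof (cases "integrable (phase_time T) ?F")
    case True
    have "(\<integral>y. ?F y \<partial>phase_time T) = (\<integral>v. \<integral>(x, t). g v * frechet_derivative \<phi> (at (x, v, t)) (v, 0, 1)
        \<partial>(torus \<Otimes>\<^sub>M time T) \<partial>lborel)"
      using integral_phase_time[OF True] by simp
    also have "\<dots> = (\<integral>v. g v * (\<integral>(x, t). frechet_derivative \<phi> (at (x, v, t)) (v, 0, 1)
        \<partial>(torus \<Otimes>\<^sub>M time T)) \<partial>lborel)"
      by (simp add: case_prod_unfold)
    also have "\<dots> = 0" by (simp add: integral_transport_derivative[OF T \<phi>])
    finally show ?thesis .
  qed (rule not_integrable_integral_eq)
  then show "- (\<integral>(x, v, t). g v * frechet_derivative \<phi> (at (x, v, t)) (v, 0, 1) \<partial>phase_time T)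
      = (\<integral>(x, v, t). 0 * \<phi> (x, v, t) \<partial>phase_time T)"
    by (simp add: case_prod_unfold)
qed

section \<open>The two comparison functions\<close>

context hard_potential
begin

lemma sufficiently_regular_maxwellian:
  assumes "0 < a" "0 \<le> T"
  shows "sufficiently_regular B \<beta> T (\<lambda>x v t. maxwellian a c v) (\<lambda>x v t. 0)"
  unfolding sufficiently_regular_def
  using maxwellian_cont_L1[OF assms(1), where 'n = 'n] transport_eq_stationary[OF assms(2)]
    Q_maxwellian_regular[OF assms(1)]
  by (auto simp: case_prod_unfold)

lemma sufficiently_regular_zero:
  assumes "0 \<le> T"
  shows "sufficiently_regular B \<beta> T (\<lambda>x v t. 0) (\<lambda>x v t. 0)"
proof -
  have conv: "AE (x, v, t) in phase_time T. Q_converges B \<beta> (\<lambda>u. f x u t) (\<lambda>u. \<bar>0\<bar>) v"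
    if "cont_L1 T f \<and> second_moment_bounded T f" for f :: "real^'n \<Rightarrow> real^'n \<Rightarrow> real \<Rightarrow> real"
  proof -
    \<comment> \<open>Convergence of the loss factor does not involve the second argument, so it can
      be read off from any Maxwellian; the gain integrand is 0.\<close>
    have "AE (x, v, t) in phase_time T. Q_converges B \<beta> (\<lambda>u. f x u t) (maxwellian 1 0) v"
      using that by (intro Q_maxwellian_regular) auto
    then show ?thesis
      by (auto simp: Q_converges_def gain_integrand_def case_prod_unfold elim: eventually_mono)
  qed
  have z: "Q_plus B f (\<lambda>u. 0) v = 0" "Q_minus \<beta> f (\<lambda>u. 0) v = 0" for f v
    by (simp_all add: Q_plus_def Q_minus_def gain_integrand_def case_prod_unfold)
  show ?thesis
    unfolding sufficiently_regular_def
    using transport_eq_stationary[OF assms, of "\<lambda>_. 0"] conv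
    by (auto simp: z cont_L1_def second_moment_bounded_def case_prod_unfold intro!: exI[of _ 0])
qed

end

section \<open>Test functions of time\<close>

text \<open>With x = 1/t, differentiation in t is -x^2 d/dx, so p(x) e^(-x) becomes x^2 (p(x) -
  p'(x)) e^(-x); the factor \<open>[:0, 0, 1:]\<close> is x^2.\<close>

fun flat_poly :: "nat \<Rightarrow> real poly" where
  "flat_poly 0 = 1"
| "flat_poly (Suc n) = [:0, 0, 1:] * (flat_poly n - pderiv (flat_poly n))"

text \<open>The \<open>n\<close>-th derivative of the function equal to \<open>exp (-1/t)\<close> for \<open>t > 0\<close> and to \<open>0\<close> for \<open>t \<le> 0\<close>.\<close>

definition flat :: "nat \<Rightarrow> real \<Rightarrow> real" where
  "flat n t = (if 0 < t then poly (flat_poly n) (inverse t) * exp (- inverse t) else 0)"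

lemma poly_over_exp_tendsto_0: "((\<lambda>x::real. poly p x * exp (- x)) \<longlongrightarrow> 0) at_top"
proof -
  have "((\<lambda>x::real. \<Sum>i\<le>degree p. coeff p i * (x ^ i / exp x)) \<longlongrightarrow> (\<Sum>i\<le>degree p. coeff p i * 0)) at_top"
    by (intro tendsto_sum tendsto_mult_left tendsto_power_div_exp_0)
  then show ?thesis
    by (simp add: poly_altdef sum_distrib_right exp_minus divide_inverse mult.assoc)
qed

lemma flat_derivative: "(flat n has_real_derivative flat (Suc n) t) (at t)"
proof -
  consider "0 < t" | "t < 0" | "t = 0" by linarith
  then show ?thesis
  proof cases
    case 1
    have "((\<lambda>t. poly (flat_poly n) (inverse t)
        * exp (- inverse t)) has_real_derivative flat (Suc n) t) (at t)"
      using 1 by (auto intro!: derivative_eq_intros poly_DERIV[THEN DERIV_chain2]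
          simp: flat_def algebra_simps power2_eq_square)
    then show ?thesis
      by (rule has_field_derivative_transform_within_open[where S =
        "{0<..}"]) (use 1 in \<open>auto simp: flat_def\<close>)
  next
    case 2
    have "((\<lambda>t. 0) has_real_derivative flat (Suc n) t) (at t)" using 2 by (simp add: flat_def)
    then show ?thesis
      by (rule has_field_derivative_transform_within_open[where S =
        "{..<0}"]) (use 2 in \<open>auto simp: flat_def\<close>)
  next
    case 3
    \<comment> \<open>Dividing by h multiplies the polynomial in 1/h by one more power, hence
      \<open>pCons 0\<close>, and the exponential still wins.\<close>
    have "((\<lambda>h. flat n h / h) \<longlongrightarrow> 0) (at_right 0)"
    proof (rule Lim_transform_eventually)
      show "((\<lambda>h. poly (pCons 0 (flat_poly n)) (inverse h)
          * exp (- inverse h)) \<longlongrightarrow> 0) (at_right (0::real))"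
        by (rule filterlim_compose[OF poly_over_exp_tendsto_0 filterlim_inverse_at_top_right])
      show "\<forall>\<^sub>F h in at_right 0. poly (pCons 0 (flat_poly n)) (inverse h) * exp (- inverse h)
          = flat n h / h"
        using eventually_at_right_less by eventually_elim (simp add: flat_def divide_inverse)
    qed
    moreover have "((\<lambda>h. flat n h / h) \<longlongrightarrow> 0) (at_left 0)"
      by (rule tendsto_eventually, rule eventually_at_leftI[of "-1"]) (simp_all add: flat_def)
    ultimately have "((\<lambda>h. flat n h / h) \<longlongrightarrow> 0) (at 0)" by (simp add: filterlim_split_at)
    then show ?thesis using 3 by (simp add: DERIV_def flat_def)
  qed
qed

text \<open>A class that contains the bumps supported in [s, s + \<epsilon>] and is closed under
  differentiation, since the product rule yields a difference of members. Smoothness of every order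
  then follows without formulas for higher derivatives.\<close>

inductive_set bump_space :: "real \<Rightarrow> (real \<Rightarrow> real) set" for \<epsilon> :: real where
  basic: "(\<lambda>t. flat i (t - s) * flat j (s + \<epsilon> - t)) \<in> bump_space \<epsilon>"
| diff: "f \<in> bump_space \<epsilon> \<Longrightarrow> g \<in> bump_space \<epsilon> \<Longrightarrow> (\<lambda>t. f t - g t) \<in> bump_space \<epsilon>"

lemma bump_space_derivative:
  assumes "f \<in> bump_space \<epsilon>"
  shows "\<exists>f'\<in>bump_space \<epsilon>. \<forall>t. (f has_real_derivative f' t) (at t)"
  using assms
proof induction
  case (basic i s j)
  show ?case
  proof (rule bexI[OF _ bump_space.diff[OF bump_space.basic[of "Suc i" s j] bump_space.basic[of i s
    "Suc j"]]], rule allI)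
    fix t
    have 1: "((\<lambda>t. flat i (t - s)) has_real_derivative flat (Suc i) (t - s) * 1) (at t)"
      by (rule DERIV_chain2[OF flat_derivative]) (auto intro!: derivative_eq_intros)
    have 2: "((\<lambda>t. flat j (s + \<epsilon> - t)) has_real_derivative flat (Suc j) (s + \<epsilon> - t) * (-1)) (at t)"
      by (rule DERIV_chain2[OF flat_derivative]) (auto intro!: derivative_eq_intros)
    show "((\<lambda>t. flat i (t - s) * flat j (s + \<epsilon> - t)) has_real_derivative
      flat (Suc i) (t - s) * flat j (s + \<epsilon> - t) - flat i (t - s) * flat (Suc j) (s + \<epsilon> - t)) (at t)"
      using DERIV_mult[OF 1 2] by (simp add: algebra_simps)
  qed
next
  case (diff f g)
  then obtain f' g' where "f' \<in> bump_space \<epsilon>" "g' \<in> bump_space \<epsilon>"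
    "\<And>t. (f has_real_derivative f' t) (at t)" "\<And>t. (g has_real_derivative g' t) (at t)" by blast
  then show ?case
    by (intro bexI[of _ "\<lambda>t. f' t - g' t"] allI DERIV_diff bump_space.diff) auto
qed

lemma frechet_derivative_snd:
  fixes g :: "real \<Rightarrow> real" and y :: "'a::real_normed_vector \<times> real"
  assumes "(g has_real_derivative d) (at (snd y))"
  shows "((\<lambda>y. k * g (snd y)) has_derivative (\<lambda>b. k * snd b * d)) (at y)"
    and "frechet_derivative (\<lambda>y. k * g (snd y)) (at y) = (\<lambda>b. k * snd b * d)"
proof -
  have "((\<lambda>y. g (snd y)) has_derivative (\<lambda>b. d * snd b)) (at y)"
    using has_derivative_compose[OF has_derivative_snd[OF has_derivative_ident] assms[unfolded
      has_field_derivative_def]] .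
  then have "((\<lambda>y. k * g (snd y)) has_derivative (\<lambda>b. k * (d * snd b))) (at y)"
    by (rule has_derivative_mult_right)
  then show D: "((\<lambda>y. k * g (snd y)) has_derivative (\<lambda>b. k * snd b * d)) (at y)" by (simp add: mult_ac)
  show "frechet_derivative (\<lambda>y. k * g (snd y)) (at y) = (\<lambda>b. k * snd b * d)"
    by (rule frechet_derivative_at[OF D, symmetric])
qed

text \<open>The derivative of c g(t) along b is g'(t) times c times the time component of b, again
  of the same shape; the free factor c lets the induction run inside S.\<close>

lemma C_k_snd:
  fixes g :: "real \<Rightarrow> real"
  assumes S: "\<And>g. g \<in> S \<Longrightarrow> \<exists>g'\<in>S. \<forall>t. (g has_real_derivative g' t) (at t)" and "g \<in> S"
  shows "C_k k (\<lambda>y :: 'a::euclidean_space \<times> real. c * g (snd y))"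
  using \<open>g \<in> S\<close>
proof (induction k arbitrary: g c)
  case 0
  then obtain g' where "\<And>t. (g has_real_derivative g' t) (at t)" using S by blast
  then have "continuous_on UNIV g" by (meson DERIV_isCont continuous_at_imp_continuous_on)
  then have "continuous_on UNIV (\<lambda>y :: 'a \<times> real. c * g (snd y))"
    by (intro continuous_on_mult continuous_on_const continuous_on_compose2[OF _ continuous_on_snd])
      (auto intro: continuous_on_id)
  then show ?case by simp
next
  case (Suc k)
  then obtain g' where g': "g' \<in> S" "\<And>t. (g has_real_derivative g' t) (at t)" using S by blast
  have D: "((\<lambda>y. c * g (snd y)) has_derivative (\<lambda>b. c * snd b * g' (snd y))) (at y)"
    "frechet_derivative (\<lambda>y. c * g (snd y)) (at y) = (\<lambda>b. c * snd b * g' (snd y))" for y :: "'a \<times> real"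
    by (rule frechet_derivative_snd[OF g'(2)])+
  have "C_k k (\<lambda>y :: 'a \<times> real. c * snd b * g' (snd y))" for b :: "'a \<times> real"
    by (rule Suc.IH[OF g'(1)])
  then show ?case
    unfolding C_k.simps D(2) by (intro conjI allI ballI differentiableI[OF D(1)])
qed

text \<open>\<zeta> is a smoothed indicator of [t1, t2]: it rises by a bump right after t1 and falls
  by the same bump right after t2. Testing with it compares averages near t1 and near t2.\<close>

lemma time_test_function:
  fixes t1 t2 \<epsilon> T :: real
  assumes "0 < t1" "t1 < t2" "0 < \<epsilon>" "t2 + \<epsilon> < T"
  obtains \<zeta> b :: "real \<Rightarrow> real" where "test_xt T (\<lambda>(x :: real^'n, t). \<zeta> t)" "\<And>t. 0 \<le> \<zeta> t"
    "\<And>t. (\<zeta> has_real_derivative b (t - t1) - b (t - t2)) (at t)"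
    "continuous_on UNIV b" "\<And>t. 0 \<le> b t" "\<And>t. b t \<noteq> 0 \<Longrightarrow> 0 < t \<and> t < \<epsilon>"
    "\<zeta> 0 = 0" "\<zeta> T = 0"
    "0 < (\<integral>t. b (t - t1) \<partial>time T)" "(\<integral>t. b (t - t1) \<partial>time T) = (\<integral>t. b (t - t2) \<partial>time T)"
proof -
  define b where "b t = flat 0 t * flat 0 (\<epsilon> - t)" for t
  \<comment> \<open>Starting the primitive at -1 makes every t \<ge> 0 an interior point of the
    interval {-1..t+1} on which it is differentiated; b vanishes on the added part.\<close>
  define A where "A t = integral {-1..t} b" for t
  define \<zeta> where "\<zeta> t = A (t - t1) - A (t - t2)" for t
  have b0: "0 \<le> b t" for t by (simp add: b_def flat_def)
  have bs: "0 < t \<and> t < \<epsilon>" if "b t \<noteq> 0" for t using that by (auto simp: b_def flat_def split: if_splits)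
  have bp: "0 < b t" if "0 < t" "t < \<epsilon>" for t using that by (simp add: b_def flat_def)
  have fc: "continuous_on UNIV (flat 0)"
    using flat_derivative by (meson DERIV_isCont continuous_at_imp_continuous_on)
  have bc: "continuous_on UNIV b"
    unfolding b_def[abs_def] by (intro continuous_intros continuous_on_compose2[OF fc]) auto
  have A0: "A t = 0" if "t \<le> 0" for t
  proof -
    have "integral {-1..t} b = integral {-1..t} (\<lambda>_. 0)"
      using bs that by (intro integral_cong) force
    then show ?thesis by (simp add: A_def)
  qed
  have A': "(A has_real_derivative b t) (at t)" for t
  proof (cases "t < 0")
    case True
    then have "b t = 0" using bs[of t] by auto
    then have "((\<lambda>t. 0) has_real_derivative b t) (at t)" by simp
    then show ?thesis
      by (rule has_field_derivative_transform_within_open[where S = "{..<0}"]) (use True A0 in auto)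
  next
    case False
    have "((\<lambda>x. integral {-1..x} b) has_real_derivative b t) (at t within {-1..t+1})"
      by (rule integral_has_real_derivative[OF continuous_on_subset[OF bc]]) (use False in auto)
    moreover have "at t within {-1..t+1} = at t"
      by (rule at_within_interior) (use False in simp)
    ultimately show ?thesis by (simp add: A_def[abs_def])
  qed
  have Amono: "A x \<le> A y" if "x \<le> y" for x y
    by (rule DERIV_nonneg_imp_nondecreasing[OF that]) (use A' b0 in blast)
  have Aconst: "A t = A \<epsilon>" if "\<epsilon> \<le> t" for t
  proof (rule antisym)
    have "b x \<le> 0" if "\<epsilon> \<le> x" for x using bs[of x] that by (cases "b x = 0") auto
    then show "A t \<le> A \<epsilon>"
      by (intro DERIV_nonpos_imp_nonincreasing[OF that]) (use A' in blast)
  qed (rule Amono[OF that])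
  have Apos: "0 < A \<epsilon>"
  proof -
    have "A (\<epsilon> / 4) < A (\<epsilon> / 2)"
      using assms(3) A' bp by (intro DERIV_pos_imp_increasing[of "\<epsilon> / 4" "\<epsilon> / 2" A]) (force, force)
    moreover have "A (\<epsilon> / 2) \<le> A \<epsilon>" "A 0 \<le> A (\<epsilon> / 4)" using assms(3) by (auto intro!: Amono)
    ultimately show ?thesis using A0[of 0] by simp
  qed
  have A'r: "((\<lambda>t. A (t - r)) has_real_derivative b (t - r)) (at t)" for r t
  proof -
    have "((\<lambda>t. A (t - r)) has_real_derivative b (t - r) * 1) (at t)"
      by (rule DERIV_chain2[OF A']) (auto intro!: derivative_eq_intros)
    then show ?thesis by simp
  qed
  have \<zeta>': "(\<zeta> has_real_derivative b (t - t1) - b (t - t2)) (at t)" for t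
    using DERIV_diff[OF A'r[of t1] A'r[of t2]] by (simp add: \<zeta>_def[abs_def])
  have \<zeta>s: "t1 \<le> t \<and> t \<le> t2 + \<epsilon>" if "\<zeta> t \<noteq> 0" for t
  proof (rule ccontr)
    assume "\<not> (t1 \<le> t \<and> t \<le> t2 + \<epsilon>)"
    then consider "t < t1" | "t2 + \<epsilon> < t" by linarith
    then show False
    proof cases
      case 1
      then show ?thesis using that A0[of "t - t1"] A0[of "t - t2"] assms by (simp add: \<zeta>_def)
    next
      case 2
      then show ?thesis using that Aconst[of "t - t1"] Aconst[of "t - t2"] assms by (simp add: \<zeta>_def)
    qed
  qed
  have int: "(\<integral>t. b (t - r) \<partial>time T) = A \<epsilon>" if "0 < r" "r + \<epsilon> < T" for r
  proof -
    have "(\<integral>t. b (t - r) \<partial>time T) = A (T - r) - A (0 - r)"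
    proof (rule integral_time_derivative[where G = "\<lambda>t. A (t - r)"])
      show "((\<lambda>t. A (t - r)) has_real_derivative b (t - r)) (at t)" for t
        by (rule A'r)
      show "continuous_on UNIV (\<lambda>t. b (t - r))"
        by (intro continuous_on_compose2[OF bc] continuous_intros) auto
    qed (use that assms in simp)
    then show ?thesis using that A0[of "0 - r"] Aconst[of "T - r"] by simp
  qed
  \<comment> \<open>\<zeta> is a primitive and is not obtained as a member of
    \<open>bump_space\<close>, but its derivative is one; hence the inserted element.\<close>
  have smooth: "C_k k (\<lambda>y :: (real^'n) \<times> real. 1 * \<zeta> (snd y))" for k
  proof (rule C_k_snd[where S = "insert \<zeta> (bump_space \<epsilon>)"])
    have "(\<lambda>t. b (t - r)) = (\<lambda>t. flat 0 (t - r) * flat 0 (r + \<epsilon> - t))" for r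
      by (rule ext) (simp add: b_def algebra_simps)
    then have "(\<lambda>t. b (t - r)) \<in> bump_space \<epsilon>" for r by (simp add: bump_space.basic)
    then have d: "(\<lambda>t. b (t - t1) - b (t - t2)) \<in> bump_space \<epsilon>" by (intro bump_space.diff)
    show "\<exists>g'\<in>insert \<zeta> (bump_space \<epsilon>). \<forall>t. (g has_real_derivative g' t) (at t)"
      if "g \<in> insert \<zeta> (bump_space \<epsilon>)" for g
    proof (cases "g \<in> bump_space \<epsilon>")
      case True
      then show ?thesis using bump_space_derivative by blast
    next
      case False
      then have "g = \<zeta>" using that by simp
      then show ?thesis using \<zeta>' d by (intro bexI[OF _ insertI2[OF d]]) simp
    qed
  qed simp
  show ?thesis
  proof (rule that[of \<zeta> b])
    define \<delta> where "\<delta> = min t1 (T - t2 - \<epsilon>)"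
    show "test_xt T (\<lambda>(x :: real^'n, t). \<zeta> t)"
      unfolding test_xt_def C_infinity_def
    proof (intro conjI exI[of _ \<delta>] allI impI)
      show "C_k k (\<lambda>(x :: real^'n, t). \<zeta> t)" for k using smooth by (simp add: case_prod_unfold)
      show "0 < \<delta>" using assms by (simp add: \<delta>_def)
      show "t \<in> {\<delta>..T - \<delta>}" if "(case (x :: real^'n, t) of (x, t) \<Rightarrow> \<zeta> t) \<noteq> 0" for x t
        using \<zeta>s[of t] that by (simp add: \<delta>_def min_def)
    qed simp
    show "0 \<le> \<zeta> t" for t using Amono[of "t - t2" "t - t1"] assms by (simp add: \<zeta>_def)
    show "\<zeta> 0 = 0" using \<zeta>s[of 0] assms by auto
    show "\<zeta> T = 0" using \<zeta>s[of T] assms by auto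
    show "0 < (\<integral>t. b (t - t1) \<partial>time T)" "(\<integral>t. b (t - t1) \<partial>time T) = (\<integral>t. b (t - t2) \<partial>time T)"
      using int[of t1] int[of t2] Apos assms by auto
  qed (use \<zeta>' bc b0 bs in auto)
qed

section \<open>Monotonicity from a weak inequality\<close>

lemma integrable_continuous_time:
  fixes g :: "real \<Rightarrow> real"
  assumes "continuous_on {0..T} g"
  shows "integrable (time T) g"
proof -
  have "integrable lborel (\<lambda>t. indicator {0..T} t *\<^sub>R g t)"
    by (rule borel_integrable_compact[OF compact_Icc assms])
  then show ?thesis unfolding time_def by (subst integrable_restrict_space) auto
qed

text \<open>Against a smoothed indicator of [t1, t2] the weak inequality says that the average of m
  just after t1 is at least its average just after t2; continuity turns averages into values. Test
  functions vanish near 0 and T, so the end points are reached as limits.\<close>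

lemma weakly_nonincreasing:
  fixes m :: "real \<Rightarrow> real"
  assumes T: "0 < T" and m: "continuous_on {0..T} m"
    and weak: "\<And>\<zeta> \<zeta>'. test_xt T (\<lambda>(x :: real^'n, t). \<zeta> t) \<Longrightarrow> (\<And>t. 0 \<le> \<zeta> t) \<Longrightarrow>
      (\<And>t. (\<zeta> has_real_derivative \<zeta>' t) (at t)) \<Longrightarrow> continuous_on UNIV \<zeta>' \<Longrightarrow> \<zeta> 0 = 0 \<Longrightarrow> \<zeta> T = 0 \<Longrightarrow>
      0 \<le> (\<integral>t. m t * \<zeta>' t \<partial>time T)"
    and t: "t \<in> {0..T}"
  shows "m t \<le> m 0"
proof -
  have step: "m t2 \<le> m t1" if t12: "0 < t1" "t1 < t2" "t2 < T" for t1 t2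
  proof (rule ccontr)
    assume "\<not> m t2 \<le> m t1"
    \<comment> \<open>One third of the supposed increase: an error \<eta> at each of the two times
      still leaves a positive gap.\<close>
    define \<eta> where "\<eta> = (m t2 - m t1) / 3"
    have \<eta>: "0 < \<eta>" using \<open>\<not> m t2 \<le> m t1\<close> by (simp add: \<eta>_def)
    obtain d1 where d1: "0 < d1" "\<And>t. t \<in> {0..T} \<Longrightarrow> dist t t1 < d1 \<Longrightarrow> dist (m t) (m t1) < \<eta>"
      using m[unfolded continuous_on_iff, rule_format, of t1 \<eta>] \<eta> t12 by auto
    obtain d2 where d2: "0 < d2" "\<And>t. t \<in> {0..T} \<Longrightarrow> dist t t2 < d2 \<Longrightarrow> dist (m t) (m t2) < \<eta>"
      using m[unfolded continuous_on_iff, rule_format, of t2 \<eta>] \<eta> t12 by auto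
    define \<epsilon> where "\<epsilon> = min (min d1 d2) ((T - t2) / 2)"
    have \<epsilon>: "0 < \<epsilon>" "\<epsilon> \<le> d1" "\<epsilon> \<le> d2" "t2 + \<epsilon> < T" using d1(1) d2(1) t12(3)
      by (auto simp: \<epsilon>_def min_def field_simps)
    obtain \<zeta> b :: "real \<Rightarrow> real" where \<zeta>: "test_xt T (\<lambda>(x :: real^'n, t). \<zeta> t)" "\<And>t. 0 \<le> \<zeta> t"
      "\<And>t. (\<zeta> has_real_derivative b (t - t1) - b (t - t2)) (at t)"
      and b: "continuous_on UNIV b" "\<And>t. 0 \<le> b t" "\<And>t. b t \<noteq> 0 \<Longrightarrow> 0 < t \<and> t < \<epsilon>"
      and \<zeta>0: "\<zeta> 0 = 0" "\<zeta> T = 0"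
      and I: "0 < (\<integral>t. b (t - t1) \<partial>time T)" "(\<integral>t. b (t - t1) \<partial>time T) = (\<integral>t. b (t - t2) \<partial>time T)"
      by (rule time_test_function[OF t12(1,2) \<epsilon>(1,4), where 'n = 'n], rule that)
    have bc: "continuous_on S (\<lambda>t. b (t - r))" for r S
      by (intro continuous_on_compose2[OF b(1)] continuous_intros) auto
    have int: "integrable (time T) (\<lambda>t. b (t - r))" "integrable (time T) (\<lambda>t. m t * b (t - r))" for r
      by (intro integrable_continuous_time continuous_intros m bc)+
    have "0 \<le> (\<integral>t. m t * (b (t - t1) - b (t - t2)) \<partial>time T)"
      by (rule weak[OF \<zeta> _ \<zeta>0]) (intro continuous_intros bc)
    also have "\<dots> = (\<integral>t. m t * b (t - t1) \<partial>time T) - (\<integral>t. m t * b (t - t2) \<partial>time T)"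
      using int by (simp add: right_diff_distrib)
    also have "(\<integral>t. m t * b (t - t1) \<partial>time T) \<le> (\<integral>t. (m t1 + \<eta>) * b (t - t1) \<partial>time T)"
    proof (rule integral_mono[OF int(2) integrable_mult_right[OF int(1)]])
      fix t assume "t \<in> space (time T)"
      show "m t * b (t - t1) \<le> (m t1 + \<eta>) * b (t - t1)"
      proof (cases "b (t - t1) = 0")
        case False
        then have "dist t t1 < d1" using b(3)[of "t - t1"] \<epsilon> by (auto simp: dist_real_def)
        then have "dist (m t) (m t1) < \<eta>" using \<open>t \<in> space (time T)\<close>
          by (intro d1(2)) (simp_all add: space_time)
        then show ?thesis using b(2) by (intro mult_right_mono) (auto simp: dist_real_def)
      qed simp
    qed
    also have "(\<integral>t. (m t1 + \<eta>) * b (t - t1) \<partial>time T) = (m t1 + \<eta>) * (\<integral>t. b (t - t1) \<partial>time T)" by simp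
    finally have 1: "(\<integral>t. m t * b (t - t2) \<partial>time T) \<le> (m t1 + \<eta>) * (\<integral>t. b (t - t1) \<partial>time T)" by simp
    have "(m t2 - \<eta>) * (\<integral>t. b (t - t2) \<partial>time T) = (\<integral>t. (m t2 - \<eta>) * b (t - t2) \<partial>time T)" by simp
    also have "\<dots> \<le> (\<integral>t. m t * b (t - t2) \<partial>time T)"
    proof (rule integral_mono[OF integrable_mult_right[OF int(1)] int(2)])
      fix t assume "t \<in> space (time T)"
      show "(m t2 - \<eta>) * b (t - t2) \<le> m t * b (t - t2)"
      proof (cases "b (t - t2) = 0")
        case False
        then have "dist t t2 < d2" using b(3)[of "t - t2"] \<epsilon> by (auto simp: dist_real_def)
        then have "dist (m t) (m t2) < \<eta>" using \<open>t \<in> space (time T)\<close>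
          by (intro d2(2)) (simp_all add: space_time)
        then show ?thesis using b(2) by (intro mult_right_mono) (auto simp: dist_real_def)
      qed simp
    qed
    finally have "(m t2 - \<eta>) * (\<integral>t. b (t - t1) \<partial>time T) \<le> (m t1 + \<eta>) * (\<integral>t. b (t - t1) \<partial>time T)"
      using 1 I(2) by simp
    then have "m t2 - \<eta> \<le> m t1 + \<eta>" using I(1) by simp
    moreover have "m t2 = m t1 + 3 * \<eta>" by (simp add: \<eta>_def field_simps)
    ultimately show False using \<eta> by linarith
  qed
  have inner: "m r \<le> m 0" if "0 < r" "r < T" for r
  proof (rule tendsto_lowerbound[OF continuous_on_Icc_at_rightD[OF m T]])
    show "\<forall>\<^sub>F s in at_right 0. m r \<le> m s"
      using that by (intro eventually_at_rightI[of 0 r]) (auto intro: step)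
  qed simp
  consider "t = 0" | "0 < t" "t < T" | "t = T" using t by fastforce
  then show ?thesis
  proof cases
    case 3
    have "m T \<le> m 0"
    proof (rule tendsto_upperbound[OF continuous_on_Icc_at_leftD[OF m T]])
      show "\<forall>\<^sub>F s in at_left T. m s \<le> m 0"
        using T by (intro eventually_at_leftI[of 0 T]) (auto intro: inner)
    qed simp
    then show ?thesis using 3 by simp
  qed (auto intro: inner)
qed

text \<open>The bounds on the solution are given for every t and almost every x, whereas the
  dissipativity inequality integrates over (x, t). The exchange rests on joint measurability of the
  exceptional set.\<close>

lemma AE_torus_time:
  assumes P: "Measurable.pred (torus \<Otimes>\<^sub>M time T) (\<lambda>(x :: real^'n, t). P x t)"
    and ae: "\<And>t. t \<in> {0..T} \<Longrightarrow> AE x in torus. P x t"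
  shows "AE (x, t) in torus \<Otimes>\<^sub>M time T. P x t"
proof -
  have S: "{y \<in> space (torus \<Otimes>\<^sub>M time T). P (fst y) (snd y)} \<in> sets (torus \<Otimes>\<^sub>M time T)"
    using P by (simp add: case_prod_unfold)
  have "AE t in time T. AE x in torus. P x t" by (rule AE_I2) (simp add: space_time ae)
  then have "AE x in torus. AE t in time T. P x t" using S by (subst torus_time.AE_commute) auto
  then have "AE y in torus \<Otimes>\<^sub>M time T. P (fst y) (snd y)"
    using S by (intro torus_time.AE_pair_measure) auto
  then show ?thesis by (simp add: case_prod_unfold)
qed

text \<open>The condition for almost all v is rewritten as the vanishing of an integral over v,
  which depends measurably on (x, t).\<close>

lemma AE_torus_time_velocity:
  fixes P :: "real^'n \<Rightarrow> real^'n \<Rightarrow> real \<Rightarrow> bool"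
  assumes P: "Measurable.pred (phase_time T) (\<lambda>(x, v, t). P x v t)"
    and ae: "\<And>t. t \<in> {0..T} \<Longrightarrow> AE x in torus. AE v in lborel. P x v t"
  shows "AE (x, t) in torus \<Otimes>\<^sub>M time T. AE v in lborel. P x v t"
proof -
  define F where "F = (\<lambda>(x, v, t). if P x v t then 0 else 1 :: ennreal)"
  have F: "F \<in> borel_measurable (phase_time T)"
    unfolding F_def case_prod_unfold using P by (simp add: case_prod_unfold)
  have sl: "(\<lambda>v. F (x, v, t)) \<in> borel_measurable lborel" if "x \<in> space torus" "t \<in> {0..T}" for x t
    using phase_time_slice[OF F that] by simp
  have iff: "(\<integral>\<^sup>+v. F (x, v, t) \<partial>lborel) = 0 \<longleftrightarrow> (AE v in lborel. P x v t)"
    if "x \<in> space torus" "t \<in> {0..T}" for x t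
    by (subst nn_integral_0_iff_AE[OF sl[OF that]]) (simp add: F_def)
  have "AE (x, t) in torus \<Otimes>\<^sub>M time T. (\<integral>\<^sup>+v. F (x, v, t) \<partial>lborel) = 0"
  proof (rule AE_torus_time)
    have "(\<lambda>y. \<integral>\<^sup>+v. F (fst y, v, snd y) \<partial>lborel) \<in> borel_measurable (torus \<Otimes>\<^sub>M time T)"
      using lborel.borel_measurable_nn_integral_fst[OF phase_time_permute(1)[OF F]]
        by (simp add: case_prod_unfold)
    then show "Measurable.pred (torus \<Otimes>\<^sub>M time T) (\<lambda>(x, t). (\<integral>\<^sup>+v. F (x, v, t) \<partial>lborel) = 0)"
      unfolding case_prod_unfold by measurable
    fix t assume t: "t \<in> {0..T}"
    show "AE x in torus. (\<integral>\<^sup>+v. F (x, v, t) \<partial>lborel) = 0"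
      using ae[OF t] AE_space by eventually_elim (use iff t in blast)
  qed
  then show ?thesis
    using AE_space by eventually_elim (auto simp: iff space_pair_measure space_time)
qed

text \<open>Brings the left side of the dissipativity inequality into the form of a time integral of
  a phase space integral times the derivative of the test function. The bound C, uniform in t, gives
  integrability in all variables.\<close>

lemma integral_torus_time_velocity:
  fixes H :: "real^'n \<Rightarrow> real^'n \<Rightarrow> real \<Rightarrow> real"
  assumes Hm: "(\<lambda>(x, v, t). H x v t) \<in> borel_measurable (phase_time T)"
    and H: "\<And>t. t \<in> {0..T} \<Longrightarrow> integrable phase (\<lambda>(x, v). H x v t)"
    and C: "\<And>t. t \<in> {0..T} \<Longrightarrow> (\<integral>(x, v). \<bar>H x v t\<bar> \<partial>phase) \<le> C"
    and g: "continuous_on UNIV g"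
  shows "integrable (torus \<Otimes>\<^sub>M time T) (\<lambda>(x, t). (\<integral>v. H x v t \<partial>lborel) * g t)"
    and "(\<integral>(x, t). (\<integral>v. H x v t \<partial>lborel) * g t \<partial>(torus \<Otimes>\<^sub>M time T))
        = (\<integral>t. (\<integral>(x, v). H x v t \<partial>phase) * g t \<partial>time T)"
proof -
  note P = phase_time_permute(1)[OF Hm]
  have int: "integrable ((torus \<Otimes>\<^sub>M time T) \<Otimes>\<^sub>M lborel) (\<lambda>(y, v). H (fst y) v (snd y))"
  proof (rule nn_integral_abs_finite)
    show m: "(\<lambda>(y, v). H (fst y) v (snd y)) \<in> borel_measurable ((torus \<Otimes>\<^sub>M time T) \<Otimes>\<^sub>M lborel)"
      using P by (simp add: case_prod_unfold)
    have Hm': "(\<lambda>y. ennreal \<bar>case y of (x, v, t) \<Rightarrow> H x v t\<bar>) \<in> borel_measurable (phase_time T)"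
      using Hm by measurable
    have "(\<integral>\<^sup>+z. ennreal \<bar>case z of (y, v) \<Rightarrow> H (fst y) v (snd y)\<bar> \<partial>((torus \<Otimes>\<^sub>M time T) \<Otimes>\<^sub>M lborel))
      = (\<integral>\<^sup>+y. \<integral>\<^sup>+v. ennreal \<bar>H (fst y) v (snd y)\<bar> \<partial>lborel \<partial>(torus \<Otimes>\<^sub>M time T))"
      using m by (subst lborel.nn_integral_fst[symmetric]) (auto intro!: measurable_compose[OF _
        measurable_ennreal] borel_measurable_abs)
    also have "\<dots> = (\<integral>\<^sup>+t. \<integral>\<^sup>+(x, v). ennreal \<bar>H x v t\<bar> \<partial>phase \<partial>time T)"
      using nn_integral_phase_time(1)[OF Hm'] nn_integral_phase_time(2)[OF Hm']
        by (simp add: case_prod_unfold)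
    also have "\<dots> \<le> (\<integral>\<^sup>+t. ennreal C \<partial>time T)"
    proof (rule nn_integral_mono)
      fix t assume "t \<in> space (time T)"
      then have t: "t \<in> {0..T}" by (simp add: space_time)
      have "(\<integral>\<^sup>+(x, v). ennreal \<bar>H x v t\<bar> \<partial>phase) = ennreal (\<integral>(x, v). \<bar>H x v t\<bar> \<partial>phase)"
        using integrable_abs[OF H[OF t]] nn_integral_eq_integral[of phase "\<lambda>z. \<bar>H (fst z) (snd z) t\<bar>"]
        by (simp add: case_prod_unfold)
      also have "\<dots> \<le> ennreal C" by (rule ennreal_leI[OF C[OF t]])
      finally show "(\<integral>\<^sup>+(x, v). ennreal \<bar>H x v t\<bar> \<partial>phase) \<le> ennreal C" .
    qed
    also have "\<dots> < \<infinity>" by (simp add: emeasure_time ennreal_mult_less_top)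
    finally show "(\<integral>\<^sup>+z. ennreal \<bar>case z of (y, v) \<Rightarrow> H (fst y) v (snd y)\<bar>
        \<partial>((torus \<Otimes>\<^sub>M time T) \<Otimes>\<^sub>M lborel)) \<noteq> \<infinity>"
      by simp
  qed
  have i1: "integrable (torus \<Otimes>\<^sub>M time T) (\<lambda>y. \<integral>v. H (fst y) v (snd y) \<partial>lborel)"
    using TT_lborel.integrable_fst[OF int] by simp
  obtain D where D: "\<forall>t\<in>{0..T}. \<bar>g t\<bar> \<le> D"
  proof -
    have "bounded (g ` {0..T})"
      by (intro compact_imp_bounded compact_continuous_image continuous_on_subset[OF g]) auto
    then show ?thesis using that unfolding bounded_iff by auto
  qed
  have gm: "(\<lambda>y :: (real^'n) \<times> real. g (snd y)) \<in> borel_measurable (torus \<Otimes>\<^sub>M time T)"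
    by (rule measurable_compose[OF measurable_compose[OF measurable_snd measurable_ident_time]
      borel_measurable_continuous_onI[OF g]])
  have i2: "integrable (torus \<Otimes>\<^sub>M time T) (\<lambda>y. (\<integral>v. H (fst y) v (snd y) \<partial>lborel) * g (snd y))"
  proof (rule Bochner_Integration.integrable_bound)
    show "integrable (torus \<Otimes>\<^sub>M time T) (\<lambda>y. (\<integral>v. H (fst y) v (snd y) \<partial>lborel) * D)" using i1 by simp
    show "AE y in torus \<Otimes>\<^sub>M time T. norm ((\<integral>v. H (fst y) v (snd y) \<partial>lborel) * g (snd y))
        \<le> norm ((\<integral>v. H (fst y) v (snd y) \<partial>lborel) * D)"
    proof (rule AE_I2)
      fix y :: "(real^'n) \<times> real" assume "y \<in> space (torus \<Otimes>\<^sub>M time T)"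
      then have "\<bar>g (snd y)\<bar> \<le> D" using D by (auto simp: space_pair_measure space_time)
      then show "norm ((\<integral>v. H (fst y) v (snd y) \<partial>lborel) * g (snd y))
          \<le> norm ((\<integral>v. H (fst y) v (snd y) \<partial>lborel) * D)"
        by (auto simp: abs_mult intro!: mult_left_mono)
    qed
  qed (use i1 gm in \<open>auto intro!: borel_measurable_times\<close>)
  then show "integrable (torus \<Otimes>\<^sub>M time T) (\<lambda>(x, t). (\<integral>v. H x v t \<partial>lborel) * g t)"
    by (simp add: case_prod_unfold)
  have "(\<integral>(x, t). (\<integral>v. H x v t \<partial>lborel) * g t \<partial>(torus \<Otimes>\<^sub>M time T))
      = (\<integral>t. \<integral>x. (\<integral>v. H x v t \<partial>lborel) * g t \<partial>torus \<partial>time T)"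
    by (rule torus_time.integral_snd[symmetric]) (use i2 in \<open>simp add: case_prod_unfold\<close>)
  also have "\<dots> = (\<integral>t. (\<integral>(x, v). H x v t \<partial>phase) * g t \<partial>time T)"
  proof (intro Bochner_Integration.integral_cong refl)
    fix t assume "t \<in> space (time T)"
    then have "integrable (torus \<Otimes>\<^sub>M lborel) (\<lambda>(x, v). H x v t)" using H
      by (simp add: space_time phase_def)
    from torus_lborel.integral_fst'[OF this]
    have "(\<integral>x. \<integral>v. H x v t \<partial>lborel \<partial>torus) = (\<integral>(x, v). H x v t \<partial>phase)" by (simp add: phase_def)
    then show "(\<integral>x. (\<integral>v. H x v t \<partial>lborel) * g t \<partial>torus) = (\<integral>(x, v). H x v t \<partial>phase) * g t"
      by simp
  qed
  finally show "(\<integral>(x, t). (\<integral>v. H x v t \<partial>lborel) * g t \<partial>(torus \<Otimes>\<^sub>M time T))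
      = (\<integral>t. (\<integral>(x, v). H x v t \<partial>phase) * g t \<partial>time T)" .
qed

section \<open>The comparison principle\<close>

lemma integral_abs_add_sub_eq:
  fixes f M :: "'z \<Rightarrow> real"
  assumes "integrable N f" "integrable N M"
  shows "integrable N (\<lambda>z. \<bar>f z - M z\<bar>)" "integrable N (\<lambda>z. \<bar>f z\<bar>)"
    and "(\<integral>z. \<bar>f z - M z\<bar> + \<bar>f z\<bar> - M z \<partial>N) = (\<integral>z. \<bar>f z - M z\<bar> \<partial>N) + (\<integral>z. \<bar>f z\<bar> \<partial>N) - (\<integral>z. M z \<partial>N)"
proof -
  show i: "integrable N (\<lambda>z. \<bar>f z - M z\<bar>)" "integrable N (\<lambda>z. \<bar>f z\<bar>)"
    using assms by auto
  show "(\<integral>z. \<bar>f z - M z\<bar> + \<bar>f z\<bar> - M z \<partial>N) = (\<integral>z. \<bar>f z - M z\<bar> \<partial>N) + (\<integral>z. \<bar>f z\<bar> \<partial>N) - (\<integral>z. M z \<partial>N)"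
    using i assms(2) by simp
qed

context hard_potential
begin

text \<open>For a test function that depends on time only the divergence term disappears.\<close>

lemma dissipative_time_inequality:
  fixes f g :: "real^'n \<Rightarrow> real^'n \<Rightarrow> real \<Rightarrow> real"
  assumes diss: "dissipative_solution s B \<beta> T f"
    and g: "sufficiently_regular B \<beta> T g (\<lambda>x v t. 0)"
    and test: "test_xt T (\<lambda>(x :: real^'n, t). \<zeta> t)" "\<And>t. 0 \<le> \<zeta> t"
    and deriv: "\<And>t. (\<zeta> has_real_derivative \<zeta>' t) (at t)"
    and sign: "AE (x, t) in torus \<Otimes>\<^sub>M time T.
      (\<integral>v. Q_bilin B \<beta> (\<lambda>u. f x u t) (\<lambda>u. g x u t) v * sign_at_0 s (f x v t - g x v t) \<partial>lborel) \<le> 0"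
  shows "0 \<le> (\<integral>(x, t). (\<integral>v. \<bar>f x v t - g x v t\<bar> \<partial>lborel) * \<zeta>' t \<partial>(torus \<Otimes>\<^sub>M time T))"
proof -
  let ?\<psi> = "\<lambda>(x :: real^'n, t). \<zeta> t"
  have fd: "frechet_derivative (\<lambda>p. \<zeta> (snd p)) (at y) b = snd b * \<zeta>' (snd y)" for y b ::
    "(real^'n) \<times> real"
    using frechet_derivative_snd(2)[of \<zeta> "\<zeta>' (snd y)" y 1] deriv[of "snd y"] by simp
  have "- (\<integral>(x, t). (\<integral>v. \<bar>f x v t - g x v t\<bar> \<partial>lborel) * frechet_derivative ?\<psi> (at (x, t)) (0, 1)
             + frechet_derivative ?\<psi> (at (x, t)) (\<integral>v. \<bar>f x v t - g x v t\<bar> *\<^sub>R v \<partial>lborel, 0)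
           \<partial>(torus \<Otimes>\<^sub>M time T))
        \<le> (\<integral>(x, t). (\<integral>v. (Q_bilin B \<beta> (\<lambda>u. f x u t) (\<lambda>u. g x u t) v - 0)
                          * sign_at_0 s (f x v t - g x v t) \<partial>lborel) * ?\<psi> (x, t)
           \<partial>(torus \<Otimes>\<^sub>M time T))"
    using diss g test unfolding dissipative_solution_def
      by (elim conjE allE[of _ g] allE[of _ "\<lambda>x v t. 0"] allE[of _ ?\<psi>]) auto
  also have "\<dots> \<le> 0"
  proof -
    \<comment> \<open>The integrand is negated because nonnegativity of a Bochner integral holds
      without knowing integrability.\<close>
    have "0 \<le> (\<integral>(x, t). - ((\<integral>v. (Q_bilin B \<beta> (\<lambda>u. f x u t) (\<lambda>u. g x u t) v - 0)
                          * sign_at_0 s (f x v t - g x v t) \<partial>lborel) * ?\<psi> (x, t))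
           \<partial>(torus \<Otimes>\<^sub>M time T))"
      using sign by (intro integral_nonneg_AE, eventually_elim) (auto simp: test(2) mult_nonpos_nonneg)
    then show ?thesis by (simp add: case_prod_unfold)
  qed
  finally show ?thesis by (simp add: fd case_prod_unfold)
qed

text \<open>Two details of the sign argument matter: s in [-1, 1] keeps 1 + sign nonnegative also
  where f = M, and the strict inequality in \<open>low\<close> excludes that case for |v| < R, so
  that the sign is exactly -1 there.\<close>

lemma Q_bilin_sign_nonpos:
  fixes f :: "real^'n \<Rightarrow> real" and a c s :: real
  assumes f[measurable]: "f \<in> borel_measurable borel" and nonneg: "AE w in lborel. 0 \<le> f w"
    and a: "0 < a" and m: "moment f \<noteq> \<infinity>" and s: "s \<in> {-1..1}"
    and low: "AE v in lborel. norm v < R \<longrightarrow> f v < maxwellian a c v"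
    and high: "\<And>v. R \<le> norm v \<Longrightarrow> Q_bilin B \<beta> f (maxwellian a c) v \<le> 0"
  shows "(\<integral>v. Q_bilin B \<beta> f (maxwellian a c) v * sign_at_0 s (f v - maxwellian a c v) \<partial>lborel) \<le> 0"
proof -
  let ?Q = "Q_bilin B \<beta> f (maxwellian a c)"
  let ?S = "\<lambda>v. sign_at_0 s (f v - maxwellian a c v)"
  have Q: "integrable lborel ?Q"
    unfolding Q_bilin_def[abs_def] by (intro Bochner_Integration.integrable_diff Q_integrable f a m)
  have Q0: "(\<integral>v. ?Q v \<partial>lborel) = 0"
    unfolding Q_bilin_def[abs_def]
    by (simp add: Q_integrable[OF f a m] integral_Q_plus_eq_Q_minus[OF f nonneg a m])
  have Sm: "?S \<in> borel_measurable borel"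
    unfolding sign_at_0_def sgn_real_def by measurable
  have S: "\<bar>?S v\<bar> \<le> 1" for v using s by (auto simp: sign_at_0_def sgn_real_def)
  have QS: "integrable lborel (\<lambda>v. ?Q v * ?S v)"
  proof (rule Bochner_Integration.integrable_bound[OF Q])
    show "(\<lambda>v. ?Q v * ?S v) \<in> borel_measurable lborel" using Q Sm by auto
    show "AE v in lborel. norm (?Q v * ?S v) \<le> norm (?Q v)"
      using S by (auto simp: abs_mult intro!: mult_left_le)
  qed
  have "AE v in lborel. 0 \<le> - (?Q v + ?Q v * ?S v)"
    using low
  proof eventually_elim
    case (elim v)
    show ?case
    proof (cases "norm v < R")
      case True
      then have "?S v = -1" using elim by (auto simp: sign_at_0_def sgn_real_def)
      then show ?thesis by simp
    next
      case False
      then have "?Q v * (1 + ?S v) \<le> 0" using high[of v] S[of v] by (intro mult_nonpos_nonneg) auto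
      then show ?thesis by (simp add: distrib_left)
    qed
  qed
  then have "0 \<le> (\<integral>v. - (?Q v + ?Q v * ?S v) \<partial>lborel)" by (rule integral_nonneg_AE)
  also have "\<dots> = - ((\<integral>v. ?Q v \<partial>lborel) + (\<integral>v. ?Q v * ?S v \<partial>lborel))" using Q QS by simp
  finally show ?thesis using Q0 by simp
qed

text \<open>Here R and c are already fixed: assumption \<open>R\<close> gives the sign of Q(f, M)
  outside the ball, and \<open>low\<close> the room above C0 inside it. What remains is the monotone
  quantity and its initial value.\<close>

lemma maxwellian_upper_bound:
  fixes f :: "real^'n \<Rightarrow> real^'n \<Rightarrow> real \<Rightarrow> real" and a c a1 c1 \<rho>0 C0 C1 s T R :: real
  assumes a: "0 < a" and T: "0 < T" and s: "s \<in> {-1..1}"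
    and R: "\<And>f v c. f \<in> borel_measurable borel \<Longrightarrow> AE w in lborel. 0 \<le> f w \<Longrightarrow> \<rho>0 \<le> (\<integral>w. f w \<partial>lborel)
      \<Longrightarrow> (\<integral>\<^sup>+w. ennreal (f w / maxwellian a1 c1 w) \<partial>lborel) \<le> ennreal C1
      \<Longrightarrow> R \<le> norm v \<Longrightarrow> Q_bilin B \<beta> f (maxwellian a c) v \<le> 0"
    and low: "\<And>v :: real^'n. norm v < R \<Longrightarrow> C0 < maxwellian a c v"
    and diss: "dissipative_solution s B \<beta> T f"
    and init: "AE (x, v) in phase. f x v 0 \<le> maxwellian a c v"
    and mass: "\<forall>t\<in>{0..T}. AE x in torus. \<rho>0 \<le> (\<integral>v. f x v t \<partial>lborel)"
    and bounded: "\<forall>t\<in>{0..T}. AE x in torus. AE v in lborel. \<bar>f x v t\<bar> \<le> C0"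
    and tail: "\<forall>t\<in>{0..T}. AE x in torus.
        (\<integral>\<^sup>+v. ennreal (f x v t / maxwellian a1 c1 v) \<partial>lborel) \<le> ennreal C1"
    and t: "t \<in> {0..T}"
  shows "AE (x, v) in phase. f x v t \<le> maxwellian a c v"
proof -
  define M :: "real^'n \<Rightarrow> real" where "M = maxwellian a c"
  have fc: "cont_L1 T f" and sm: "second_moment_bounded T f"
    and nonneg: "\<And>t. t \<in> {0..T} \<Longrightarrow> AE (x, v) in phase. 0 \<le> f x v t"
    using diss by (auto simp: dissipative_solution_def renormalized_solution_def)
  have fm: "(\<lambda>(x, v, t). f x v t) \<in> borel_measurable (phase_time T)"
    and fi: "\<And>t. t \<in> {0..T} \<Longrightarrow> integrable phase (\<lambda>(x, v). f x v t)"
    using fc by (auto simp: cont_L1_def)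
  have Mi: "integrable phase (\<lambda>(x :: real^'n, v). M v)"
    using maxwellian_cont_L1(1)[OF a, where 'n = 'n, of T c] T by (auto simp: cont_L1_def M_def)
  have Mm: "(\<lambda>(x :: real^'n, v, t :: real). M v) \<in> borel_measurable (phase_time T)"
    using maxwellian_cont_L1(1)[OF a, where 'n = 'n, of T c] by (auto simp: cont_L1_def M_def)
  have fs: "(\<lambda>v. f x v t) \<in> borel_measurable borel" if "x \<in> space torus" "t \<in> {0..T}" for x t
    using phase_time_slice[OF fm that] by simp
  have fp: "(\<lambda>(y, v). f (fst y) v (snd y)) \<in> borel_measurable ((torus \<Otimes>\<^sub>M time T) \<Otimes>\<^sub>M lborel)"
    using phase_time_permute(1)[OF fm] by (simp add: case_prod_unfold)
  have [measurable]: "(\<lambda>y. f (fst y) (fst (snd y)) (snd (snd y))) \<in> borel_measurable (phase_time T)"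
    using fm by (simp add: case_prod_unfold)
  have 1: "AE (x, t) in torus \<Otimes>\<^sub>M time T. AE v in lborel. 0 \<le> f x v t"
  proof (rule AE_torus_time_velocity)
    show "Measurable.pred (phase_time T) (\<lambda>(x, v, t). 0 \<le> f x v t)"
      unfolding case_prod_unfold by measurable
    fix t assume "t \<in> {0..T}"
    from torus_lborel.AE_pair[OF nonneg[OF this, unfolded phase_def]]
    show "AE x in torus. AE v in lborel. 0 \<le> f x v t" by simp
  qed
  have 2: "AE (x, t) in torus \<Otimes>\<^sub>M time T. AE v in lborel. \<bar>f x v t\<bar> \<le> C0"
  proof (rule AE_torus_time_velocity)
    show "Measurable.pred (phase_time T) (\<lambda>(x, v, t). \<bar>f x v t\<bar> \<le> C0)"
      unfolding case_prod_unfold by measurable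
  qed (use bounded in auto)
  have 3: "AE (x, t) in torus \<Otimes>\<^sub>M time T. \<rho>0 \<le> (\<integral>v. f x v t \<partial>lborel)"
  proof (rule AE_torus_time)
    have "(\<lambda>y. \<integral>v. f (fst y) v (snd y) \<partial>lborel) \<in> borel_measurable (torus \<Otimes>\<^sub>M time T)"
      using fp by (rule lborel.borel_measurable_lebesgue_integral)
    then show "Measurable.pred (torus \<Otimes>\<^sub>M time T) (\<lambda>(x, t). \<rho>0 \<le> (\<integral>v. f x v t \<partial>lborel))"
      unfolding case_prod_unfold by measurable
  qed (use mass in auto)
  have 4: "AE (x, t) in torus \<Otimes>\<^sub>M time T. (\<integral>\<^sup>+v. ennreal (f x v t / maxwellian a1 c1 v) \<partial>lborel)
      \<le> ennreal C1"
  proof (rule AE_torus_time)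
    have "(\<lambda>z. f (fst (fst z)) (snd z) (snd (fst z)) / maxwellian a1 c1 (snd z))
        \<in> borel_measurable ((torus \<Otimes>\<^sub>M time T) \<Otimes>\<^sub>M lborel)"
      using fp by (intro borel_measurable_divide maxwellian_measurable) (simp_all add: case_prod_unfold)
    then have "(\<lambda>z. ennreal (f (fst (fst z)) (snd z) (snd (fst z)) / maxwellian a1 c1 (snd z)))
        \<in> borel_measurable ((torus \<Otimes>\<^sub>M time T) \<Otimes>\<^sub>M lborel)"
      by measurable
    from lborel.borel_measurable_nn_integral_fst[OF this]
    have "(\<lambda>y. \<integral>\<^sup>+v. ennreal (f (fst y) v (snd y) / maxwellian a1 c1 v) \<partial>lborel)
        \<in> borel_measurable (torus \<Otimes>\<^sub>M time T)"
      by simp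
    then show "Measurable.pred (torus \<Otimes>\<^sub>M time T) (\<lambda>(x, t). (\<integral>\<^sup>+v. ennreal (f x v t / maxwellian a1 c1 v) \<partial>lborel) \<le> ennreal C1)"
      unfolding case_prod_unfold by measurable
  qed (use tail in auto)
  have 5: "AE y in torus \<Otimes>\<^sub>M time T. (case y of (x, t) \<Rightarrow> moment (\<lambda>v. f x v t)) \<noteq> \<infinity>"
    using moment_phase_time_finite[OF fc sm] by (intro nn_integral_PInf_AE moment_measurable fm) auto
  have sign: "AE (x, t) in torus \<Otimes>\<^sub>M time T.
      (\<integral>v. Q_bilin B \<beta> (\<lambda>u. f x u t) M v * sign_at_0 s (f x v t - M v) \<partial>lborel) \<le> 0"
    using 1 2 3 4 5 AE_space
  proof eventually_elim
    case (elim y)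
    obtain x t where y: "y = (x, t)" by (cases y)
    have xt: "x \<in> space torus" "t \<in> {0..T}" using elim(6)
      by (auto simp: y space_pair_measure space_time)
    have nn: "AE v in lborel. 0 \<le> f x v t" using elim(1) by (simp add: y)
    have "AE v in lborel. norm v < R \<longrightarrow> f x v t < M v"
    proof -
      have "AE v in lborel. \<bar>f x v t\<bar> \<le> C0" using elim(2) by (simp add: y)
      then show ?thesis by eventually_elim (use low in \<open>force simp: M_def\<close>)
    qed
    then have "(\<integral>v. Q_bilin B \<beta> (\<lambda>u. f x u t) M v * sign_at_0 s (f x v t - M v) \<partial>lborel) \<le> 0"
      unfolding M_def
      using elim(3-5) by (intro Q_bilin_sign_nonpos[OF fs[OF xt] nn a _ s] R[OF fs[OF xt] nn])
        (auto simp: y)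
    then show ?case by (simp add: y)
  qed

  \<comment> \<open>For f \<ge> 0 the combination \<alpha> + \<nu> - \<mu> is twice the integral of
    the positive part of f - M. The mass is kept as the integral of |f|, since that is what the
    inequality with g = 0 controls.\<close>
  define \<alpha> where "\<alpha> t = (\<integral>(x, v). \<bar>f x v t - M v\<bar> \<partial>phase)" for t
  define \<nu> where "\<nu> t = (\<integral>(x, v). \<bar>f x v t\<bar> \<partial>phase)" for t
  define \<mu> where "\<mu> = (\<integral>(x :: real^'n, v). M v \<partial>phase)"
  have i\<alpha>: "integrable phase (\<lambda>(x, v). \<bar>f x v t - M v\<bar>)" if "t \<in> {0..T}" for t
    using integral_abs_add_sub_eq(1)[OF fi[OF that] Mi] by (simp add: case_prod_unfold)
  have i\<nu>: "integrable phase (\<lambda>(x, v). \<bar>f x v t\<bar>)" if "t \<in> {0..T}" for t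
    using integral_abs_add_sub_eq(2)[OF fi[OF that] Mi] by (simp add: case_prod_unfold)
  have c\<alpha>: "continuous_on {0..T} \<alpha>"
    unfolding \<alpha>_def[abs_def] by (rule cont_L1_integral_continuous[OF fc i\<alpha>, where L = 1]) auto
  have c\<nu>: "continuous_on {0..T} \<nu>"
    unfolding \<nu>_def[abs_def] by (rule cont_L1_integral_continuous[OF fc i\<nu>, where L = 1]) auto
  define m where "m t = \<alpha> t + \<nu> t - \<mu>" for t
  have cm: "continuous_on {0..T} m" unfolding m_def[abs_def] by (intro continuous_intros c\<alpha> c\<nu>)
  have bound: "\<exists>C. \<forall>t\<in>{0..T}. u t \<le> C" if "continuous_on {0..T} u" for u :: "real \<Rightarrow> real"
  proof -
    have "bounded (u ` {0..T})" using that by (intro compact_imp_bounded compact_continuous_image) auto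
    then show ?thesis unfolding bounded_iff by (metis abs_le_D1 imageI real_norm_def)
  qed
  have weak: "0 \<le> (\<integral>t. m t * \<zeta>' t \<partial>time T)"
    if \<zeta>: "test_xt T (\<lambda>(x :: real^'n, t). \<zeta> t)" "\<And>t. 0 \<le> \<zeta> t"
      "\<And>t. (\<zeta> has_real_derivative \<zeta>' t) (at t)" "continuous_on UNIV \<zeta>'" "\<zeta> 0 = 0" "\<zeta> T = 0" for \<zeta> \<zeta>'
  proof -
    obtain C where C: "\<forall>t\<in>{0..T}. \<alpha> t \<le> C" using bound[OF c\<alpha>] by blast
    obtain D where D: "\<forall>t\<in>{0..T}. \<nu> t \<le> D" using bound[OF c\<nu>] by blast
    have "0 \<le> (\<integral>(x, t). (\<integral>v. \<bar>f x v t - M v\<bar> \<partial>lborel) * \<zeta>' t \<partial>(torus \<Otimes>\<^sub>M time T))"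
      using sufficiently_regular_maxwellian[OF a, of T c] T sign
      by (intro dissipative_time_inequality[OF diss _ \<zeta>(1-3)]) (simp_all add: M_def)
    also have "\<dots> = (\<integral>t. \<alpha> t * \<zeta>' t \<partial>time T)"
      unfolding \<alpha>_def
    proof (rule integral_torus_time_velocity(2)[where H = "\<lambda>x v t. \<bar>f x v t - M v\<bar>", OF _ i\<alpha> _ \<zeta>(4)])
      show "(\<lambda>(x, v, t). \<bar>f x v t - M v\<bar>) \<in> borel_measurable (phase_time T)"
        using borel_measurable_abs[OF borel_measurable_diff[OF fm Mm]] by (simp add: case_prod_unfold)
      show "(\<integral>(x, v). \<bar>\<bar>f x v t - M v\<bar>\<bar> \<partial>phase) \<le> C" if "t \<in> {0..T}" for t
        using bspec[OF C that] by (simp add: \<alpha>_def)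
    qed
    finally have A: "0 \<le> (\<integral>t. \<alpha> t * \<zeta>' t \<partial>time T)" .
    have "0 \<le> (\<integral>(x, t). (\<integral>v. \<bar>f x v t - 0\<bar> \<partial>lborel) * \<zeta>' t \<partial>(torus \<Otimes>\<^sub>M time T))"
      using sufficiently_regular_zero[of T] T
      by (intro dissipative_time_inequality[OF diss _ \<zeta>(1-3)])
        (simp_all add: Q_bilin_def Q_plus_def Q_minus_def gain_integrand_def case_prod_unfold)
    also have "\<dots> = (\<integral>t. \<nu> t * \<zeta>' t \<partial>time T)"
      unfolding \<nu>_def diff_0_right
    proof (rule integral_torus_time_velocity(2)[where H = "\<lambda>x v t. \<bar>f x v t\<bar>", OF _ i\<nu> _ \<zeta>(4)])
      show "(\<lambda>(x, v, t). \<bar>f x v t\<bar>) \<in> borel_measurable (phase_time T)"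
        using borel_measurable_abs[OF fm] by (simp add: case_prod_unfold)
      show "(\<integral>(x, v). \<bar>\<bar>f x v t\<bar>\<bar> \<partial>phase) \<le> D" if "t \<in> {0..T}" for t
        using bspec[OF D that] by (simp add: \<nu>_def)
    qed
    finally have N: "0 \<le> (\<integral>t. \<nu> t * \<zeta>' t \<partial>time T)" .
    have Z: "(\<integral>t. \<zeta>' t \<partial>time T) = 0"
      using integral_time_derivative[OF _ \<zeta>(3,4)] T \<zeta>(5,6) by simp
    have c': "continuous_on {0..T} \<zeta>'" by (rule continuous_on_subset[OF \<zeta>(4)]) simp
    have "(\<integral>t. m t * \<zeta>' t \<partial>time T) = (\<integral>t. \<alpha> t * \<zeta>' t + \<nu> t * \<zeta>' t - \<mu> * \<zeta>' t \<partial>time T)"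
      by (simp add: m_def algebra_simps)
    also have "\<dots> = (\<integral>t. \<alpha> t * \<zeta>' t \<partial>time T) + (\<integral>t. \<nu> t * \<zeta>' t \<partial>time T) - \<mu> * (\<integral>t. \<zeta>' t \<partial>time T)"
      by (simp add: integrable_continuous_time continuous_on_mult c\<alpha> c\<nu> c')
    finally show ?thesis using A N Z by simp
  qed
  have m_eq: "m t = (\<integral>z. \<bar>(case z of (x, v) \<Rightarrow> f x v t) - (case z of (x, v) \<Rightarrow> M v)\<bar>
      + \<bar>case z of (x, v) \<Rightarrow> f x v t\<bar> - (case z of (x, v) \<Rightarrow> M v) \<partial>phase)" if "t \<in> {0..T}" for t
    using integral_abs_add_sub_eq(3)[OF fi[OF that] Mi]
    by (simp add: m_def \<alpha>_def \<nu>_def \<mu>_def case_prod_unfold)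
  have t0: "0 \<in> {0..T}" using T by simp
  \<comment> \<open>Initially 0 \<le> f \<le> M almost everywhere, and the integrand is (M - f) + f
    - M.\<close>
  have "m 0 = (\<integral>z. 0 \<partial>(phase :: ((real^'n) \<times> (real^'n)) measure))"
    unfolding m_eq[OF t0]
  proof (rule integral_cong_AE)
    show "AE z in phase. \<bar>(case z of (x, v) \<Rightarrow> f x v 0) - (case z of (x, v) \<Rightarrow> M v)\<bar>
      + \<bar>case z of (x, v) \<Rightarrow> f x v 0\<bar> - (case z of (x, v) \<Rightarrow> M v) = 0"
      using init nonneg[OF t0] by eventually_elim (auto simp: M_def)
    show "(\<lambda>z. \<bar>(case z of (x, v) \<Rightarrow> f x v 0) - (case z of (x, v) \<Rightarrow> M v)\<bar>
      + \<bar>case z of (x, v) \<Rightarrow> f x v 0\<bar> - (case z of (x, v) \<Rightarrow> M v)) \<in> borel_measurable phase"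
      by (intro borel_measurable_diff borel_measurable_add borel_measurable_abs
          borel_measurable_integrable[OF fi[OF t0]] borel_measurable_integrable[OF Mi])
  qed simp
  moreover have "m t \<le> m 0" by (rule weakly_nonincreasing[OF T cm _ t, where 'n = 'n]) (rule weak)
  ultimately have "m t \<le> 0" by simp
  let ?h = "\<lambda>z. \<bar>(case z of (x, v) \<Rightarrow> f x v t) - (case z of (x, v) \<Rightarrow> M v)\<bar>
      + \<bar>case z of (x, v) \<Rightarrow> f x v t\<bar> - (case z of (x, v) \<Rightarrow> M v)"
  \<comment> \<open>The triangle inequality makes the integrand nonnegative; it is positive where f
    > M, so a vanishing integral gives the claim.\<close>
  have h0: "0 \<le> ?h z" for z by linarith
  have hi: "integrable phase ?h"
    using integral_abs_add_sub_eq(1,2)[OF fi[OF t] Mi] Mi by auto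
  have "(\<integral>z. ?h z \<partial>phase) = 0"
  proof (rule antisym)
    show "(\<integral>z. ?h z \<partial>phase) \<le> 0" using \<open>m t \<le> 0\<close> by (simp only: m_eq[OF t])
    show "0 \<le> (\<integral>z. ?h z \<partial>phase)" by (intro integral_nonneg_AE AE_I2 h0)
  qed
  then have "AE z in phase. ?h z = 0"
    using integral_nonneg_eq_0_iff_AE[OF hi] h0 by simp
  then show ?thesis
    by eventually_elim (auto simp: M_def split: prod.splits)
qed

end

text \<open>That c depends only on the data is expressed by the order of quantifiers: c is chosen
  before T, f, f0 and the value s assigned to sign(0).\<close>

theorem theorem3:
  fixes B :: "real^'n \<Rightarrow> real^'n \<Rightarrow> real" and \<beta> :: real and h :: "real \<Rightarrow> real"
    and a a0 c0 a1 c1 \<rho>0 C0 C1 :: real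
  assumes "2 \<le> CARD('n)"
    and "hard_potential_cutoff B \<beta> h"
    and "0 < a" "a < a1" "a1 < a0" "0 < \<rho>0"
  shows "\<exists>c. \<forall>T f (f0 :: real^'n \<Rightarrow> real^'n \<Rightarrow> real) s.
     0 < T \<and> s \<in> {-1..1} \<and>
     dissipative_solution s B \<beta> T f \<and>
     (AE (x, v) in phase. f x v 0 = f0 x v \<and> f0 x v \<le> maxwellian a0 c0 v) \<and>
     (\<forall>t\<in>{0..T}. AE x in torus. \<rho>0 \<le> (\<integral>v. f x v t \<partial>lborel)) \<and>
     (\<forall>t\<in>{0..T}. AE x in torus. AE v in lborel. \<bar>f x v t\<bar> \<le> C0) \<and>
     (\<forall>t\<in>{0..T}. AE x in torus.
        (\<integral>\<^sup>+v. ennreal (f x v t / maxwellian a1 c1 v) \<partial>lborel) \<le> ennreal C1)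
     \<longrightarrow> (\<forall>t\<in>{0..T}. AE (x, v) in phase. f x v t \<le> maxwellian a c v)"
proof -
  interpret hard_potential B \<beta> h using assms(1,2) by unfold_locales
  obtain R where R: "1 \<le> R"
    "\<And>f v c. f \<in> borel_measurable borel \<Longrightarrow> AE w in lborel. 0 \<le> f w \<Longrightarrow> \<rho>0 \<le> (\<integral>w. f w \<partial>lborel)
      \<Longrightarrow> (\<integral>\<^sup>+w. ennreal (f w / maxwellian a1 c1 w) \<partial>lborel) \<le> ennreal C1
      \<Longrightarrow> R \<le> norm v \<Longrightarrow> Q_bilin B \<beta> f (maxwellian a c) v \<le> 0"
    by (rule Q_bilin_maxwellian_nonpos[OF assms(3,4,6), of c1 C1], rule that)
  \<comment> \<open>The second entry gives M \<ge> |C0| + 1 on the ball of radius R, hence strictly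
    more than f; with the first entry and a < a0 the Maxwellian also dominates the initial bound.
    The \<open>+ 1\<close> provides both strictness and a positive argument of the
    logarithm.\<close>
  define c where "c = max c0 (a * R\<^sup>2 + ln (\<bar>C0\<bar> + 1))"
  have low: "C0 < maxwellian a c v" if "norm v < R" for v :: "real^'n"
  proof -
    have "a * (norm v)\<^sup>2 \<le> a * R\<^sup>2" using assms(3) that by (intro mult_left_mono power_mono) auto
    then have "ln (\<bar>C0\<bar> + 1) \<le> - a * (norm v)\<^sup>2 + c" by (simp add: c_def)
    then have "exp (ln (\<bar>C0\<bar> + 1)) \<le> maxwellian a c v"
      unfolding maxwellian_def by (rule exp_le_cancel_iff[THEN iffD2])
    moreover have "exp (ln (\<bar>C0\<bar> + 1)) = \<bar>C0\<bar> + 1" by (rule exp_ln) simp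
    ultimately show ?thesis by linarith
  qed
  have M0: "maxwellian a0 c0 v \<le> maxwellian a c v" for v :: "real^'n"
  proof -
    have "a * (norm v)\<^sup>2 \<le> a0 * (norm v)\<^sup>2" using assms(4,5) by (intro mult_right_mono) auto
    then show ?thesis by (simp add: maxwellian_def c_def)
  qed
  show ?thesis
  proof (intro exI[of _ c] allI impI, elim conjE, intro ballI)
    fix T s t :: real and f f0
    assume hyp: "0 < T" "s \<in> {-1..1}" "dissipative_solution s B \<beta> T f"
      "\<forall>t\<in>{0..T}. AE x in torus. \<rho>0 \<le> (\<integral>v. f x v t \<partial>lborel)"
      "\<forall>t\<in>{0..T}. AE x in torus. AE v in lborel. \<bar>f x v t\<bar> \<le> C0"
      "\<forall>t\<in>{0..T}. AE x in torus. (\<integral>\<^sup>+v. ennreal (f x v t / maxwellian a1 c1 v) \<partial>lborel) \<le> ennreal C1"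
      and t: "t \<in> {0..T}"
      and "AE (x, v) in phase. f x v 0 = f0 x v \<and> f0 x v \<le> maxwellian a0 c0 v"
    from this(8) have init: "AE (x, v) in phase. f x v 0 \<le> maxwellian a c v"
      by eventually_elim (use M0 in \<open>auto intro: order_trans\<close>)
    show "AE (x, v) in phase. f x v t \<le> maxwellian a c v"
    proof (rule maxwellian_upper_bound[where R = R])
      show "Q_bilin B \<beta> f (maxwellian a c) v \<le> 0"
        if "f \<in> borel_measurable borel" "AE w in lborel. 0 \<le> f w" "\<rho>0 \<le> (\<integral>w. f w \<partial>lborel)"
          "(\<integral>\<^sup>+w. ennreal (f w / maxwellian a1 c1 w) \<partial>lborel) \<le> ennreal C1" "R \<le> norm v" for f v c
        using that by (rule R(2))
    qed (fact assms(3) hyp init low t)+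
  qed
qed

end
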